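(* Let $\mathcal{A}=D(a,\sigma)$ be a generalized Weyl algebra of degree $\alpha$ (a finite or infinite ordinal) with base ring $D$ which is regular and of surjective type. Let $S$ be the multiplicatively closed subset of $D$ generated by the elements $\sigma_j^m(a_i)$, $i,j<\alpha$, $m\in\mathbb{Z}$. Then $S$ is $\sigma$-stable and $\mathcal{A}_S\simeq D_S*\mathbb{Z}^{\oplus\alpha}$.
   Context: Rings are $\mathsf{k}$-algebras over an arbitrary field $\mathsf{k}$ (not necessarily commutative). Generalized Weyl algebra (GWA): let $D$ be a ring, $\alpha$ an ordinal, $\sigma=\langle\sigma_\beta\rangle_{\beta<\alpha}$ commuting automorphisms of $D$, and $a=\langle a_\beta\rangle_{\beta<\alpha}$ nonzero elements of the center of $D$ with $\sigma_\beta(a_\gamma)=a_\gamma$ for $\gamma\neq\beta$. The GWA $D(a,\sigma)$ of degree $\alpha$ and base ring $D$ is generated over $D$ by $X_\beta^+,X_\beta^-$ ($\beta<\alpha$) with relations $X_\beta^{+}d=\sigma_\beta(d)X_\beta^{+}$, $X_\beta^{-}d=\sigma_\beta^{-1}(d)X_\beta^{-}$ for $d\in D$; $[X_\beta^+,X_\gamma^+]=[X_\beta^-,X_\gamma^-]=[X_\beta^+,X_\gamma^-]=0$ for $\beta\neq\gamma$; $X_\beta^-X_\beta^+=a_\beta$, $X_\beta^+X_\beta^-=\sigma_\beta(a_\beta)$. The GWA is regular if every $a_\beta$ is a regular element (non-zero-divisor) of $D$. $\mathbb{Z}^{\oplus\alpha}$ is the group of finitely supported integer sequences indexed by $\beta<\alpha$.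 Let $\Sigma$ be the subgroup of $\mathrm{Aut}\,D$ generated by the $\sigma_\beta$; the GWA is of surjective type if the natural surjective homomorphism $\xi:\mathbb{Z}^{\oplus\alpha}\to\Sigma$, sending the $\beta$-th basis vector to $\sigma_\beta$, is an isomorphism. A subset $S\subset D$ is $\sigma$-stable if $\sigma_\beta^j(S)\subset S$ for all $\beta<\alpha$, $j\in\mathbb{Z}$. $D_S$, $\mathcal{A}_S$ denote localizations at $S$ (which consists of central regular elements of $D$), and $D_S*\mathbb{Z}^{\oplus\alpha}$ is the skew group ring where $\mathbb{Z}^{\oplus\alpha}$ acts on $D_S$ through $\xi$. *)

theory Defs
  imports "HOL-Algebra.Algebra"
begin

section \<open>Associative algebras over a field\<close>

text \<open>
  The locale \<^locale>\<open>algebra\<close> of the library assumes a commutative multiplication, so it cannot be used here.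
\<close>

locale assoc_algebra = K?: field K + A?: ring A + module K A
  for K :: "('k, 'm) ring_scheme" (structure) and A :: "('k, 'a, 'n) module_scheme" (structure) +
  assumes smult_mult_left:
      "\<lbrakk>c \<in> carrier K; x \<in> carrier A; y \<in> carrier A\<rbrakk>
        \<Longrightarrow> (c \<odot>\<^bsub>A\<^esub> x) \<otimes>\<^bsub>A\<^esub> y = c \<odot>\<^bsub>A\<^esub> (x \<otimes>\<^bsub>A\<^esub> y)"
    and smult_mult_right:
      "\<lbrakk>c \<in> carrier K; x \<in> carrier A; y \<in> carrier A\<rbrakk>
        \<Longrightarrow> x \<otimes>\<^bsub>A\<^esub> (c \<odot>\<^bsub>A\<^esub> y) = c \<odot>\<^bsub>A\<^esub> (x \<otimes>\<^bsub>A\<^esub> y)"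

definition alg_iso ::
  "('k, 'm) ring_scheme \<Rightarrow> ('k, 'a, 'n) module_scheme \<Rightarrow> ('k, 'b, 'p) module_scheme \<Rightarrow> ('a \<Rightarrow> 'b) set"
where
  "alg_iso K A B = {h \<in> ring_iso A B.
     \<forall>c\<in>carrier K. \<forall>x\<in>carrier A. h (c \<odot>\<^bsub>A\<^esub> x) = c \<odot>\<^bsub>B\<^esub> h x}"

definition alg_isomorphic ::
  "('k, 'm) ring_scheme \<Rightarrow> ('k, 'a, 'n) module_scheme \<Rightarrow> ('k, 'b, 'p) module_scheme \<Rightarrow> bool"
where
  "alg_isomorphic K A B \<longleftrightarrow> assoc_algebra K A \<and> assoc_algebra K B \<and> alg_iso K A B \<noteq> {}"

text \<open>Automorphisms are extensional functions, as in \<^const>\<open>BijGroup\<close>; the product is composition.\<close>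

definition alg_Aut ::
  "('k, 'm) ring_scheme \<Rightarrow> ('k, 'a, 'n) module_scheme \<Rightarrow> ('a \<Rightarrow> 'a) monoid"
where
  "alg_Aut K A = (BijGroup (carrier A))\<lparr>carrier := extensional (carrier A) \<inter> alg_iso K A A\<rparr>"

definition ring_center :: "('a, 'm) ring_scheme \<Rightarrow> 'a set" where
  "ring_center R = {z \<in> carrier R. \<forall>x\<in>carrier R. z \<otimes>\<^bsub>R\<^esub> x = x \<otimes>\<^bsub>R\<^esub> z}"

definition regular_element :: "('a, 'm) ring_scheme \<Rightarrow> 'a \<Rightarrow> bool" where
  "regular_element R z \<longleftrightarrow> z \<in> carrier R \<and>
     (\<forall>x\<in>carrier R. (z \<otimes>\<^bsub>R\<^esub> x = \<zero>\<^bsub>R\<^esub> \<longrightarrow> x = \<zero>\<^bsub>R\<^esub>) \<and> (x \<otimes>\<^bsub>R\<^esub> z = \<zero>\<^bsub>R\<^esub> \<longrightarrow> x = \<zero>\<^bsub>R\<^esub>))"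


section \<open>Algebras given by generators and relations\<close>

definition fin_supp_funs :: "('b, 'm) ring_scheme \<Rightarrow> 'a set \<Rightarrow> ('a \<Rightarrow> 'b) set" where
  "fin_supp_funs R Y =
     {f. (\<forall>y. f y \<in> carrier R) \<and> finite {y. f y \<noteq> \<zero>\<^bsub>R\<^esub>} \<and> {y. f y \<noteq> \<zero>\<^bsub>R\<^esub>} \<subseteq> Y}"

text \<open>
  The free associative algebra on a set \<open>Y\<close>: an element assigns to each word in \<open>Y\<close> its coefficient,
  and a word is multiplied with a word by concatenation.
\<close>

definition free_algebra :: "('k, 'm) ring_scheme \<Rightarrow> 'y set \<Rightarrow> ('k, 'y list \<Rightarrow> 'k) module" where
  "free_algebra K Y =
    \<lparr>carrier = fin_supp_funs K (lists Y),
     monoid.mult = (\<lambda>f g w. \<Oplus>\<^bsub>K\<^esub>i\<in>{..length w}. f (take i w) \<otimes>\<^bsub>K\<^esub> g (drop i w)),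
     one = (\<lambda>w. if w = [] then \<one>\<^bsub>K\<^esub> else \<zero>\<^bsub>K\<^esub>),
     ring.zero = (\<lambda>w. \<zero>\<^bsub>K\<^esub>),
     add = (\<lambda>f g w. f w \<oplus>\<^bsub>K\<^esub> g w),
     smult = (\<lambda>c f w. c \<otimes>\<^bsub>K\<^esub> f w)\<rparr>"

definition free_var :: "('k, 'm) ring_scheme \<Rightarrow> 'y \<Rightarrow> 'y list \<Rightarrow> 'k" where
  "free_var K y = (\<lambda>w. if w = [y] then \<one>\<^bsub>K\<^esub> else \<zero>\<^bsub>K\<^esub>)"

definition quot_algebra :: "('k, 'a, 'n) module_scheme \<Rightarrow> 'a set \<Rightarrow> ('k, 'a set) module" where
  "quot_algebra A I = ring.extend (A Quot I)
     \<lparr>smult = (\<lambda>c C. \<Union>x\<in>C. I +>\<^bsub>A\<^esub> (c \<odot>\<^bsub>A\<^esub> x))\<rparr>"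


section \<open>Generalized Weyl algebras\<close>

text \<open>
  The ordinal \<open>\<alpha>\<close> is represented by a well-order \<open>r\<close>; the indices \<open>\<beta> < \<alpha>\<close> are the elements of \<^term>\<open>Field r\<close>.
  The \<open>\<sigma>\<^sub>\<beta>\<close> are automorphisms of algebras over \<open>K\<close>.
\<close>

locale gwa_data = assoc_algebra K D
  for K :: "('k, 'm) ring_scheme" (structure) and D :: "('k, 'd, 'n) module_scheme" (structure) +
  fixes r :: "'i rel" and \<sigma> :: "'i \<Rightarrow> 'd \<Rightarrow> 'd" and a :: "'i \<Rightarrow> 'd"
  assumes well_order: "Well_order r"
    and sigma_aut: "\<beta> \<in> Field r \<Longrightarrow> \<sigma> \<beta> \<in> carrier (alg_Aut K D)"
    and sigma_commute: "\<lbrakk>\<beta> \<in> Field r; \<gamma> \<in> Field r\<rbrakk>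
        \<Longrightarrow> \<sigma> \<beta> \<otimes>\<^bsub>alg_Aut K D\<^esub> \<sigma> \<gamma> = \<sigma> \<gamma> \<otimes>\<^bsub>alg_Aut K D\<^esub> \<sigma> \<beta>"
    and a_central: "\<beta> \<in> Field r \<Longrightarrow> a \<beta> \<in> ring_center D"
    and a_nonzero: "\<beta> \<in> Field r \<Longrightarrow> a \<beta> \<noteq> \<zero>\<^bsub>D\<^esub>"
    and sigma_fixes_a: "\<lbrakk>\<beta> \<in> Field r; \<gamma> \<in> Field r; \<gamma> \<noteq> \<beta>\<rbrakk> \<Longrightarrow> \<sigma> \<beta> (a \<gamma>) = a \<gamma>"

datatype ('d, 'i) gwa_gen = Base 'd | X_plus 'i | X_minus 'i

definition gwa_gens :: "('k, 'd, 'n) module_scheme \<Rightarrow> 'i rel \<Rightarrow> ('d, 'i) gwa_gen set" where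
  "gwa_gens D r = Base ` carrier D \<union> X_plus ` Field r \<union> X_minus ` Field r"

text \<open>
  An equation \<open>u = v\<close> is represented by the element \<open>u - v\<close>. The first four sets say that
  \<^const>\<open>Base\<close> is a homomorphism of algebras from \<open>D\<close> (\<open>generated over D\<close>); the others are the
  relations between the \<open>X\<^sub>\<beta>\<^sup>+\<close>, the \<open>X\<^sub>\<beta>\<^sup>-\<close> and \<open>D\<close>.
\<close>

definition gwa_relations ::
  "('k, 'm) ring_scheme \<Rightarrow> ('k, 'd, 'n) module_scheme \<Rightarrow> 'i rel \<Rightarrow> ('i \<Rightarrow> 'd \<Rightarrow> 'd) \<Rightarrow> ('i \<Rightarrow> 'd)
    \<Rightarrow> (('d, 'i) gwa_gen list \<Rightarrow> 'k) set"
where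
  "gwa_relations K D r \<sigma> a =
    (let F = free_algebra K (gwa_gens D r);
         b = (\<lambda>d. free_var K (Base d));
         p = (\<lambda>\<beta>. free_var K (X_plus \<beta>));
         m = (\<lambda>\<beta>. free_var K (X_minus \<beta>))
     in {b (d \<oplus>\<^bsub>D\<^esub> e) \<ominus>\<^bsub>F\<^esub> (b d \<oplus>\<^bsub>F\<^esub> b e) | d e. d \<in> carrier D \<and> e \<in> carrier D}
      \<union> {b (d \<otimes>\<^bsub>D\<^esub> e) \<ominus>\<^bsub>F\<^esub> (b d \<otimes>\<^bsub>F\<^esub> b e) | d e. d \<in> carrier D \<and> e \<in> carrier D}
      \<union> {b (c \<odot>\<^bsub>D\<^esub> d) \<ominus>\<^bsub>F\<^esub> (c \<odot>\<^bsub>F\<^esub> b d) | c d. c \<in> carrier K \<and> d \<in> carrier D}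
      \<union> {b \<one>\<^bsub>D\<^esub> \<ominus>\<^bsub>F\<^esub> \<one>\<^bsub>F\<^esub>}
      \<union> {p \<beta> \<otimes>\<^bsub>F\<^esub> b d \<ominus>\<^bsub>F\<^esub> b (\<sigma> \<beta> d) \<otimes>\<^bsub>F\<^esub> p \<beta> | \<beta> d. \<beta> \<in> Field r \<and> d \<in> carrier D}
      \<union> {m \<beta> \<otimes>\<^bsub>F\<^esub> b d \<ominus>\<^bsub>F\<^esub> b ((inv\<^bsub>alg_Aut K D\<^esub> \<sigma> \<beta>) d) \<otimes>\<^bsub>F\<^esub> m \<beta>
          | \<beta> d. \<beta> \<in> Field r \<and> d \<in> carrier D}
      \<union> {p \<beta> \<otimes>\<^bsub>F\<^esub> p \<gamma> \<ominus>\<^bsub>F\<^esub> p \<gamma> \<otimes>\<^bsub>F\<^esub> p \<beta> | \<beta> \<gamma>. \<beta> \<in> Field r \<and> \<gamma> \<in> Field r \<and> \<beta> \<noteq> \<gamma>}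
      \<union> {m \<beta> \<otimes>\<^bsub>F\<^esub> m \<gamma> \<ominus>\<^bsub>F\<^esub> m \<gamma> \<otimes>\<^bsub>F\<^esub> m \<beta> | \<beta> \<gamma>. \<beta> \<in> Field r \<and> \<gamma> \<in> Field r \<and> \<beta> \<noteq> \<gamma>}
      \<union> {p \<beta> \<otimes>\<^bsub>F\<^esub> m \<gamma> \<ominus>\<^bsub>F\<^esub> m \<gamma> \<otimes>\<^bsub>F\<^esub> p \<beta> | \<beta> \<gamma>. \<beta> \<in> Field r \<and> \<gamma> \<in> Field r \<and> \<beta> \<noteq> \<gamma>}
      \<union> {m \<beta> \<otimes>\<^bsub>F\<^esub> p \<beta> \<ominus>\<^bsub>F\<^esub> b (a \<beta>) | \<beta>. \<beta> \<in> Field r}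
      \<union> {p \<beta> \<otimes>\<^bsub>F\<^esub> m \<beta> \<ominus>\<^bsub>F\<^esub> b (\<sigma> \<beta> (a \<beta>)) | \<beta>. \<beta> \<in> Field r})"

definition gwa_ideal where
  "gwa_ideal K D r \<sigma> a = Idl\<^bsub>free_algebra K (gwa_gens D r)\<^esub> (gwa_relations K D r \<sigma> a)"

definition gwa ::
  "('k, 'm) ring_scheme \<Rightarrow> ('k, 'd, 'n) module_scheme \<Rightarrow> 'i rel \<Rightarrow> ('i \<Rightarrow> 'd \<Rightarrow> 'd) \<Rightarrow> ('i \<Rightarrow> 'd)
    \<Rightarrow> ('k, (('d, 'i) gwa_gen list \<Rightarrow> 'k) set) module"
where
  "gwa K D r \<sigma> a = quot_algebra (free_algebra K (gwa_gens D r)) (gwa_ideal K D r \<sigma> a)"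

definition gwa_base ::
  "('k, 'm) ring_scheme \<Rightarrow> ('k, 'd, 'n) module_scheme \<Rightarrow> 'i rel \<Rightarrow> ('i \<Rightarrow> 'd \<Rightarrow> 'd) \<Rightarrow> ('i \<Rightarrow> 'd)
    \<Rightarrow> 'd \<Rightarrow> (('d, 'i) gwa_gen list \<Rightarrow> 'k) set"
where
  "gwa_base K D r \<sigma> a d =
     gwa_ideal K D r \<sigma> a +>\<^bsub>free_algebra K (gwa_gens D r)\<^esub> free_var K (Base d)"

definition gwa_regular :: "('k, 'd, 'n) module_scheme \<Rightarrow> 'i rel \<Rightarrow> ('i \<Rightarrow> 'd) \<Rightarrow> bool" where
  "gwa_regular D r a \<longleftrightarrow> (\<forall>\<beta>\<in>Field r. regular_element D (a \<beta>))"

text \<open>The group \<open>\<Sigma>\<close> and the homomorphism \<open>\<xi>\<close> from the free abelian group on \<^term>\<open>Field r\<close>.\<close>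

definition gwa_Sigma where
  "gwa_Sigma K D r \<sigma> = (alg_Aut K D)\<lparr>carrier := generate (alg_Aut K D) (\<sigma> ` Field r)\<rparr>"

definition gwa_xi ::
  "('k, 'm) ring_scheme \<Rightarrow> ('k, 'd, 'n) module_scheme \<Rightarrow> 'i rel \<Rightarrow> ('i \<Rightarrow> 'd \<Rightarrow> 'd)
    \<Rightarrow> ('i \<Rightarrow>\<^sub>0 int) \<Rightarrow> 'd \<Rightarrow> 'd"
where
  "gwa_xi K D r \<sigma> c =
     (\<Otimes>\<^bsub>gwa_Sigma K D r \<sigma>\<^esub>\<beta>\<in>Poly_Mapping.keys c.
        \<sigma> \<beta> [^]\<^bsub>gwa_Sigma K D r \<sigma>\<^esub> Poly_Mapping.lookup c \<beta>)"

definition gwa_surjective_type where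
  "gwa_surjective_type K D r \<sigma> \<longleftrightarrow>
     gwa_xi K D r \<sigma> \<in> iso (free_Abelian_group (Field r)) (gwa_Sigma K D r \<sigma>)"

definition sigma_stable where
  "sigma_stable K D r \<sigma> S \<longleftrightarrow>
     (\<forall>\<beta>\<in>Field r. \<forall>j::int. (\<sigma> \<beta> [^]\<^bsub>alg_Aut K D\<^esub> j) ` S \<subseteq> S)"

text \<open>Multiplicatively closed sets contain the unit.\<close>

definition gwa_mult_set ::
  "('k, 'm) ring_scheme \<Rightarrow> ('k, 'd, 'n) module_scheme \<Rightarrow> 'i rel \<Rightarrow> ('i \<Rightarrow> 'd \<Rightarrow> 'd) \<Rightarrow> ('i \<Rightarrow> 'd) \<Rightarrow> 'd set"
where
  "gwa_mult_set K D r \<sigma> a =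
     \<Inter>{T. submonoid T D \<and>
          {(\<sigma> j [^]\<^bsub>alg_Aut K D\<^esub> n) (a i) | i j (n::int). i \<in> Field r \<and> j \<in> Field r} \<subseteq> T}"


section \<open>Ore localization\<close>

definition left_denominator_set :: "('a, 'm) ring_scheme \<Rightarrow> 'a set \<Rightarrow> bool" where
  "left_denominator_set R S \<longleftrightarrow> submonoid S R \<and>
     (\<forall>x\<in>carrier R. \<forall>s\<in>S. \<exists>t\<in>S. \<exists>u\<in>carrier R. t \<otimes>\<^bsub>R\<^esub> x = u \<otimes>\<^bsub>R\<^esub> s) \<and>
     (\<forall>x\<in>carrier R. \<forall>s\<in>S. x \<otimes>\<^bsub>R\<^esub> s = \<zero>\<^bsub>R\<^esub> \<longrightarrow> (\<exists>t\<in>S. t \<otimes>\<^bsub>R\<^esub> x = \<zero>\<^bsub>R\<^esub>))"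

text \<open>The pair \<open>(s, x)\<close> stands for the left fraction \<open>s\<^sup>-\<^sup>1 x\<close>.\<close>

definition fraction_rel :: "('a, 'm) ring_scheme \<Rightarrow> 'a set \<Rightarrow> ('a \<times> 'a) rel" where
  "fraction_rel R S =
     {((s, x), (t, y)). s \<in> S \<and> t \<in> S \<and> x \<in> carrier R \<and> y \<in> carrier R \<and>
        (\<exists>u\<in>carrier R. \<exists>v\<in>carrier R.
           u \<otimes>\<^bsub>R\<^esub> s = v \<otimes>\<^bsub>R\<^esub> t \<and> u \<otimes>\<^bsub>R\<^esub> s \<in> S \<and> u \<otimes>\<^bsub>R\<^esub> x = v \<otimes>\<^bsub>R\<^esub> y)}"

text \<open>
  Sums are formed over a common denominator \<open>u s = v t \<in> S\<close>. For products, the Ore condition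
  \<open>w x = u t\<close> with \<open>w \<in> S\<close> gives \<open>x t\<^sup>-\<^sup>1 = w\<^sup>-\<^sup>1 u\<close>, hence \<open>(s\<^sup>-\<^sup>1 x) (t\<^sup>-\<^sup>1 y) = (w s)\<^sup>-\<^sup>1 (u y)\<close>.
  When \<open>S\<close> is a left denominator set, the unions below run over representatives and auxiliary
  elements that all give the same class.
\<close>

definition localization :: "('k, 'a, 'n) module_scheme \<Rightarrow> 'a set \<Rightarrow> ('k, ('a \<times> 'a) set) module" where
  "localization R S =
    (let cls = (\<lambda>q. fraction_rel R S `` {q}) in
    \<lparr>carrier = (S \<times> carrier R) // fraction_rel R S,
     monoid.mult = (\<lambda>P Q. \<Union>{cls (w \<otimes>\<^bsub>R\<^esub> s, u \<otimes>\<^bsub>R\<^esub> y) | s x t y w u.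
               (s, x) \<in> P \<and> (t, y) \<in> Q \<and> w \<in> S \<and> u \<in> carrier R \<and> w \<otimes>\<^bsub>R\<^esub> x = u \<otimes>\<^bsub>R\<^esub> t}),
     one = cls (\<one>\<^bsub>R\<^esub>, \<one>\<^bsub>R\<^esub>),
     ring.zero = cls (\<one>\<^bsub>R\<^esub>, \<zero>\<^bsub>R\<^esub>),
     add = (\<lambda>P Q. \<Union>{cls (u \<otimes>\<^bsub>R\<^esub> s, u \<otimes>\<^bsub>R\<^esub> x \<oplus>\<^bsub>R\<^esub> v \<otimes>\<^bsub>R\<^esub> y) | s x t y u v.
               (s, x) \<in> P \<and> (t, y) \<in> Q \<and> u \<in> carrier R \<and> v \<in> carrier R \<and>
               u \<otimes>\<^bsub>R\<^esub> s = v \<otimes>\<^bsub>R\<^esub> t \<and> u \<otimes>\<^bsub>R\<^esub> s \<in> S}),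
     smult = (\<lambda>c P. \<Union>{cls (s, c \<odot>\<^bsub>R\<^esub> x) | s x. (s, x) \<in> P})\<rparr>)"

definition localization_map ::
  "('k, 'a, 'n) module_scheme \<Rightarrow> 'a set \<Rightarrow> ('a \<Rightarrow> 'a) \<Rightarrow> ('a \<times> 'a) set \<Rightarrow> ('a \<times> 'a) set"
where
  "localization_map R S \<tau> P = \<Union>{fraction_rel R S `` {(\<tau> s, \<tau> x)} | s x. (s, x) \<in> P}"


section \<open>Skew group rings\<close>

text \<open>
  The function \<open>f\<close> stands for the formal sum of the \<open>f g \<cdot> g\<close>, and the multiplication is determined by
  \<open>g \<cdot> x = act g x \<cdot> g\<close>.
\<close>

definition skew_group_ring ::
  "('k, 'a, 'n) module_scheme \<Rightarrow> ('g, 'p) monoid_scheme \<Rightarrow> ('g \<Rightarrow> 'a \<Rightarrow> 'a) \<Rightarrow> ('k, 'g \<Rightarrow> 'a) module"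
where
  "skew_group_ring R G act =
    \<lparr>carrier = fin_supp_funs R (carrier G),
     monoid.mult = (\<lambda>f f' h. if h \<in> carrier G
       then \<Oplus>\<^bsub>R\<^esub>g\<in>{g. f g \<noteq> \<zero>\<^bsub>R\<^esub>}. f g \<otimes>\<^bsub>R\<^esub> act g (f' (inv\<^bsub>G\<^esub> g \<otimes>\<^bsub>G\<^esub> h)) else \<zero>\<^bsub>R\<^esub>),
     one = (\<lambda>h. if h = \<one>\<^bsub>G\<^esub> then \<one>\<^bsub>R\<^esub> else \<zero>\<^bsub>R\<^esub>),
     ring.zero = (\<lambda>h. \<zero>\<^bsub>R\<^esub>),
     add = (\<lambda>f f' h. f h \<oplus>\<^bsub>R\<^esub> f' h),
     smult = (\<lambda>c f h. c \<odot>\<^bsub>R\<^esub> f h)\<rparr>"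

end

theory Submission
  imports Defs
begin

text \<open>
  Write \<open>g\<^sub>\<beta>\<close> for the group elements in \<open>B = D\<^sub>S * \<int>\<^sup>\<oplus>\<^sup>\<alpha>\<close>. The assignment \<open>X\<^sub>\<beta>\<^sup>+ \<mapsto> g\<^sub>\<beta>\<close>,
  \<open>X\<^sub>\<beta>\<^sup>- \<mapsto> a\<^sub>\<beta> g\<^sub>\<beta>\<^sup>-\<^sup>1\<close> respects the defining relations, so it extends to a homomorphism \<open>\<phi>\<close> from the
  generalized Weyl algebra \<open>A\<close> to \<open>B\<close>. As a left \<open>D\<close>-module, \<open>A\<close> is spanned by monomials \<open>X\<^sub>n\<close> with
  \<open>n \<in> \<int>\<^sup>\<oplus>\<^sup>\<alpha>\<close>, and \<open>\<phi>\<close> maps \<open>X\<^sub>n\<close> to \<open>u\<^sub>n g\<^sup>n\<close> with \<open>u\<^sub>n \<in> S\<close>. Since the elements of \<open>S\<close> are regular, \<open>\<phi>\<close> is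
  injective. It maps \<open>S\<close> to units, and every element of \<open>B\<close> has the form \<open>\<phi>(s)\<^sup>-\<^sup>1 \<phi>(x)\<close>. These three
  properties imply the Ore conditions for \<open>S\<close> in \<open>A\<close> and identify \<open>A\<^sub>S\<close> with \<open>B\<close>.
\<close>

section \<open>Finitely supported functions and twisted monoid algebras\<close>

text \<open>The algebra is known only through a presentation, so a priori it could collapse: neither
  the injectivity of \<open>D\<close> into it nor the independence of the monomials is visible in
  the relations. Rewriting therefore supplies only the spanning half of a normal form, and
  independence is read off in the skew group ring, where the group elements are independent by
  construction. The coefficient of the image of \<open>X_minus\<close> is forced: once
  \<open>X_plus\<close> goes to g, the relation X- X+ = a gives X- = a g^-1, and then X+ X- = g a
  g^-1 = \<sigma>(a) comes out right. Commutation for distinct indices is what the hypothesis that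
  \<open>\<sigma> \<beta>\<close> fixes \<open>a \<gamma>\<close> provides. A second obstacle is
  that \<open>S\<close> is central in \<open>D\<close> but in general not in the algebra, so genuine
  left Ore fractions are required there. Their ring axioms are not checked on fractions but carried
  over from the skew group ring. For \<open>D\<close> no such target ring is available beforehand;
  its localization is built by hand, with centrality reducing equality of fractions to cross
  multiplication.\<close>

definition point_fun :: "('b, 'm) ring_scheme \<Rightarrow> 'a \<Rightarrow> 'b \<Rightarrow> 'a \<Rightarrow> 'b" where
  "point_fun R y c = (\<lambda>x. if x = y then c else \<zero>\<^bsub>R\<^esub>)"

text \<open>Only additivity of \<open>t y\<close> in the coefficient is asked for later. This covers
  two uses: evaluation of the free algebra, with coefficients in \<open>K\<close>, and the expansion
  of normal forms, with coefficients in the noncommutative ring \<open>D\<close>.\<close>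

definition lin_ext :: "('b, 'm) ring_scheme \<Rightarrow> ('c, 'p) ring_scheme \<Rightarrow> ('a \<Rightarrow> 'b \<Rightarrow> 'c) \<Rightarrow> ('a \<Rightarrow> 'b) \<Rightarrow> 'c" where
  "lin_ext R M t f = (\<Oplus>\<^bsub>M\<^esub>y\<in>{y. f y \<noteq> \<zero>\<^bsub>R\<^esub>}. t y (f y))"

context abelian_monoid
begin

lemma fin_supp_funs_closed: "f \<in> fin_supp_funs G Y \<Longrightarrow> f y \<in> carrier G"
  by (simp add: fin_supp_funs_def)

lemma fin_supp_funs_zero: "(\<lambda>_. \<zero>) \<in> fin_supp_funs G Y"
  by (simp add: fin_supp_funs_def)

lemma fin_supp_funs_add:
  assumes "f \<in> fin_supp_funs G Y" "g \<in> fin_supp_funs G Y"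
  shows "(\<lambda>y. f y \<oplus> g y) \<in> fin_supp_funs G Y"
proof -
  have "{y. f y \<oplus> g y \<noteq> \<zero>} \<subseteq> {y. f y \<noteq> \<zero>} \<union> {y. g y \<noteq> \<zero>}" by auto
  with assms show ?thesis unfolding fin_supp_funs_def
    by (auto intro: finite_subset)
qed

lemma point_fun_closed: "c \<in> carrier G \<Longrightarrow> y \<in> Y \<Longrightarrow> point_fun G y c \<in> fin_supp_funs G Y"
  unfolding fin_supp_funs_def point_fun_def by (auto intro: finite_subset[of _ "{y}"])

lemma fin_supp_funs_map:
  assumes "f \<in> fin_supp_funs G Y" "\<And>x. x \<in> carrier G \<Longrightarrow> h x \<in> carrier G" "h \<zero> = \<zero>"
  shows "(\<lambda>y. h (f y)) \<in> fin_supp_funs G Y"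
proof -
  have "{y. h (f y) \<noteq> \<zero>} \<subseteq> {y. f y \<noteq> \<zero>}" using assms by auto
  with assms show ?thesis unfolding fin_supp_funs_def
    by (auto intro: finite_subset)
qed

text \<open>One point of the support is cleared at a time. The step does not record that
  \<open>f\<close> vanishes at \<open>y\<close>, because the properties proved with it are
  compatible with arbitrary sums.\<close>

lemma fin_supp_funs_induct [consumes 1, case_names zero add]:
  assumes f: "f \<in> fin_supp_funs G Y"
    and zero: "P (\<lambda>_. \<zero>)"
    and add: "\<And>f c y. \<lbrakk>f \<in> fin_supp_funs G Y; P f; c \<in> carrier G; y \<in> Y\<rbrakk>
      \<Longrightarrow> P (\<lambda>x. f x \<oplus> point_fun G y c x)"
  shows "P f"
proof -
  have "P f" if "finite N" "{y. f y \<noteq> \<zero>} = N" "f \<in> fin_supp_funs G Y" for N f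
    using that
  proof (induction N arbitrary: f)
    case empty
    then have "f = (\<lambda>_. \<zero>)" by auto
    with zero show ?case by simp
  next
    case (insert y N)
    let ?f = "f(y := \<zero>)"
    have s: "{x. ?f x \<noteq> \<zero>} = N" using insert by auto
    have c: "?f \<in> fin_supp_funs G Y" using insert s unfolding fin_supp_funs_def by auto
    have y: "f y \<in> carrier G" "y \<in> Y" using insert unfolding fin_supp_funs_def by auto
    have "f = (\<lambda>x. ?f x \<oplus> point_fun G y (f y) x)"
      using fin_supp_funs_closed[OF insert.prems(2)] by (auto simp: point_fun_def)
    then show ?case using add[OF c insert.IH[OF s c] y] by simp
  qed
  then show ?thesis using f unfolding fin_supp_funs_def by auto
qed

end

section \<open>Additive extension from point functions to finitely supported functions\<close>

locale additive_family = R: abelian_monoid R + M: abelian_group M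
  for R :: "('b, 'm) ring_scheme" and M :: "('c, 'p) ring_scheme" +
  fixes Y :: "'a set" and t :: "'a \<Rightarrow> 'b \<Rightarrow> 'c"
  assumes t_closed: "\<lbrakk>y \<in> Y; c \<in> carrier R\<rbrakk> \<Longrightarrow> t y c \<in> carrier M"
    and t_add: "\<lbrakk>y \<in> Y; c \<in> carrier R; d \<in> carrier R\<rbrakk> \<Longrightarrow> t y (c \<oplus>\<^bsub>R\<^esub> d) = t y c \<oplus>\<^bsub>M\<^esub> t y d"
begin

lemma t_zero: "y \<in> Y \<Longrightarrow> t y \<zero>\<^bsub>R\<^esub> = \<zero>\<^bsub>M\<^esub>"
  using t_add[of y "\<zero>\<^bsub>R\<^esub>" "\<zero>\<^bsub>R\<^esub>"] t_closed[of y "\<zero>\<^bsub>R\<^esub>"]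
  by (metis M.add.r_cancel_one' R.r_zero R.zero_closed)

text \<open>Terms outside the support are values of \<open>t\<close> at zero and vanish by
  additivity. This allows sums over different supports to be compared on a common index set.\<close>

lemma lin_ext_superset:
  assumes "f \<in> fin_supp_funs R Y" "finite N" "{y. f y \<noteq> \<zero>\<^bsub>R\<^esub>} \<subseteq> N" "N \<subseteq> Y"
  shows "lin_ext R M t f = (\<Oplus>\<^bsub>M\<^esub>y\<in>N. t y (f y))"
  unfolding lin_ext_def using assms R.fin_supp_funs_closed[OF assms(1)]
  by (intro M.add.finprod_mono_neutral_cong_left) (auto simp: t_zero intro!: t_closed)

lemma lin_ext_closed: "f \<in> fin_supp_funs R Y \<Longrightarrow> lin_ext R M t f \<in> carrier M"
  unfolding lin_ext_def
  by (intro M.finsum_closed) (auto simp: fin_supp_funs_def intro!: t_closed)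

lemma lin_ext_zero: "lin_ext R M t (\<lambda>_. \<zero>\<^bsub>R\<^esub>) = \<zero>\<^bsub>M\<^esub>"
  by (simp add: lin_ext_def)

lemma lin_ext_point:
  assumes "y \<in> Y" "c \<in> carrier R"
  shows "lin_ext R M t (point_fun R y c) = t y c"
proof -
  have "lin_ext R M t (point_fun R y c) = (\<Oplus>\<^bsub>M\<^esub>x\<in>{y}. t x (point_fun R y c x))"
    using assms by (intro lin_ext_superset R.point_fun_closed) (auto simp: point_fun_def)
  then show ?thesis using assms by (simp add: point_fun_def t_closed)
qed

lemma lin_ext_add:
  assumes f: "f \<in> fin_supp_funs R Y" and g: "g \<in> fin_supp_funs R Y"
  shows "lin_ext R M t (\<lambda>y. f y \<oplus>\<^bsub>R\<^esub> g y) = lin_ext R M t f \<oplus>\<^bsub>M\<^esub> lin_ext R M t g"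
proof -
  \<comment> \<open>The support of the sum can be strictly smaller than this union, since
    coefficients may cancel.\<close>
  let ?N = "{y. f y \<noteq> \<zero>\<^bsub>R\<^esub>} \<union> {y. g y \<noteq> \<zero>\<^bsub>R\<^esub>}"
  have N: "finite ?N" "?N \<subseteq> Y" using f g by (auto simp: fin_supp_funs_def)
  have fc: "f y \<in> carrier R" and gc: "g y \<in> carrier R" for y
    using f g by (simp_all add: R.fin_supp_funs_closed)
  have "lin_ext R M t (\<lambda>y. f y \<oplus>\<^bsub>R\<^esub> g y) = (\<Oplus>\<^bsub>M\<^esub>y\<in>?N. t y (f y \<oplus>\<^bsub>R\<^esub> g y))"
    using N by (intro lin_ext_superset R.fin_supp_funs_add f g) auto
  also have "\<dots> = (\<Oplus>\<^bsub>M\<^esub>y\<in>?N. t y (f y) \<oplus>\<^bsub>M\<^esub> t y (g y))"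
    using N fc gc by (intro M.add.finprod_cong') (auto simp: t_add intro!: t_closed)
  also have "\<dots> = (\<Oplus>\<^bsub>M\<^esub>y\<in>?N. t y (f y)) \<oplus>\<^bsub>M\<^esub> (\<Oplus>\<^bsub>M\<^esub>y\<in>?N. t y (g y))"
    using N fc gc by (intro M.finsum_addf) (auto intro!: t_closed)
  also have "\<dots> = lin_ext R M t f \<oplus>\<^bsub>M\<^esub> lin_ext R M t g"
    using N f g lin_ext_superset[of f ?N] lin_ext_superset[of g ?N] by simp
  finally show ?thesis .
qed

end

lemma assoc_algebraI:
  assumes "field K" "ring A" "module K A"
    and "\<And>c x y. \<lbrakk>c \<in> carrier K; x \<in> carrier A; y \<in> carrier A\<rbrakk>
        \<Longrightarrow> (c \<odot>\<^bsub>A\<^esub> x) \<otimes>\<^bsub>A\<^esub> y = c \<odot>\<^bsub>A\<^esub> (x \<otimes>\<^bsub>A\<^esub> y)"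
    and "\<And>c x y. \<lbrakk>c \<in> carrier K; x \<in> carrier A; y \<in> carrier A\<rbrakk>
        \<Longrightarrow> x \<otimes>\<^bsub>A\<^esub> (c \<odot>\<^bsub>A\<^esub> y) = c \<odot>\<^bsub>A\<^esub> (x \<otimes>\<^bsub>A\<^esub> y)"
  shows "assoc_algebra K A"
  using assms by (simp add: assoc_algebra_def assoc_algebra_axioms_def)

text \<open>
  Both the free algebra (words with the trivial action) and the skew group ring are instances. By
  additivity, associativity of \<open>B\<close> reduces to products of three point functions.
\<close>

locale twisted_algebra = R: ring R + G: monoid G + K: field K
  for K :: "('k, 'm) ring_scheme" and R :: "('a, 'n) ring_scheme" and G :: "('g, 'p) monoid_scheme" +
  fixes sm :: "'k \<Rightarrow> 'a \<Rightarrow> 'a" and act :: "'g \<Rightarrow> 'a \<Rightarrow> 'a" and B :: "('k, 'g \<Rightarrow> 'a) module"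
  assumes sm_closed: "\<lbrakk>c \<in> carrier K; x \<in> carrier R\<rbrakk> \<Longrightarrow> sm c x \<in> carrier R"
    and sm_l_distr: "\<lbrakk>c \<in> carrier K; d \<in> carrier K; x \<in> carrier R\<rbrakk> \<Longrightarrow> sm (c \<oplus>\<^bsub>K\<^esub> d) x = sm c x \<oplus>\<^bsub>R\<^esub> sm d x"
    and sm_r_distr: "\<lbrakk>c \<in> carrier K; x \<in> carrier R; y \<in> carrier R\<rbrakk> \<Longrightarrow> sm c (x \<oplus>\<^bsub>R\<^esub> y) = sm c x \<oplus>\<^bsub>R\<^esub> sm c y"
    and sm_assoc: "\<lbrakk>c \<in> carrier K; d \<in> carrier K; x \<in> carrier R\<rbrakk> \<Longrightarrow> sm (c \<otimes>\<^bsub>K\<^esub> d) x = sm c (sm d x)"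
    and sm_one: "x \<in> carrier R \<Longrightarrow> sm \<one>\<^bsub>K\<^esub> x = x"
    and sm_left: "\<lbrakk>c \<in> carrier K; x \<in> carrier R; y \<in> carrier R\<rbrakk> \<Longrightarrow> sm c x \<otimes>\<^bsub>R\<^esub> y = sm c (x \<otimes>\<^bsub>R\<^esub> y)"
    and sm_right: "\<lbrakk>c \<in> carrier K; x \<in> carrier R; y \<in> carrier R\<rbrakk> \<Longrightarrow> x \<otimes>\<^bsub>R\<^esub> sm c y = sm c (x \<otimes>\<^bsub>R\<^esub> y)"
    and act_hom: "g \<in> carrier G \<Longrightarrow> act g \<in> ring_hom R R"
    and act_mult: "\<lbrakk>g \<in> carrier G; h \<in> carrier G; x \<in> carrier R\<rbrakk> \<Longrightarrow> act (g \<otimes>\<^bsub>G\<^esub> h) x = act g (act h x)"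
    and act_one: "x \<in> carrier R \<Longrightarrow> act \<one>\<^bsub>G\<^esub> x = x"
    and act_sm: "\<lbrakk>g \<in> carrier G; c \<in> carrier K; x \<in> carrier R\<rbrakk> \<Longrightarrow> act g (sm c x) = sm c (act g x)"
    and carrier_B: "carrier B = fin_supp_funs R (carrier G)"
    and add_B: "add B = (\<lambda>f f' h. f h \<oplus>\<^bsub>R\<^esub> f' h)"
    and zero_B: "\<zero>\<^bsub>B\<^esub> = (\<lambda>h. \<zero>\<^bsub>R\<^esub>)"
    and one_B: "\<one>\<^bsub>B\<^esub> = point_fun R \<one>\<^bsub>G\<^esub> \<one>\<^bsub>R\<^esub>"
    and smult_B: "smult B = (\<lambda>c f h. sm c (f h))"
    and l_distr_B: "\<lbrakk>f \<in> carrier B; f' \<in> carrier B; k \<in> carrier B\<rbrakk> \<Longrightarrow> (f \<oplus>\<^bsub>B\<^esub> f') \<otimes>\<^bsub>B\<^esub> k = f \<otimes>\<^bsub>B\<^esub> k \<oplus>\<^bsub>B\<^esub> f' \<otimes>\<^bsub>B\<^esub> k"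
    and r_distr_B: "\<lbrakk>f \<in> carrier B; f' \<in> carrier B; k \<in> carrier B\<rbrakk> \<Longrightarrow> k \<otimes>\<^bsub>B\<^esub> (f \<oplus>\<^bsub>B\<^esub> f') = k \<otimes>\<^bsub>B\<^esub> f \<oplus>\<^bsub>B\<^esub> k \<otimes>\<^bsub>B\<^esub> f'"
    and point_B: "\<lbrakk>g \<in> carrier G; h \<in> carrier G; x \<in> carrier R; y \<in> carrier R\<rbrakk>
      \<Longrightarrow> point_fun R g x \<otimes>\<^bsub>B\<^esub> point_fun R h y = point_fun R (g \<otimes>\<^bsub>G\<^esub> h) (x \<otimes>\<^bsub>R\<^esub> act g y)"
begin

lemma act_closed: "\<lbrakk>g \<in> carrier G; x \<in> carrier R\<rbrakk> \<Longrightarrow> act g x \<in> carrier R"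
  using act_hom ring_hom_closed by fast

lemma sm_zero: "c \<in> carrier K \<Longrightarrow> sm c \<zero>\<^bsub>R\<^esub> = \<zero>\<^bsub>R\<^esub>"
  using sm_r_distr[of c "\<zero>\<^bsub>R\<^esub>" "\<zero>\<^bsub>R\<^esub>"] sm_closed[of c "\<zero>\<^bsub>R\<^esub>"]
  by (metis R.add.r_cancel_one' R.r_zero R.zero_closed)

lemma point_closed: "\<lbrakk>g \<in> carrier G; x \<in> carrier R\<rbrakk> \<Longrightarrow> point_fun R g x \<in> carrier B"
  by (simp add: carrier_B R.point_fun_closed)

lemma B_induct [consumes 1, case_names zero add]:
  assumes "f \<in> carrier B" "P \<zero>\<^bsub>B\<^esub>"
    and "\<And>f x g. \<lbrakk>f \<in> carrier B; P f; x \<in> carrier R; g \<in> carrier G\<rbrakk> \<Longrightarrow> P (f \<oplus>\<^bsub>B\<^esub> point_fun R g x)"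
  shows "P f"
  using assms unfolding carrier_B zero_B add_B by (rule R.fin_supp_funs_induct)

lemma abelian_group_B: "abelian_group B"
proof (rule abelian_groupI)
  show "x \<oplus>\<^bsub>B\<^esub> y \<in> carrier B" if "x \<in> carrier B" "y \<in> carrier B" for x y
    using that unfolding carrier_B add_B by (rule R.fin_supp_funs_add)
  show "\<zero>\<^bsub>B\<^esub> \<in> carrier B" unfolding carrier_B zero_B by (rule R.fin_supp_funs_zero)
  fix x assume x: "x \<in> carrier B"
  then have "(\<lambda>h. \<ominus>\<^bsub>R\<^esub> x h) \<in> carrier B" unfolding carrier_B
    using R.fin_supp_funs_map[of x _ "a_inv R"] by auto
  moreover have "(\<lambda>h. \<ominus>\<^bsub>R\<^esub> x h) \<oplus>\<^bsub>B\<^esub> x = \<zero>\<^bsub>B\<^esub>"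
    using x by (simp add: add_B zero_B carrier_B R.fin_supp_funs_closed R.l_neg)
  ultimately show "\<exists>y\<in>carrier B. y \<oplus>\<^bsub>B\<^esub> x = \<zero>\<^bsub>B\<^esub>" by blast
qed (auto simp: add_B zero_B carrier_B R.fin_supp_funs_closed R.a_ac)

sublocale B: abelian_group B by (rule abelian_group_B)

lemma zero_point: "g \<in> carrier G \<Longrightarrow> \<zero>\<^bsub>B\<^esub> = point_fun R g \<zero>\<^bsub>R\<^esub>"
  by (auto simp: zero_B point_fun_def)

text \<open>The usual cancellation argument for a product with zero requires products to lie in the
  carrier, and that closure is itself proved from this fact. Instead, zero is written as a point
  function with coefficient zero.\<close>

lemma l_null_point:
  assumes "g \<in> carrier G" "x \<in> carrier R" shows "\<zero>\<^bsub>B\<^esub> \<otimes>\<^bsub>B\<^esub> point_fun R g x = \<zero>\<^bsub>B\<^esub>"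
  using assms point_B[of g g "\<zero>\<^bsub>R\<^esub>" x] zero_point[of g] zero_point[of "g \<otimes>\<^bsub>G\<^esub> g"]
  by (simp add: act_closed)

lemma r_null_point:
  assumes "g \<in> carrier G" "x \<in> carrier R" shows "point_fun R g x \<otimes>\<^bsub>B\<^esub> \<zero>\<^bsub>B\<^esub> = \<zero>\<^bsub>B\<^esub>"
proof -
  have "act g \<zero>\<^bsub>R\<^esub> = \<zero>\<^bsub>R\<^esub>" using act_hom[OF assms(1)] R.ring_axioms
    by (meson ring_hom_zero)
  then show ?thesis
    using assms point_B[of g g x "\<zero>\<^bsub>R\<^esub>"] zero_point[of g] zero_point[of "g \<otimes>\<^bsub>G\<^esub> g"]
    by simp
qed

lemma l_null_B: "f \<in> carrier B \<Longrightarrow> \<zero>\<^bsub>B\<^esub> \<otimes>\<^bsub>B\<^esub> f = \<zero>\<^bsub>B\<^esub>"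
proof (induction rule: B_induct)
  case zero
  show ?case using l_null_point[of "\<one>\<^bsub>G\<^esub>" "\<zero>\<^bsub>R\<^esub>"] zero_point[of "\<one>\<^bsub>G\<^esub>"] by simp
qed (simp add: r_distr_B point_closed l_null_point)

lemma r_null_B: "f \<in> carrier B \<Longrightarrow> f \<otimes>\<^bsub>B\<^esub> \<zero>\<^bsub>B\<^esub> = \<zero>\<^bsub>B\<^esub>"
  by (induction rule: B_induct) (simp_all add: l_null_B l_distr_B point_closed r_null_point)

lemma mult_closed_B:
  assumes "f \<in> carrier B" "f' \<in> carrier B" shows "f \<otimes>\<^bsub>B\<^esub> f' \<in> carrier B"
  using assms
proof (induction rule: B_induct)
  case (add f x g)
  have "point_fun R g x \<otimes>\<^bsub>B\<^esub> f' \<in> carrier B" using \<open>f' \<in> carrier B\<close>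
    by (induction rule: B_induct)
       (use add in \<open>simp_all add: r_distr_B point_closed r_null_point point_B act_closed\<close>)
  with add show ?case by (simp add: l_distr_B point_closed)
qed (simp add: l_null_B)

text \<open>Both bracketings are additive in each of the three arguments, so three nested inductions
  reduce the claim to point functions.\<close>

lemma mult_assoc_B:
  assumes "f \<in> carrier B" "f' \<in> carrier B" "f'' \<in> carrier B"
  shows "f \<otimes>\<^bsub>B\<^esub> f' \<otimes>\<^bsub>B\<^esub> f'' = f \<otimes>\<^bsub>B\<^esub> (f' \<otimes>\<^bsub>B\<^esub> f'')"
  using assms
proof (induction rule: B_induct)
  case zero
  then show ?case by (simp add: l_null_B mult_closed_B)
next
  case (add f x g)
  have "point_fun R g x \<otimes>\<^bsub>B\<^esub> f' \<otimes>\<^bsub>B\<^esub> f'' = point_fun R g x \<otimes>\<^bsub>B\<^esub> (f' \<otimes>\<^bsub>B\<^esub> f'')"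
    using \<open>f' \<in> carrier B\<close>
  proof (induction rule: B_induct)
    case zero
    with add show ?case by (simp add: l_null_B r_null_point)
  next
    case (add f' x' g')
    have "point_fun R g x \<otimes>\<^bsub>B\<^esub> point_fun R g' x' \<otimes>\<^bsub>B\<^esub> f''
        = point_fun R g x \<otimes>\<^bsub>B\<^esub> (point_fun R g' x' \<otimes>\<^bsub>B\<^esub> f'')"
      using \<open>f'' \<in> carrier B\<close>
    proof (induction rule: B_induct)
      case zero
      then show ?case using add \<open>x \<in> carrier R\<close> \<open>g \<in> carrier G\<close>
        by (simp add: r_null_point r_null_B mult_closed_B point_closed)
    next
      case (add f'' x'' g'')
      \<comment> \<open>The twisted part of associativity: both sides carry the coefficient x
        act_g(x') act_gg'(x''), which uses that \<open>act g\<close> is multiplicative and that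
        \<open>act\<close> is an action.\<close>
      have "act g (x' \<otimes>\<^bsub>R\<^esub> act g' x'') = act g x' \<otimes>\<^bsub>R\<^esub> act g (act g' x'')"
        using act_hom add \<open>x' \<in> carrier R\<close> \<open>g' \<in> carrier G\<close> \<open>g \<in> carrier G\<close>
        by (simp add: act_closed ring_hom_mult)
      then show ?case using add \<open>x \<in> carrier R\<close> \<open>g \<in> carrier G\<close> \<open>x' \<in> carrier R\<close> \<open>g' \<in> carrier G\<close>
        by (simp add: r_distr_B mult_closed_B point_closed point_B act_closed act_mult R.m_assoc G.m_assoc)
    qed
    then show ?case using add \<open>x \<in> carrier R\<close> \<open>g \<in> carrier G\<close> \<open>f'' \<in> carrier B\<close>
      by (simp add: r_distr_B l_distr_B mult_closed_B point_closed)
  qed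
  then show ?case using add
    by (simp add: l_distr_B mult_closed_B point_closed)
qed

lemma act_unit: "g \<in> carrier G \<Longrightarrow> act g \<one>\<^bsub>R\<^esub> = \<one>\<^bsub>R\<^esub>"
  using act_hom ring_hom_one by fast

lemma ring_B: "ring B"
proof (rule ringI)
  show "abelian_group B" by (rule abelian_group_B)
  show "monoid B"
  proof (rule monoidI)
    show "\<one>\<^bsub>B\<^esub> \<in> carrier B" by (simp add: one_B point_closed)
    show "\<one>\<^bsub>B\<^esub> \<otimes>\<^bsub>B\<^esub> f = f" if "f \<in> carrier B" for f using that unfolding one_B
      by (induction rule: B_induct) (simp_all add: r_null_point r_distr_B point_closed point_B act_one)
    show "f \<otimes>\<^bsub>B\<^esub> \<one>\<^bsub>B\<^esub> = f" if "f \<in> carrier B" for f using that unfolding one_B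
      by (induction rule: B_induct) (simp_all add: l_null_point l_distr_B point_closed point_B act_unit)
  qed (simp_all add: mult_closed_B mult_assoc_B)
qed (simp_all add: l_distr_B r_distr_B)

lemma smult_closed_B: "\<lbrakk>c \<in> carrier K; f \<in> carrier B\<rbrakk> \<Longrightarrow> c \<odot>\<^bsub>B\<^esub> f \<in> carrier B"
  unfolding carrier_B smult_B using R.fin_supp_funs_map[of f _ "sm c"]
  by (simp add: sm_closed sm_zero)

lemma module_B: "module K B"
proof (rule moduleI)
  show "cring K" by (rule K.is_cring)
  show "abelian_group B" by (rule abelian_group_B)
qed (simp_all add: smult_closed_B, simp_all add: carrier_B smult_B add_B R.fin_supp_funs_closed
      sm_l_distr sm_r_distr sm_assoc sm_one)

lemma smult_point: "c \<in> carrier K \<Longrightarrow> c \<odot>\<^bsub>B\<^esub> point_fun R g x = point_fun R g (sm c x)"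
  by (auto simp: smult_B point_fun_def sm_zero)

lemma smult_zero_B: "c \<in> carrier K \<Longrightarrow> c \<odot>\<^bsub>B\<^esub> \<zero>\<^bsub>B\<^esub> = \<zero>\<^bsub>B\<^esub>"
  by (simp add: smult_B zero_B sm_zero)

lemma smult_add_B: "\<lbrakk>c \<in> carrier K; f \<in> carrier B; f' \<in> carrier B\<rbrakk>
    \<Longrightarrow> c \<odot>\<^bsub>B\<^esub> (f \<oplus>\<^bsub>B\<^esub> f') = c \<odot>\<^bsub>B\<^esub> f \<oplus>\<^bsub>B\<^esub> c \<odot>\<^bsub>B\<^esub> f'"
  using module_B module.smult_r_distr by fast

text \<open>On point functions the second identity moves the scalar out of \<open>act g\<close>, so
  it rests on \<open>act_sm\<close>.\<close>

lemma smult_mult_B: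
  assumes c: "c \<in> carrier K" and f: "f \<in> carrier B" and f': "f' \<in> carrier B"
  shows "(c \<odot>\<^bsub>B\<^esub> f) \<otimes>\<^bsub>B\<^esub> f' = c \<odot>\<^bsub>B\<^esub> (f \<otimes>\<^bsub>B\<^esub> f') \<and> f \<otimes>\<^bsub>B\<^esub> (c \<odot>\<^bsub>B\<^esub> f') = c \<odot>\<^bsub>B\<^esub> (f \<otimes>\<^bsub>B\<^esub> f')"
  using f
proof (induction rule: B_induct)
  case zero
  then show ?case using c f' by (simp add: l_null_B smult_zero_B smult_closed_B)
next
  case (add f x g)
  have "(c \<odot>\<^bsub>B\<^esub> point_fun R g x) \<otimes>\<^bsub>B\<^esub> f' = c \<odot>\<^bsub>B\<^esub> (point_fun R g x \<otimes>\<^bsub>B\<^esub> f')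
      \<and> point_fun R g x \<otimes>\<^bsub>B\<^esub> (c \<odot>\<^bsub>B\<^esub> f') = c \<odot>\<^bsub>B\<^esub> (point_fun R g x \<otimes>\<^bsub>B\<^esub> f')"
    using f'
  proof (induction rule: B_induct)
    case zero
    then show ?case using add c by (simp add: smult_zero_B r_null_B point_closed smult_closed_B)
  next
    case (add f' x' g')
    then show ?case using c \<open>x \<in> carrier R\<close> \<open>g \<in> carrier G\<close>
      by (simp add: smult_add_B smult_point r_distr_B mult_closed_B point_closed point_B smult_closed_B
          sm_closed act_closed act_sm sm_left sm_right)
  qed
  then show ?case using add c f'
    by (simp add: l_distr_B smult_add_B point_closed smult_closed_B mult_closed_B)
qed

lemma assoc_algebra_B: "assoc_algebra K B"
  by (rule assoc_algebraI) (simp_all add: K.field_axioms ring_B module_B smult_mult_B)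

end

section \<open>The free algebra and the skew group ring as twisted monoid algebras\<close>

definition word_monoid :: "'y set \<Rightarrow> 'y list monoid" where
  "word_monoid Y = \<lparr>carrier = lists Y, monoid.mult = (@), one = []\<rparr>"

lemma (in ring) ring_hom_id: "(\<lambda>x. x) \<in> ring_hom R R"
  by (simp add: ring_hom_def)

lemma twisted_algebra_free_algebra:
  assumes "field K"
  shows "twisted_algebra K K (word_monoid Y) (\<otimes>\<^bsub>K\<^esub>) (\<lambda>_ x. x) (free_algebra K Y)"
proof -
  interpret K: field K by fact
  have fc: "f w \<in> carrier K" if "f \<in> fin_supp_funs K (lists Y)" for f w
    using that by (rule K.fin_supp_funs_closed)
  show ?thesis
  proof
    fix f f' h assume "f \<in> carrier (free_algebra K Y)" "f' \<in> carrier (free_algebra K Y)"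
      "h \<in> carrier (free_algebra K Y)"
    then have c: "f w \<in> carrier K" "f' w \<in> carrier K" "h w \<in> carrier K" for w
      by (simp_all add: free_algebra_def fc)
    show "(f \<oplus>\<^bsub>free_algebra K Y\<^esub> f') \<otimes>\<^bsub>free_algebra K Y\<^esub> h =
        f \<otimes>\<^bsub>free_algebra K Y\<^esub> h \<oplus>\<^bsub>free_algebra K Y\<^esub> f' \<otimes>\<^bsub>free_algebra K Y\<^esub> h"
      using c by (simp add: free_algebra_def K.l_distr K.finsum_addf Pi_def)
    show "h \<otimes>\<^bsub>free_algebra K Y\<^esub> (f \<oplus>\<^bsub>free_algebra K Y\<^esub> f') =
        h \<otimes>\<^bsub>free_algebra K Y\<^esub> f \<oplus>\<^bsub>free_algebra K Y\<^esub> h \<otimes>\<^bsub>free_algebra K Y\<^esub> f'"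
      using c by (simp add: free_algebra_def K.r_distr K.finsum_addf Pi_def)
  next
    fix v w x y assume "v \<in> carrier (word_monoid Y)" "w \<in> carrier (word_monoid Y)"
      and xy: "x \<in> carrier K" "y \<in> carrier K"
    have "(\<Oplus>\<^bsub>K\<^esub>i\<in>{..length u}. point_fun K v x (take i u) \<otimes>\<^bsub>K\<^esub> point_fun K w y (drop i u))
        = point_fun K (v @ w) (x \<otimes>\<^bsub>K\<^esub> y) u" for u
    proof (cases "u = v @ w")
      case True
      \<comment> \<open>Among all splittings of \<open>u = v @ w\<close> into a prefix and a suffix,
        only the cut after \<open>length v\<close> letters contributes.\<close>
      have pt: "point_fun K v x (take i u) \<otimes>\<^bsub>K\<^esub> point_fun K w y (drop i u)
          = (if length v = i then x \<otimes>\<^bsub>K\<^esub> y else \<zero>\<^bsub>K\<^esub>)" if i: "i \<le> length u" for i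
      proof (cases "length v = i")
        case True
        then show ?thesis using \<open>u = v @ w\<close> by (simp add: point_fun_def)
      next
        case False
        then have "take i u \<noteq> v" using i by auto
        with False xy show ?thesis by (simp add: point_fun_def)
      qed
      have "(\<Oplus>\<^bsub>K\<^esub>i\<in>{..length u}. point_fun K v x (take i u) \<otimes>\<^bsub>K\<^esub> point_fun K w y (drop i u))
          = (\<Oplus>\<^bsub>K\<^esub>i\<in>{..length u}. if length v = i then x \<otimes>\<^bsub>K\<^esub> y else \<zero>\<^bsub>K\<^esub>)"
        using xy by (intro K.add.finprod_cong' refl pt) auto
      also have "\<dots> = x \<otimes>\<^bsub>K\<^esub> y"
        using xy True by (intro K.finsum_singleton[where f = "\<lambda>_. x \<otimes>\<^bsub>K\<^esub> y"]) auto
      finally show ?thesis using True by (simp add: point_fun_def)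
    next
      case False
      have "(\<Oplus>\<^bsub>K\<^esub>i\<in>{..length u}. point_fun K v x (take i u) \<otimes>\<^bsub>K\<^esub> point_fun K w y (drop i u))
          = (\<Oplus>\<^bsub>K\<^esub>i\<in>{..length u}. \<zero>\<^bsub>K\<^esub>)"
        using xy False by (intro K.add.finprod_cong') (auto simp: point_fun_def)
      with False show ?thesis by (simp add: point_fun_def)
    qed
    then show "point_fun K v x \<otimes>\<^bsub>free_algebra K Y\<^esub> point_fun K w y =
        point_fun K (v \<otimes>\<^bsub>word_monoid Y\<^esub> w) (x \<otimes>\<^bsub>K\<^esub> y)"
      by (simp add: free_algebra_def word_monoid_def)
  qed (auto simp: word_monoid_def free_algebra_def point_fun_def K.l_distr K.r_distr K.m_assoc K.m_lcomm
        K.ring_hom_id)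
qed

lemma twisted_algebra_skew_group_ring:
  fixes R :: "('k, 'a, 'n) module_scheme"
  assumes "assoc_algebra K R" "group G"
    and hom: "\<And>g. g \<in> carrier G \<Longrightarrow> act g \<in> ring_hom R R"
    and mult: "\<And>g h x. \<lbrakk>g \<in> carrier G; h \<in> carrier G; x \<in> carrier R\<rbrakk> \<Longrightarrow> act (g \<otimes>\<^bsub>G\<^esub> h) x = act g (act h x)"
    and one: "\<And>x. x \<in> carrier R \<Longrightarrow> act \<one>\<^bsub>G\<^esub> x = x"
    and sm: "\<And>g c x. \<lbrakk>g \<in> carrier G; c \<in> carrier K; x \<in> carrier R\<rbrakk> \<Longrightarrow> act g (c \<odot>\<^bsub>R\<^esub> x) = c \<odot>\<^bsub>R\<^esub> act g x"
  shows "twisted_algebra K R G (smult R) act (skew_group_ring R G act)"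
proof -
  interpret R: assoc_algebra K R by fact
  interpret G: group G by fact
  let ?B = "skew_group_ring R G act"
  have car: "carrier ?B = fin_supp_funs R (carrier G)" by (simp add: skew_group_ring_def)
  have fc: "f g \<in> carrier R" if "f \<in> carrier ?B" for f g
    using that by (simp add: car R.fin_supp_funs_closed)
  have fs: "finite {g. f g \<noteq> \<zero>\<^bsub>R\<^esub>}" "{g. f g \<noteq> \<zero>\<^bsub>R\<^esub>} \<subseteq> carrier G" if "f \<in> carrier ?B" for f
    using that by (auto simp: car fin_supp_funs_def)
  have ac: "act g x \<in> carrier R" if "g \<in> carrier G" "x \<in> carrier R" for g x
    using hom[OF that(1)] that(2) by (rule ring_hom_closed)
  \<comment> \<open>The product is defined by a sum over the support of the left factor.
    Distributivity compares left factors with different supports, so the index set is first freed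
    from \<open>f\<close>.\<close>
  have mB: "(f \<otimes>\<^bsub>?B\<^esub> f') h = (\<Oplus>\<^bsub>R\<^esub>g\<in>N. f g \<otimes>\<^bsub>R\<^esub> act g (f' (inv\<^bsub>G\<^esub> g \<otimes>\<^bsub>G\<^esub> h)))"
    if "f \<in> carrier ?B" "f' \<in> carrier ?B" "finite N" "{g. f g \<noteq> \<zero>\<^bsub>R\<^esub>} \<subseteq> N" "N \<subseteq> carrier G"
      "h \<in> carrier G" for f f' N h
  proof -
    have "(f \<otimes>\<^bsub>?B\<^esub> f') h = (\<Oplus>\<^bsub>R\<^esub>g\<in>{g. f g \<noteq> \<zero>\<^bsub>R\<^esub>}. f g \<otimes>\<^bsub>R\<^esub> act g (f' (inv\<^bsub>G\<^esub> g \<otimes>\<^bsub>G\<^esub> h)))"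
      using that by (simp add: skew_group_ring_def)
    also have "\<dots> = (\<Oplus>\<^bsub>R\<^esub>g\<in>N. f g \<otimes>\<^bsub>R\<^esub> act g (f' (inv\<^bsub>G\<^esub> g \<otimes>\<^bsub>G\<^esub> h)))"
      using that by (intro R.add.finprod_mono_neutral_cong_left) (auto simp: subset_iff fc ac)
    finally show ?thesis .
  qed
  have mB': "(f \<otimes>\<^bsub>?B\<^esub> f') h = \<zero>\<^bsub>R\<^esub>" if "h \<notin> carrier G" for f f' h
    using that by (simp add: skew_group_ring_def)
  have addc: "f \<oplus>\<^bsub>?B\<^esub> f' \<in> carrier ?B" if "f \<in> carrier ?B" "f' \<in> carrier ?B" for f f'
    using that R.fin_supp_funs_add by (simp add: skew_group_ring_def)
  have addB: "(f \<oplus>\<^bsub>?B\<^esub> f') h = f h \<oplus>\<^bsub>R\<^esub> f' h" for f f' h by (simp add: skew_group_ring_def)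
  show ?thesis
  proof
    fix f f' k assume B: "f \<in> carrier ?B" "f' \<in> carrier ?B" "k \<in> carrier ?B"
    show "(f \<oplus>\<^bsub>?B\<^esub> f') \<otimes>\<^bsub>?B\<^esub> k = f \<otimes>\<^bsub>?B\<^esub> k \<oplus>\<^bsub>?B\<^esub> f' \<otimes>\<^bsub>?B\<^esub> k"
    proof
      fix h
      let ?N = "{g. f g \<noteq> \<zero>\<^bsub>R\<^esub>} \<union> {g. f' g \<noteq> \<zero>\<^bsub>R\<^esub>}"
      have N: "finite ?N" "?N \<subseteq> carrier G" using fs B by auto
      show "((f \<oplus>\<^bsub>?B\<^esub> f') \<otimes>\<^bsub>?B\<^esub> k) h = (f \<otimes>\<^bsub>?B\<^esub> k \<oplus>\<^bsub>?B\<^esub> f' \<otimes>\<^bsub>?B\<^esub> k) h"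
      proof (cases "h \<in> carrier G")
        case True
        have "((f \<oplus>\<^bsub>?B\<^esub> f') \<otimes>\<^bsub>?B\<^esub> k) h
            = (\<Oplus>\<^bsub>R\<^esub>g\<in>?N. (f \<oplus>\<^bsub>?B\<^esub> f') g \<otimes>\<^bsub>R\<^esub> act g (k (inv\<^bsub>G\<^esub> g \<otimes>\<^bsub>G\<^esub> h)))"
          using N B True by (intro mB addc) (auto simp: addB)
        also have "\<dots> = (\<Oplus>\<^bsub>R\<^esub>g\<in>?N. f g \<otimes>\<^bsub>R\<^esub> act g (k (inv\<^bsub>G\<^esub> g \<otimes>\<^bsub>G\<^esub> h))
            \<oplus>\<^bsub>R\<^esub> f' g \<otimes>\<^bsub>R\<^esub> act g (k (inv\<^bsub>G\<^esub> g \<otimes>\<^bsub>G\<^esub> h)))"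
          using N B by (intro R.add.finprod_cong') (auto simp: addB R.l_distr fc ac subset_iff)
        also have "\<dots> = (f \<otimes>\<^bsub>?B\<^esub> k) h \<oplus>\<^bsub>R\<^esub> (f' \<otimes>\<^bsub>?B\<^esub> k) h"
          using N B True mB[of f k ?N h] mB[of f' k ?N h]
          by (subst R.finsum_addf) (auto simp: fc ac subset_iff)
        finally show ?thesis by (simp add: addB)
      qed (simp add: mB' addB)
    qed
    show "k \<otimes>\<^bsub>?B\<^esub> (f \<oplus>\<^bsub>?B\<^esub> f') = k \<otimes>\<^bsub>?B\<^esub> f \<oplus>\<^bsub>?B\<^esub> k \<otimes>\<^bsub>?B\<^esub> f'"
    proof
      fix h
      let ?N = "{g. k g \<noteq> \<zero>\<^bsub>R\<^esub>}"
      have N: "finite ?N" "?N \<subseteq> carrier G" using fs B by auto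
      show "(k \<otimes>\<^bsub>?B\<^esub> (f \<oplus>\<^bsub>?B\<^esub> f')) h = (k \<otimes>\<^bsub>?B\<^esub> f \<oplus>\<^bsub>?B\<^esub> k \<otimes>\<^bsub>?B\<^esub> f') h"
      proof (cases "h \<in> carrier G")
        case True
        have "(k \<otimes>\<^bsub>?B\<^esub> (f \<oplus>\<^bsub>?B\<^esub> f')) h
            = (\<Oplus>\<^bsub>R\<^esub>g\<in>?N. k g \<otimes>\<^bsub>R\<^esub> act g ((f \<oplus>\<^bsub>?B\<^esub> f') (inv\<^bsub>G\<^esub> g \<otimes>\<^bsub>G\<^esub> h)))"
          using N B True by (intro mB addc) auto
        also have "\<dots> = (\<Oplus>\<^bsub>R\<^esub>g\<in>?N. k g \<otimes>\<^bsub>R\<^esub> act g (f (inv\<^bsub>G\<^esub> g \<otimes>\<^bsub>G\<^esub> h))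
            \<oplus>\<^bsub>R\<^esub> k g \<otimes>\<^bsub>R\<^esub> act g (f' (inv\<^bsub>G\<^esub> g \<otimes>\<^bsub>G\<^esub> h)))"
        proof (intro R.add.finprod_cong' refl)
          show "k g \<otimes>\<^bsub>R\<^esub> act g ((f \<oplus>\<^bsub>?B\<^esub> f') (inv\<^bsub>G\<^esub> g \<otimes>\<^bsub>G\<^esub> h))
            = k g \<otimes>\<^bsub>R\<^esub> act g (f (inv\<^bsub>G\<^esub> g \<otimes>\<^bsub>G\<^esub> h)) \<oplus>\<^bsub>R\<^esub> k g \<otimes>\<^bsub>R\<^esub> act g (f' (inv\<^bsub>G\<^esub> g \<otimes>\<^bsub>G\<^esub> h))"
            if "g \<in> ?N" for g
          proof -
            have "g \<in> carrier G" using N that by auto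
            then show ?thesis using B by (simp add: addB ring_hom_add[OF hom] fc ac R.r_distr)
          qed
        qed (use N B in \<open>auto simp: subset_iff fc ac\<close>)
        also have "\<dots> = (k \<otimes>\<^bsub>?B\<^esub> f) h \<oplus>\<^bsub>R\<^esub> (k \<otimes>\<^bsub>?B\<^esub> f') h"
          using N B True mB[of k f ?N h] mB[of k f' ?N h]
          by (subst R.finsum_addf) (auto simp: fc ac subset_iff)
        finally show ?thesis by (simp add: addB)
      qed (simp add: mB' addB)
    qed
  next
    fix g h x y assume gh: "g \<in> carrier G" "h \<in> carrier G" and xy: "x \<in> carrier R" "y \<in> carrier R"
    show "point_fun R g x \<otimes>\<^bsub>?B\<^esub> point_fun R h y = point_fun R (g \<otimes>\<^bsub>G\<^esub> h) (x \<otimes>\<^bsub>R\<^esub> act g y)"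
    proof
      fix k
      show "(point_fun R g x \<otimes>\<^bsub>?B\<^esub> point_fun R h y) k = point_fun R (g \<otimes>\<^bsub>G\<^esub> h) (x \<otimes>\<^bsub>R\<^esub> act g y) k"
      proof (cases "k \<in> carrier G")
        case True
        have z: "act g \<zero>\<^bsub>R\<^esub> = \<zero>\<^bsub>R\<^esub>" using hom[OF gh(1)] R.A.ring_axioms by (meson ring_hom_zero)
        have eq: "inv\<^bsub>G\<^esub> g \<otimes>\<^bsub>G\<^esub> k = h \<longleftrightarrow> k = g \<otimes>\<^bsub>G\<^esub> h"
          using gh True G.inv_solve_left[of k g h] by (metis G.inv_solve_left)
        have "(point_fun R g x \<otimes>\<^bsub>?B\<^esub> point_fun R h y) k
            = (\<Oplus>\<^bsub>R\<^esub>g'\<in>{g}. point_fun R g x g' \<otimes>\<^bsub>R\<^esub> act g' (point_fun R h y (inv\<^bsub>G\<^esub> g' \<otimes>\<^bsub>G\<^esub> k)))"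
          using gh xy True by (intro mB) (simp_all add: car R.point_fun_closed, auto simp: point_fun_def)
        also have "\<dots> = x \<otimes>\<^bsub>R\<^esub> act g (point_fun R h y (inv\<^bsub>G\<^esub> g \<otimes>\<^bsub>G\<^esub> k))"
          using gh xy by (subst R.add.finprod_insert) (auto simp: point_fun_def ac)
        also have "\<dots> = point_fun R (g \<otimes>\<^bsub>G\<^esub> h) (x \<otimes>\<^bsub>R\<^esub> act g y) k"
          using xy by (auto simp: point_fun_def eq z)
        finally show ?thesis .
      next
        case False
        with gh have "k \<noteq> g \<otimes>\<^bsub>G\<^esub> h" by auto
        with False show ?thesis by (simp add: mB' point_fun_def)
      qed
    qed
  qed (simp_all add: hom mult one sm R.smult_l_distr R.smult_r_distr R.smult_assoc1 R.smult_mult_left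
        R.smult_mult_right, simp_all add: skew_group_ring_def point_fun_def)
qed

section \<open>The universal property of the free algebra\<close>

definition word_prod :: "('b, 'm) monoid_scheme \<Rightarrow> ('y \<Rightarrow> 'b) \<Rightarrow> 'y list \<Rightarrow> 'b" where
  "word_prod B \<psi> w = foldr (\<lambda>y x. \<psi> y \<otimes>\<^bsub>B\<^esub> x) w \<one>\<^bsub>B\<^esub>"

definition free_eval ::
  "('k, 'm) ring_scheme \<Rightarrow> ('k, 'b, 'p) module_scheme \<Rightarrow> ('y \<Rightarrow> 'b) \<Rightarrow> ('y list \<Rightarrow> 'k) \<Rightarrow> 'b" where
  "free_eval K B \<psi> = lin_ext K B (\<lambda>w c. c \<odot>\<^bsub>B\<^esub> word_prod B \<psi> w)"

lemma (in monoid) word_prod_closed: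
  "\<psi> \<in> Y \<rightarrow> carrier G \<Longrightarrow> w \<in> lists Y \<Longrightarrow> word_prod G \<psi> w \<in> carrier G"
  by (induction w) (auto simp: word_prod_def)

lemma (in monoid) word_prod_append:
  "\<psi> \<in> Y \<rightarrow> carrier G \<Longrightarrow> v \<in> lists Y \<Longrightarrow> w \<in> lists Y
    \<Longrightarrow> word_prod G \<psi> (v @ w) = word_prod G \<psi> v \<otimes> word_prod G \<psi> w"
proof (induction v)
  case Nil
  then show ?case using word_prod_closed[of \<psi> Y w] by (simp add: word_prod_def)
next
  case (Cons y v)
  then show ?case using word_prod_closed[of \<psi> Y w] word_prod_closed[of \<psi> Y v]
    by (auto simp: word_prod_def m_assoc Pi_iff)
qed

lemma free_var_point: "free_var K y = point_fun K [y] \<one>\<^bsub>K\<^esub>"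
  by (simp add: free_var_def point_fun_def)

text \<open>Evaluation is additive by construction, so multiplicativity has to be checked only on
  two words with coefficients, where concatenation becomes a product in \<open>B\<close>.\<close>

lemma free_eval:
  assumes "assoc_algebra K B" and \<psi>: "\<psi> \<in> Y \<rightarrow> carrier B"
  defines "F \<equiv> free_algebra K Y"
  shows free_eval_ring_hom: "free_eval K B \<psi> \<in> ring_hom F B"
    and free_eval_smult: "\<And>c f. \<lbrakk>c \<in> carrier K; f \<in> carrier F\<rbrakk>
      \<Longrightarrow> free_eval K B \<psi> (c \<odot>\<^bsub>F\<^esub> f) = c \<odot>\<^bsub>B\<^esub> free_eval K B \<psi> f"
    and free_eval_var: "\<And>y. y \<in> Y \<Longrightarrow> free_eval K B \<psi> (free_var K y) = \<psi> y"
proof -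
  interpret B: assoc_algebra K B by fact
  interpret F: twisted_algebra K K "word_monoid Y" "(\<otimes>\<^bsub>K\<^esub>)" "\<lambda>_ x. x" F
    unfolding F_def by (rule twisted_algebra_free_algebra) (rule B.K.field_axioms)
  let ?t = "\<lambda>w c. c \<odot>\<^bsub>B\<^esub> word_prod B \<psi> w"
  let ?e = "free_eval K B \<psi>"
  have wc: "word_prod B \<psi> w \<in> carrier B" if "w \<in> lists Y" for w
    using \<psi> that by (rule B.A.word_prod_closed)
  interpret E: additive_family K B "lists Y" ?t
    by unfold_locales (simp_all add: wc B.smult_l_distr)
  have carF: "carrier F = fin_supp_funs K (lists Y)" by (simp add: F.carrier_B word_monoid_def)
  have car: "carrier (word_monoid Y) = lists Y" by (simp add: word_monoid_def)
  have closed: "?e f \<in> carrier B" if "f \<in> carrier F" for f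
    using that unfolding free_eval_def carF by (rule E.lin_ext_closed)
  have e_add: "?e (f \<oplus>\<^bsub>F\<^esub> g) = ?e f \<oplus>\<^bsub>B\<^esub> ?e g" if "f \<in> carrier F" "g \<in> carrier F" for f g
    using that unfolding free_eval_def carF F.add_B by (rule E.lin_ext_add)
  have e_zero: "?e \<zero>\<^bsub>F\<^esub> = \<zero>\<^bsub>B\<^esub>" unfolding free_eval_def F.zero_B by (rule E.lin_ext_zero)
  have point: "?e (point_fun K w c) = c \<odot>\<^bsub>B\<^esub> word_prod B \<psi> w" if "w \<in> lists Y" "c \<in> carrier K" for w c
    unfolding free_eval_def using that by (rule E.lin_ext_point)
  \<comment> \<open>Both scalars are pulled out of the product in \<open>B\<close>, which uses that
    scalars pass through either factor.\<close>
  have mult_point: "?e (point_fun K v c \<otimes>\<^bsub>F\<^esub> point_fun K w d)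
      = ?e (point_fun K v c) \<otimes>\<^bsub>B\<^esub> ?e (point_fun K w d)"
    if vw: "v \<in> lists Y" "w \<in> lists Y" and cd: "c \<in> carrier K" "d \<in> carrier K" for v w c d
  proof -
    have "point_fun K v c \<otimes>\<^bsub>F\<^esub> point_fun K w d = point_fun K (v @ w) (c \<otimes>\<^bsub>K\<^esub> d)"
      using F.point_B[of v w c d] vw cd by (simp add: word_monoid_def)
    moreover have "v @ w \<in> lists Y" using vw by simp
    ultimately show ?thesis using vw cd wc[of v] wc[of w] B.A.word_prod_append[OF \<psi>]
      by (simp add: point B.smult_mult_left[of c "word_prod B \<psi> v"] B.smult_mult_right[of d "word_prod B \<psi> v"]
          B.smult_assoc1)
  qed
  have mult: "?e (f \<otimes>\<^bsub>F\<^esub> g) = ?e f \<otimes>\<^bsub>B\<^esub> ?e g" if f: "f \<in> carrier F" and g: "g \<in> carrier F" for f g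
    using f
  proof (induction rule: F.B_induct)
    case zero
    then show ?case using g by (simp add: F.l_null_B e_zero closed)
  next
    case (add f c w)
    have "?e (point_fun K w c \<otimes>\<^bsub>F\<^esub> g) = ?e (point_fun K w c) \<otimes>\<^bsub>B\<^esub> ?e g"
      using g
    proof (induction rule: F.B_induct)
      case zero
      then show ?case using add by (simp add: F.r_null_point e_zero closed F.point_closed)
    next
      case (add g d v)
      then show ?case using \<open>w \<in> carrier (word_monoid Y)\<close> \<open>c \<in> carrier K\<close>
        by (simp add: F.r_distr_B F.point_closed F.mult_closed_B e_add closed B.A.r_distr mult_point car)
    qed
    then show ?case using add g
      by (simp add: F.l_distr_B F.point_closed F.mult_closed_B e_add closed B.A.l_distr)
  qed
  have one: "?e \<one>\<^bsub>F\<^esub> = \<one>\<^bsub>B\<^esub>"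
    using point[of "[]" "\<one>\<^bsub>K\<^esub>"] by (simp add: F.one_B word_monoid_def word_prod_def)
  show "?e \<in> ring_hom F B"
    by (rule ring_hom_memI) (simp_all add: closed mult e_add one)
  show "?e (c \<odot>\<^bsub>F\<^esub> f) = c \<odot>\<^bsub>B\<^esub> ?e f" if c: "c \<in> carrier K" and f: "f \<in> carrier F" for c f
    using f
  proof (induction rule: F.B_induct)
    case zero
    then show ?case using c by (simp add: F.smult_zero_B e_zero)
  next
    case (add f d w)
    have "?e (c \<odot>\<^bsub>F\<^esub> point_fun K w d) = c \<odot>\<^bsub>B\<^esub> ?e (point_fun K w d)"
      using add c wc[of w] by (simp add: F.smult_point point car B.smult_assoc1)
    then show ?case using add c
      by (simp add: F.smult_add_B F.point_closed F.smult_closed_B e_add closed B.smult_r_distr)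
  qed
  show "?e (free_var K y) = \<psi> y" if "y \<in> Y" for y
  proof -
    have "\<psi> y \<in> carrier B" using \<psi> that by auto
    then show ?thesis using point[of "[y]" "\<one>\<^bsub>K\<^esub>"] that by (simp add: free_var_point word_prod_def)
  qed
qed

section \<open>Localizations recognized by a homomorphism\<close>

text \<open>Transport of structure: nothing is presupposed about \<open>A\<close> beyond its
  operations, and every axiom is carried over from \<open>B\<close> along the bijection
  \<open>h\<close>. The isomorphism demanded by the conclusion is the inverse of
  \<open>h\<close>.\<close>

lemma alg_isomorphic_image:
  assumes "assoc_algebra K B" and car: "carrier A = h ` carrier B" and inj: "inj_on h (carrier B)"
    and add: "\<And>x y. \<lbrakk>x \<in> carrier B; y \<in> carrier B\<rbrakk> \<Longrightarrow> h x \<oplus>\<^bsub>A\<^esub> h y = h (x \<oplus>\<^bsub>B\<^esub> y)"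
    and mult: "\<And>x y. \<lbrakk>x \<in> carrier B; y \<in> carrier B\<rbrakk> \<Longrightarrow> h x \<otimes>\<^bsub>A\<^esub> h y = h (x \<otimes>\<^bsub>B\<^esub> y)"
    and zero: "\<zero>\<^bsub>A\<^esub> = h \<zero>\<^bsub>B\<^esub>" and one: "\<one>\<^bsub>A\<^esub> = h \<one>\<^bsub>B\<^esub>"
    and smult: "\<And>c x. \<lbrakk>c \<in> carrier K; x \<in> carrier B\<rbrakk> \<Longrightarrow> c \<odot>\<^bsub>A\<^esub> h x = h (c \<odot>\<^bsub>B\<^esub> x)"
  shows "alg_isomorphic K A B"
proof -
  interpret B: assoc_algebra K B by fact
  have grp: "abelian_group A"
  proof (rule abelian_groupI)
    fix x assume "x \<in> carrier A"
    then obtain b where b: "b \<in> carrier B" "x = h b" using car by auto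
    then have "h (\<ominus>\<^bsub>B\<^esub> b) \<oplus>\<^bsub>A\<^esub> x = \<zero>\<^bsub>A\<^esub>" by (simp add: add zero B.A.l_neg)
    with b car show "\<exists>y\<in>carrier A. y \<oplus>\<^bsub>A\<^esub> x = \<zero>\<^bsub>A\<^esub>" by blast
  qed (auto simp: car add zero B.A.a_ac)
  have "monoid A"
    by (rule monoidI) (auto simp: car mult one B.A.m_assoc)
  then have ring: "ring A" using grp
    by (intro ringI) (auto simp: car mult add B.A.l_distr B.A.r_distr)
  have mod: "module K A" using B.K.is_cring grp
    by (intro moduleI) (auto simp: car add smult B.smult_l_distr B.smult_r_distr B.smult_assoc1)
  have alg: "assoc_algebra K A" using B.K.field_axioms ring mod
    by (intro assoc_algebraI) (auto simp: car mult smult B.smult_mult_left B.smult_mult_right)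
  let ?g = "the_inv_into (carrier B) h"
  have gh: "?g (h x) = x" if "x \<in> carrier B" for x using inj that by (rule the_inv_into_f_f)
  have "?g \<in> ring_hom A B"
    by (rule ring_hom_memI) (auto simp: car mult add one gh)
  moreover have "bij_betw ?g (carrier A) (carrier B)"
    unfolding car using inj by (intro bij_betw_the_inv_into) (simp add: bij_betw_def)
  ultimately have "?g \<in> alg_iso K A B"
    by (auto simp: alg_iso_def ring_iso_def car smult gh)
  with alg assms(1) show ?thesis unfolding alg_isomorphic_def by blast
qed

text \<open>Operations on localizations are unions over all representatives and auxiliary elements.
  Such a union is a single class once all members agree and there is at least one member.\<close>

lemma Union_const: "U \<in> C \<Longrightarrow> (\<And>V. V \<in> C \<Longrightarrow> V = Z) \<Longrightarrow> \<Union>C = Z"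
  by blast

text \<open>Recognition of a localization by an injective map that inverts \<open>S\<close> and
  reaches every element of \<open>B\<close> by a left fraction. No Ore condition is assumed; it will
  be a consequence.\<close>

locale localizing_hom = A: ring A + B: assoc_algebra K B
  for K :: "('k, 'm) ring_scheme" and A :: "('k, 'a, 'n) module_scheme" and B :: "('k, 'b, 'p) module_scheme" +
  fixes \<phi> :: "'a \<Rightarrow> 'b" and S :: "'a set"
  assumes hom: "\<phi> \<in> ring_hom A B" and inj: "inj_on \<phi> (carrier A)"
    and smult_closed_A: "\<lbrakk>c \<in> carrier K; x \<in> carrier A\<rbrakk> \<Longrightarrow> c \<odot>\<^bsub>A\<^esub> x \<in> carrier A"
    and hom_smult: "\<lbrakk>c \<in> carrier K; x \<in> carrier A\<rbrakk> \<Longrightarrow> \<phi> (c \<odot>\<^bsub>A\<^esub> x) = c \<odot>\<^bsub>B\<^esub> \<phi> x"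
    and submonoid: "submonoid S A"
    and units: "s \<in> S \<Longrightarrow> \<phi> s \<in> Units B"
    and fractions: "y \<in> carrier B \<Longrightarrow> \<exists>s\<in>S. \<exists>x\<in>carrier A. \<phi> s \<otimes>\<^bsub>B\<^esub> y = \<phi> x"
begin

lemma S_carrier: "s \<in> S \<Longrightarrow> s \<in> carrier A"
  using submonoid submonoid.subset by blast

lemma S_mult: "s \<in> S \<Longrightarrow> t \<in> S \<Longrightarrow> s \<otimes>\<^bsub>A\<^esub> t \<in> S"
  using submonoid by (rule submonoid.m_closed)

lemma S_one: "\<one>\<^bsub>A\<^esub> \<in> S"
  using submonoid by (rule submonoid.one_closed)

lemma hom_closed: "x \<in> carrier A \<Longrightarrow> \<phi> x \<in> carrier B"
  using hom by (rule ring_hom_closed)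

lemma hom_mult: "\<lbrakk>x \<in> carrier A; y \<in> carrier A\<rbrakk> \<Longrightarrow> \<phi> (x \<otimes>\<^bsub>A\<^esub> y) = \<phi> x \<otimes>\<^bsub>B\<^esub> \<phi> y"
  using hom by (rule ring_hom_mult)

lemma hom_add: "\<lbrakk>x \<in> carrier A; y \<in> carrier A\<rbrakk> \<Longrightarrow> \<phi> (x \<oplus>\<^bsub>A\<^esub> y) = \<phi> x \<oplus>\<^bsub>B\<^esub> \<phi> y"
  using hom by (rule ring_hom_add)

lemma hom_one: "\<phi> \<one>\<^bsub>A\<^esub> = \<one>\<^bsub>B\<^esub>"
  using hom by (rule ring_hom_one)

lemma hom_zero: "\<phi> \<zero>\<^bsub>A\<^esub> = \<zero>\<^bsub>B\<^esub>"
  using hom A.ring_axioms B.A.ring_axioms by (rule ring_hom_zero)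

lemma hom_cancel: "\<lbrakk>x \<in> carrier A; y \<in> carrier A; \<phi> x = \<phi> y\<rbrakk> \<Longrightarrow> x = y"
  using inj by (auto dest: inj_onD)

lemma inv_closed: "s \<in> S \<Longrightarrow> inv\<^bsub>B\<^esub> \<phi> s \<in> carrier B"
  using units by (rule B.A.Units_inv_closed)

definition frac_val :: "'a \<times> 'a \<Rightarrow> 'b" where
  "frac_val p = inv\<^bsub>B\<^esub> \<phi> (fst p) \<otimes>\<^bsub>B\<^esub> \<phi> (snd p)"

text \<open>These fibres turn out to be the classes of \<open>fraction_rel\<close>, so this function
  is the isomorphism in the direction from \<open>B\<close> to the localization.\<close>

definition frac_fibre :: "'b \<Rightarrow> ('a \<times> 'a) set" where
  "frac_fibre y = {p \<in> S \<times> carrier A. frac_val p = y}"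

lemma frac_val_closed: "s \<in> S \<Longrightarrow> x \<in> carrier A \<Longrightarrow> frac_val (s, x) \<in> carrier B"
  by (simp add: frac_val_def inv_closed hom_closed)

text \<open>Multiplying by the unit \<open>\<phi> s\<close> clears the denominator. Later
  computations use the cleared form, so that no inverse of a product has to be expanded.\<close>

lemma frac_val_eq_iff:
  assumes "s \<in> S" "x \<in> carrier A" "y \<in> carrier B"
  shows "frac_val (s, x) = y \<longleftrightarrow> \<phi> x = \<phi> s \<otimes>\<^bsub>B\<^esub> y"
proof
  assume "frac_val (s, x) = y"
  then have "\<phi> s \<otimes>\<^bsub>B\<^esub> y = \<phi> s \<otimes>\<^bsub>B\<^esub> inv\<^bsub>B\<^esub> \<phi> s \<otimes>\<^bsub>B\<^esub> \<phi> x"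
    using assms by (auto simp: frac_val_def B.A.m_assoc inv_closed hom_closed S_carrier)
  then show "\<phi> x = \<phi> s \<otimes>\<^bsub>B\<^esub> y" using assms by (simp add: units hom_closed)
next
  assume "\<phi> x = \<phi> s \<otimes>\<^bsub>B\<^esub> y"
  then have "frac_val (s, x) = inv\<^bsub>B\<^esub> \<phi> s \<otimes>\<^bsub>B\<^esub> \<phi> s \<otimes>\<^bsub>B\<^esub> y"
    using assms by (simp add: frac_val_def B.A.m_assoc inv_closed hom_closed S_carrier)
  then show "frac_val (s, x) = y" using assms by (simp add: units)
qed

lemma fibre_nonempty:
  assumes "y \<in> carrier B" obtains s x where "s \<in> S" "x \<in> carrier A" "frac_val (s, x) = y"
  using fractions[OF assms] assms frac_val_eq_iff by metis

text \<open>The right fraction \<open>\<phi> x\<close> times the inverse of \<open>\<phi> s\<close>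
  is an element of \<open>B\<close>, hence also a left fraction with some denominator
  \<open>t\<close> and numerator \<open>u\<close>. Clearing both denominators gives the equation in
  \<open>B\<close>, and injectivity brings it back to \<open>A\<close>.\<close>

lemma ore: 
  assumes "x \<in> carrier A" "s \<in> S" obtains t u where "t \<in> S" "u \<in> carrier A" "t \<otimes>\<^bsub>A\<^esub> x = u \<otimes>\<^bsub>A\<^esub> s"
proof -
  have "\<phi> x \<otimes>\<^bsub>B\<^esub> inv\<^bsub>B\<^esub> \<phi> s \<in> carrier B" using assms by (simp add: hom_closed inv_closed)
  then obtain t u where t: "t \<in> S" "u \<in> carrier A" "\<phi> t \<otimes>\<^bsub>B\<^esub> (\<phi> x \<otimes>\<^bsub>B\<^esub> inv\<^bsub>B\<^esub> \<phi> s) = \<phi> u"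
    using fractions by blast
  have "\<phi> (u \<otimes>\<^bsub>A\<^esub> s) = \<phi> t \<otimes>\<^bsub>B\<^esub> \<phi> x \<otimes>\<^bsub>B\<^esub> (inv\<^bsub>B\<^esub> \<phi> s \<otimes>\<^bsub>B\<^esub> \<phi> s)"
    using t assms by (simp add: hom_mult S_carrier B.A.m_assoc hom_closed inv_closed flip: t(3))
  also have "\<dots> = \<phi> (t \<otimes>\<^bsub>A\<^esub> x)"
    using t assms by (simp add: units hom_mult S_carrier hom_closed)
  finally have "t \<otimes>\<^bsub>A\<^esub> x = u \<otimes>\<^bsub>A\<^esub> s"
    using t assms by (intro hom_cancel) (simp_all add: S_carrier)
  with t that show ?thesis by blast
qed

text \<open>Besides the Ore condition, reversibility holds in a strong form: \<open>x\<close> times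
  \<open>s\<close> being zero forces \<open>x\<close> to be zero, since \<open>\<phi> s\<close> is a
  unit and \<open>\<phi>\<close> is injective. Hence the unit element can serve as the left
  annihilator.\<close>

lemma left_denominator_set: "left_denominator_set A S"
  unfolding left_denominator_set_def
proof (intro conjI ballI impI)
  show "submonoid S A" by (rule submonoid)
  fix x s assume xs: "x \<in> carrier A" "s \<in> S"
  then show "\<exists>t\<in>S. \<exists>u\<in>carrier A. t \<otimes>\<^bsub>A\<^esub> x = u \<otimes>\<^bsub>A\<^esub> s" using ore by metis
  assume 0: "x \<otimes>\<^bsub>A\<^esub> s = \<zero>\<^bsub>A\<^esub>"
  have "\<phi> x = \<phi> (x \<otimes>\<^bsub>A\<^esub> s) \<otimes>\<^bsub>B\<^esub> inv\<^bsub>B\<^esub> \<phi> s"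
    using xs by (simp add: hom_mult S_carrier B.A.m_assoc hom_closed inv_closed units)
  also have "\<dots> = \<phi> \<zero>\<^bsub>A\<^esub>" using xs by (simp add: 0 hom_zero inv_closed)
  finally have "x = \<zero>\<^bsub>A\<^esub>" using xs by (intro hom_cancel) auto
  then show "\<exists>t\<in>S. t \<otimes>\<^bsub>A\<^esub> x = \<zero>\<^bsub>A\<^esub>" using S_one by force
qed

text \<open>As in \<open>fraction_rel\<close>, the multiplier \<open>u\<close> may lie outside
  \<open>S\<close>; only the new denominator must belong to it.\<close>

lemma frac_val_expand:
  assumes "u \<in> carrier A" "s \<in> S" "u \<otimes>\<^bsub>A\<^esub> s \<in> S" "x \<in> carrier A"
  shows "frac_val (u \<otimes>\<^bsub>A\<^esub> s, u \<otimes>\<^bsub>A\<^esub> x) = frac_val (s, x)"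
proof -
  have "\<phi> x = \<phi> s \<otimes>\<^bsub>B\<^esub> frac_val (s, x)"
    using assms frac_val_eq_iff[of s x "frac_val (s, x)"] frac_val_closed by simp
  then show ?thesis
    using assms frac_val_closed[of s x]
    by (subst frac_val_eq_iff) (simp_all add: hom_mult S_carrier B.A.m_assoc hom_closed)
qed

text \<open>Expanding a fraction does not change its value; conversely, fractions of equal value are
  compared over a common denominator. Being equality of values, the relation needs no separate proof
  of transitivity.\<close>

lemma fraction_rel_iff:
  "((s, x), (t, y)) \<in> fraction_rel A S \<longleftrightarrow>
    s \<in> S \<and> t \<in> S \<and> x \<in> carrier A \<and> y \<in> carrier A \<and> frac_val (s, x) = frac_val (t, y)"
proof (cases "s \<in> S \<and> t \<in> S \<and> x \<in> carrier A \<and> y \<in> carrier A")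
  case True
  then have c: "s \<in> S" "t \<in> S" "x \<in> carrier A" "y \<in> carrier A" by auto
  have "\<exists>u\<in>carrier A. \<exists>v\<in>carrier A. u \<otimes>\<^bsub>A\<^esub> s = v \<otimes>\<^bsub>A\<^esub> t \<and> u \<otimes>\<^bsub>A\<^esub> s \<in> S \<and> u \<otimes>\<^bsub>A\<^esub> x = v \<otimes>\<^bsub>A\<^esub> y"
    if eq: "frac_val (s, x) = frac_val (t, y)"
  proof -
    \<comment> \<open>The Ore condition for the two denominators, with \<open>s\<close> in the role
      of the element and \<open>t\<close> in that of the denominator; the multiplier
      \<open>w\<close> lies in \<open>S\<close>, which keeps the common denominator in
      \<open>S\<close>.\<close>
    obtain w v where w: "w \<in> S" "v \<in> carrier A" "w \<otimes>\<^bsub>A\<^esub> s = v \<otimes>\<^bsub>A\<^esub> t"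
      using ore[of s t] c S_carrier by metis
    let ?q = "frac_val (t, y)"
    have "\<phi> x = \<phi> s \<otimes>\<^bsub>B\<^esub> ?q" "\<phi> y = \<phi> t \<otimes>\<^bsub>B\<^esub> ?q"
      using c eq frac_val_eq_iff[of s x ?q] frac_val_eq_iff[of t y ?q] frac_val_closed by simp_all
    then have "\<phi> (w \<otimes>\<^bsub>A\<^esub> x) = \<phi> (w \<otimes>\<^bsub>A\<^esub> s) \<otimes>\<^bsub>B\<^esub> ?q" "\<phi> (v \<otimes>\<^bsub>A\<^esub> y) = \<phi> (v \<otimes>\<^bsub>A\<^esub> t) \<otimes>\<^bsub>B\<^esub> ?q"
      using c w(1,2) by (simp_all add: hom_mult S_carrier B.A.m_assoc hom_closed frac_val_closed)
    with w have "\<phi> (w \<otimes>\<^bsub>A\<^esub> x) = \<phi> (v \<otimes>\<^bsub>A\<^esub> y)" by simp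
    then have "w \<otimes>\<^bsub>A\<^esub> x = v \<otimes>\<^bsub>A\<^esub> y" using c w by (intro hom_cancel) (simp_all add: S_carrier)
    moreover have "w \<otimes>\<^bsub>A\<^esub> s \<in> S" using w c by (intro S_mult)
    ultimately show ?thesis using w S_carrier by blast
  qed
  moreover have "frac_val (s, x) = frac_val (t, y)"
    if "u \<in> carrier A" "v \<in> carrier A" "u \<otimes>\<^bsub>A\<^esub> s = v \<otimes>\<^bsub>A\<^esub> t" "u \<otimes>\<^bsub>A\<^esub> s \<in> S" "u \<otimes>\<^bsub>A\<^esub> x = v \<otimes>\<^bsub>A\<^esub> y" for u v
    using that c frac_val_expand[of u s x] frac_val_expand[of v t y] by simp
  ultimately show ?thesis using c unfolding fraction_rel_def by blast
qed (auto simp: fraction_rel_def)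

lemma fraction_class:
  assumes "s \<in> S" "x \<in> carrier A"
  shows "fraction_rel A S `` {(s, x)} = frac_fibre (frac_val (s, x))"
  using assms unfolding frac_fibre_def by (auto simp: fraction_rel_iff)

lemma localization_carrier: "carrier (localization A S) = frac_fibre ` carrier B"
proof -
  have "carrier (localization A S) = {frac_fibre (frac_val (s, x)) | s x. s \<in> S \<and> x \<in> carrier A}"
    by (auto simp: localization_def quotient_def fraction_class) blast+
  also have "\<dots> = frac_fibre ` carrier B"
    using frac_val_closed by (auto elim!: fibre_nonempty)
  finally show ?thesis .
qed

lemma localization_mult:
  assumes "y \<in> carrier B" "z \<in> carrier B"
  shows "frac_fibre y \<otimes>\<^bsub>localization A S\<^esub> frac_fibre z = frac_fibre (y \<otimes>\<^bsub>B\<^esub> z)"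
proof -
  let ?U = "{fraction_rel A S `` {(w \<otimes>\<^bsub>A\<^esub> s, u \<otimes>\<^bsub>A\<^esub> x')} | s x t x' w u.
      (s, x) \<in> frac_fibre y \<and> (t, x') \<in> frac_fibre z \<and> w \<in> S \<and> u \<in> carrier A \<and> w \<otimes>\<^bsub>A\<^esub> x = u \<otimes>\<^bsub>A\<^esub> t}"
  have "fraction_rel A S `` {(w \<otimes>\<^bsub>A\<^esub> s, u \<otimes>\<^bsub>A\<^esub> x')} = frac_fibre (y \<otimes>\<^bsub>B\<^esub> z)"
    if p: "(s, x) \<in> frac_fibre y" "(t, x') \<in> frac_fibre z" and w: "w \<in> S" "u \<in> carrier A" "w \<otimes>\<^bsub>A\<^esub> x = u \<otimes>\<^bsub>A\<^esub> t"
    for s x t x' w u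
  proof -
    have c: "s \<in> S" "x \<in> carrier A" "t \<in> S" "x' \<in> carrier A" and e: "frac_val (s, x) = y" "frac_val (t, x') = z"
      using p by (auto simp: frac_fibre_def)
    have e': "\<phi> x = \<phi> s \<otimes>\<^bsub>B\<^esub> y" "\<phi> x' = \<phi> t \<otimes>\<^bsub>B\<^esub> z"
      using c e assms frac_val_eq_iff by auto
    \<comment> \<open>The auxiliary equation enters as \<open>\<phi>\<close> of \<open>u\<close>
      times \<open>t\<close> being \<open>\<phi>\<close> of \<open>w\<close> times \<open>x\<close>:
      it moves the inner denominator \<open>t\<close> to the left across the numerator
      \<open>x\<close>.\<close>
    have "\<phi> (u \<otimes>\<^bsub>A\<^esub> x') = \<phi> (u \<otimes>\<^bsub>A\<^esub> t) \<otimes>\<^bsub>B\<^esub> z"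
      using c w(1,2) e' assms by (simp add: hom_mult S_carrier hom_closed B.A.m_assoc)
    also have "\<dots> = \<phi> (w \<otimes>\<^bsub>A\<^esub> x) \<otimes>\<^bsub>B\<^esub> z" using w by simp
    also have "\<dots> = \<phi> (w \<otimes>\<^bsub>A\<^esub> s) \<otimes>\<^bsub>B\<^esub> (y \<otimes>\<^bsub>B\<^esub> z)"
      using c w(1,2) e' assms by (simp add: hom_mult S_carrier hom_closed B.A.m_assoc)
    finally have "frac_val (w \<otimes>\<^bsub>A\<^esub> s, u \<otimes>\<^bsub>A\<^esub> x') = y \<otimes>\<^bsub>B\<^esub> z"
      using c w assms by (subst frac_val_eq_iff) (simp_all add: S_mult S_carrier)
    then show ?thesis using c w by (subst fraction_class) (simp_all add: S_mult S_carrier)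
  qed
  note const = this
  obtain s x t x' where p: "s \<in> S" "x \<in> carrier A" "frac_val (s, x) = y" "t \<in> S" "x' \<in> carrier A" "frac_val (t, x') = z"
    using assms fibre_nonempty by metis
  \<comment> \<open>Without such a pair the union defining the product would be empty instead of a
    class.\<close>
  then obtain w u where "w \<in> S" "u \<in> carrier A" "w \<otimes>\<^bsub>A\<^esub> x = u \<otimes>\<^bsub>A\<^esub> t" using ore by metis
  with p have "fraction_rel A S `` {(w \<otimes>\<^bsub>A\<^esub> s, u \<otimes>\<^bsub>A\<^esub> x')} \<in> ?U"
    unfolding frac_fibre_def by blast
  then have "\<Union>?U = frac_fibre (y \<otimes>\<^bsub>B\<^esub> z)"
    by (rule Union_const) (use const in blast)
  then show ?thesis by (simp add: localization_def)
qed

lemma localization_add: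
  assumes "y \<in> carrier B" "z \<in> carrier B"
  shows "frac_fibre y \<oplus>\<^bsub>localization A S\<^esub> frac_fibre z = frac_fibre (y \<oplus>\<^bsub>B\<^esub> z)"
proof -
  let ?U = "{fraction_rel A S `` {(u \<otimes>\<^bsub>A\<^esub> s, u \<otimes>\<^bsub>A\<^esub> x \<oplus>\<^bsub>A\<^esub> v \<otimes>\<^bsub>A\<^esub> x')} | s x t x' u v.
      (s, x) \<in> frac_fibre y \<and> (t, x') \<in> frac_fibre z \<and> u \<in> carrier A \<and> v \<in> carrier A
      \<and> u \<otimes>\<^bsub>A\<^esub> s = v \<otimes>\<^bsub>A\<^esub> t \<and> u \<otimes>\<^bsub>A\<^esub> s \<in> S}"
  have "fraction_rel A S `` {(u \<otimes>\<^bsub>A\<^esub> s, u \<otimes>\<^bsub>A\<^esub> x \<oplus>\<^bsub>A\<^esub> v \<otimes>\<^bsub>A\<^esub> x')} = frac_fibre (y \<oplus>\<^bsub>B\<^esub> z)"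
    if p: "(s, x) \<in> frac_fibre y" "(t, x') \<in> frac_fibre z"
      and u: "u \<in> carrier A" "v \<in> carrier A" "u \<otimes>\<^bsub>A\<^esub> s = v \<otimes>\<^bsub>A\<^esub> t" "u \<otimes>\<^bsub>A\<^esub> s \<in> S"
    for s x t x' u v
  proof -
    have c: "s \<in> S" "x \<in> carrier A" "t \<in> S" "x' \<in> carrier A" and e: "frac_val (s, x) = y" "frac_val (t, x') = z"
      using p by (auto simp: frac_fibre_def)
    have e': "\<phi> x = \<phi> s \<otimes>\<^bsub>B\<^esub> y" "\<phi> x' = \<phi> t \<otimes>\<^bsub>B\<^esub> z"
      using c e assms frac_val_eq_iff by auto
    have "\<phi> (v \<otimes>\<^bsub>A\<^esub> x') = \<phi> (v \<otimes>\<^bsub>A\<^esub> t) \<otimes>\<^bsub>B\<^esub> z"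
      using c u(1,2) e' assms by (simp add: hom_mult S_carrier hom_closed B.A.m_assoc)
    moreover have "\<phi> (u \<otimes>\<^bsub>A\<^esub> x) = \<phi> (u \<otimes>\<^bsub>A\<^esub> s) \<otimes>\<^bsub>B\<^esub> y"
      using c u(1,2) e' assms by (simp add: hom_mult S_carrier hom_closed B.A.m_assoc)
    ultimately have "\<phi> (u \<otimes>\<^bsub>A\<^esub> x \<oplus>\<^bsub>A\<^esub> v \<otimes>\<^bsub>A\<^esub> x') = \<phi> (u \<otimes>\<^bsub>A\<^esub> s) \<otimes>\<^bsub>B\<^esub> (y \<oplus>\<^bsub>B\<^esub> z)"
      using c u assms by (simp add: hom_add hom_closed S_carrier B.A.r_distr)
    then have "frac_val (u \<otimes>\<^bsub>A\<^esub> s, u \<otimes>\<^bsub>A\<^esub> x \<oplus>\<^bsub>A\<^esub> v \<otimes>\<^bsub>A\<^esub> x') = y \<oplus>\<^bsub>B\<^esub> z"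
      using c u(1,2,4) assms by (subst frac_val_eq_iff) simp_all
    then show ?thesis using c u(1,2,4) by (subst fraction_class) simp_all
  qed
  note const = this
  obtain s x t x' where p: "s \<in> S" "x \<in> carrier A" "frac_val (s, x) = y" "t \<in> S" "x' \<in> carrier A" "frac_val (t, x') = z"
    using assms fibre_nonempty by metis
  \<comment> \<open>The definition of the sum admits any \<open>u\<close> in the carrier; the Ore
    condition even gives one in \<open>S\<close>, which puts the common denominator into
    \<open>S\<close>.\<close>
  then obtain u v where "u \<in> S" "v \<in> carrier A" "u \<otimes>\<^bsub>A\<^esub> s = v \<otimes>\<^bsub>A\<^esub> t"
    using ore[of s t] S_carrier by metis
  moreover from this p have "u \<otimes>\<^bsub>A\<^esub> s \<in> S" by (intro S_mult)
  ultimately have "fraction_rel A S `` {(u \<otimes>\<^bsub>A\<^esub> s, u \<otimes>\<^bsub>A\<^esub> x \<oplus>\<^bsub>A\<^esub> v \<otimes>\<^bsub>A\<^esub> x')} \<in> ?U"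
    using p S_carrier unfolding frac_fibre_def by blast
  then have "\<Union>?U = frac_fibre (y \<oplus>\<^bsub>B\<^esub> z)"
    by (rule Union_const) (use const in blast)
  then show ?thesis by (simp add: localization_def)
qed

lemma localization_smult:
  assumes "c \<in> carrier K" "y \<in> carrier B"
  shows "c \<odot>\<^bsub>localization A S\<^esub> frac_fibre y = frac_fibre (c \<odot>\<^bsub>B\<^esub> y)"
proof -
  let ?U = "{fraction_rel A S `` {(s, c \<odot>\<^bsub>A\<^esub> x)} | s x. (s, x) \<in> frac_fibre y}"
  have const: "fraction_rel A S `` {(s, c \<odot>\<^bsub>A\<^esub> x)} = frac_fibre (c \<odot>\<^bsub>B\<^esub> y)"
    if p: "(s, x) \<in> frac_fibre y" for s x
  proof -
    have c: "s \<in> S" "x \<in> carrier A" "frac_val (s, x) = y"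
      using p by (auto simp: frac_fibre_def)
    then have "\<phi> x = \<phi> s \<otimes>\<^bsub>B\<^esub> y" using assms frac_val_eq_iff by auto
    then have "frac_val (s, c \<odot>\<^bsub>A\<^esub> x) = c \<odot>\<^bsub>B\<^esub> y"
      using c(1,2) assms
      by (subst frac_val_eq_iff) (simp_all add: smult_closed_A hom_smult B.smult_mult_right hom_closed S_carrier)
    then show ?thesis using c(1,2) assms by (subst fraction_class) (simp_all add: smult_closed_A)
  qed
  obtain s x where "s \<in> S" "x \<in> carrier A" "frac_val (s, x) = y"
    using assms fibre_nonempty by metis
  then have "fraction_rel A S `` {(s, c \<odot>\<^bsub>A\<^esub> x)} \<in> ?U"
    unfolding frac_fibre_def by blast
  then have "\<Union>?U = frac_fibre (c \<odot>\<^bsub>B\<^esub> y)"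
    by (rule Union_const) (use const in blast)
  then show ?thesis by (simp add: localization_def)
qed

theorem localization_isomorphic: "alg_isomorphic K (localization A S) B"
proof (rule alg_isomorphic_image[where h = frac_fibre])
  \<comment> \<open>Fibres over different values are disjoint and no fibre is empty, so a fibre
    determines its value.\<close>
  show "inj_on frac_fibre (carrier B)"
  proof (rule inj_onI)
    fix y z assume "y \<in> carrier B" "z \<in> carrier B" "frac_fibre y = frac_fibre z"
    then show "y = z" using fibre_nonempty[of y] unfolding frac_fibre_def by blast
  qed
  have "frac_val (\<one>\<^bsub>A\<^esub>, \<one>\<^bsub>A\<^esub>) = \<one>\<^bsub>B\<^esub>" "frac_val (\<one>\<^bsub>A\<^esub>, \<zero>\<^bsub>A\<^esub>) = \<zero>\<^bsub>B\<^esub>"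
    by (simp_all add: frac_val_def hom_one hom_zero)
  then show "\<zero>\<^bsub>localization A S\<^esub> = frac_fibre \<zero>\<^bsub>B\<^esub>" "\<one>\<^bsub>localization A S\<^esub> = frac_fibre \<one>\<^bsub>B\<^esub>"
    by (simp_all add: localization_def fraction_class S_one)
qed (simp_all add: B.assoc_algebra_axioms localization_carrier localization_add localization_mult localization_smult)

end

section \<open>Localization at central regular elements\<close>

text \<open>This is the base ring, where no ring inverting \<open>S\<close> is given in advance, so
  \<open>localizing_hom\<close> cannot be applied and fractions are computed with directly.
  Centrality of the denominators makes this as simple as in commutative algebra.\<close>

locale central_localization = assoc_algebra K D
  for K :: "('k, 'm) ring_scheme" and D :: "('k, 'd, 'n) module_scheme" +
  fixes S :: "'d set"
  assumes submonoid: "submonoid S D" and central: "S \<subseteq> ring_center D"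
    and regular: "s \<in> S \<Longrightarrow> regular_element D s"
begin

lemma S_carrier: "s \<in> S \<Longrightarrow> s \<in> carrier D"
  using submonoid submonoid.subset by blast

lemma S_mult: "s \<in> S \<Longrightarrow> t \<in> S \<Longrightarrow> s \<otimes>\<^bsub>D\<^esub> t \<in> S"
  using submonoid by (rule submonoid.m_closed)

lemma S_one: "\<one>\<^bsub>D\<^esub> \<in> S"
  using submonoid by (rule submonoid.one_closed)

lemma S_comm: "s \<in> S \<Longrightarrow> x \<in> carrier D \<Longrightarrow> x \<otimes>\<^bsub>D\<^esub> s = s \<otimes>\<^bsub>D\<^esub> x"
  using central unfolding ring_center_def by auto

lemma S_lcomm: "s \<in> S \<Longrightarrow> x \<in> carrier D \<Longrightarrow> y \<in> carrier D
    \<Longrightarrow> x \<otimes>\<^bsub>D\<^esub> (s \<otimes>\<^bsub>D\<^esub> y) = s \<otimes>\<^bsub>D\<^esub> (x \<otimes>\<^bsub>D\<^esub> y)"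
  by (simp add: S_comm S_carrier flip: A.m_assoc)

lemma S_cancel: 
  assumes "s \<in> S" "x \<in> carrier D" "y \<in> carrier D" "s \<otimes>\<^bsub>D\<^esub> x = s \<otimes>\<^bsub>D\<^esub> y"
  shows "x = y"
proof -
  have "s \<otimes>\<^bsub>D\<^esub> (x \<ominus>\<^bsub>D\<^esub> y) = s \<otimes>\<^bsub>D\<^esub> x \<ominus>\<^bsub>D\<^esub> s \<otimes>\<^bsub>D\<^esub> y"
    using assms S_carrier by (simp add: A.minus_eq A.r_distr A.r_minus)
  also have "\<dots> = \<zero>\<^bsub>D\<^esub>" using assms S_carrier by simp
  finally have "x \<ominus>\<^bsub>D\<^esub> y = \<zero>\<^bsub>D\<^esub>"
    using regular[OF assms(1)] A.minus_closed[OF assms(2,3)] unfolding regular_element_def by blast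
  then show ?thesis using assms(2,3) by simp
qed

lemma left_denominator_set: "left_denominator_set D S"
  unfolding left_denominator_set_def
proof (intro conjI ballI impI)
  show "submonoid S D" by (rule submonoid)
  fix x s assume xs: "x \<in> carrier D" "s \<in> S"
  then show "\<exists>t\<in>S. \<exists>u\<in>carrier D. t \<otimes>\<^bsub>D\<^esub> x = u \<otimes>\<^bsub>D\<^esub> s"
    using S_comm by metis
  assume "x \<otimes>\<^bsub>D\<^esub> s = \<zero>\<^bsub>D\<^esub>"
  then have "x = \<zero>\<^bsub>D\<^esub>" using regular xs unfolding regular_element_def by blast
  then show "\<exists>t\<in>S. t \<otimes>\<^bsub>D\<^esub> x = \<zero>\<^bsub>D\<^esub>" using S_one by force
qed

section \<open>Arithmetic of fractions with central denominators\<close>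

definition fr :: "'d \<Rightarrow> 'd \<Rightarrow> ('d \<times> 'd) set" where
  "fr s x = fraction_rel D S `` {(s, x)}"

definition L where "L = localization D S"

text \<open>Given multipliers \<open>u\<close> and \<open>v\<close>, both sides of the cross
  multiplied equation are multiplied by the element \<open>u\<close> times \<open>s\<close> of
  \<open>S\<close>, which can be cancelled although nothing is known about \<open>u\<close> alone.
  Conversely, \<open>t\<close> and \<open>s\<close> themselves are suitable multipliers.\<close>

lemma fraction_rel_iff:
  "((s, x), (t, y)) \<in> fraction_rel D S \<longleftrightarrow>
    s \<in> S \<and> t \<in> S \<and> x \<in> carrier D \<and> y \<in> carrier D \<and> t \<otimes>\<^bsub>D\<^esub> x = s \<otimes>\<^bsub>D\<^esub> y"
proof (cases "s \<in> S \<and> t \<in> S \<and> x \<in> carrier D \<and> y \<in> carrier D")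
  case True
  then have c: "s \<in> S" "t \<in> S" "x \<in> carrier D" "y \<in> carrier D" by auto
  have "t \<otimes>\<^bsub>D\<^esub> x = s \<otimes>\<^bsub>D\<^esub> y"
    if u: "u \<in> carrier D" "v \<in> carrier D" and e: "u \<otimes>\<^bsub>D\<^esub> s = v \<otimes>\<^bsub>D\<^esub> t" "u \<otimes>\<^bsub>D\<^esub> s \<in> S"
      "u \<otimes>\<^bsub>D\<^esub> x = v \<otimes>\<^bsub>D\<^esub> y" for u v
  proof (rule S_cancel[OF e(2)])
    have "u \<otimes>\<^bsub>D\<^esub> s \<otimes>\<^bsub>D\<^esub> (t \<otimes>\<^bsub>D\<^esub> x) = s \<otimes>\<^bsub>D\<^esub> (t \<otimes>\<^bsub>D\<^esub> (u \<otimes>\<^bsub>D\<^esub> x))"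
      using c u by (simp add: A.m_assoc S_carrier S_lcomm[of s u] S_lcomm[of t u])
    also have "\<dots> = s \<otimes>\<^bsub>D\<^esub> (v \<otimes>\<^bsub>D\<^esub> t \<otimes>\<^bsub>D\<^esub> y)"
      using c u by (simp add: e(3) A.m_assoc S_carrier S_lcomm[of t v])
    also have "\<dots> = u \<otimes>\<^bsub>D\<^esub> s \<otimes>\<^bsub>D\<^esub> (s \<otimes>\<^bsub>D\<^esub> y)"
      using c u by (simp add: A.m_assoc S_carrier S_lcomm[of s u] flip: e(1))
    finally show "u \<otimes>\<^bsub>D\<^esub> s \<otimes>\<^bsub>D\<^esub> (t \<otimes>\<^bsub>D\<^esub> x) = u \<otimes>\<^bsub>D\<^esub> s \<otimes>\<^bsub>D\<^esub> (s \<otimes>\<^bsub>D\<^esub> y)" .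
  qed (use c S_carrier in auto)
  moreover have "\<exists>u\<in>carrier D. \<exists>v\<in>carrier D. u \<otimes>\<^bsub>D\<^esub> s = v \<otimes>\<^bsub>D\<^esub> t \<and> u \<otimes>\<^bsub>D\<^esub> s \<in> S \<and> u \<otimes>\<^bsub>D\<^esub> x = v \<otimes>\<^bsub>D\<^esub> y"
    if "t \<otimes>\<^bsub>D\<^esub> x = s \<otimes>\<^bsub>D\<^esub> y"
    using c that S_comm[of s t] S_mult[of t s] S_carrier by metis
  ultimately show ?thesis using c unfolding fraction_rel_def by blast
qed (auto simp: fraction_rel_def)

lemma equiv_fraction_rel: "equiv (S \<times> carrier D) (fraction_rel D S)"
proof (rule equivI)
  show "fraction_rel D S \<subseteq> (S \<times> carrier D) \<times> (S \<times> carrier D)"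
    unfolding fraction_rel_def by auto
  show "refl_on (S \<times> carrier D) (fraction_rel D S)"
    by (auto simp: refl_on_def fraction_rel_iff)
  show "sym (fraction_rel D S)" by (auto simp: sym_def fraction_rel_iff)
  show "trans (fraction_rel D S)"
  proof (rule transI, clarify)
    fix s x t y w z
    assume "((s, x), (t, y)) \<in> fraction_rel D S" "((t, y), (w, z)) \<in> fraction_rel D S"
    then have c: "s \<in> S" "t \<in> S" "w \<in> S" "x \<in> carrier D" "y \<in> carrier D" "z \<in> carrier D"
      and e: "t \<otimes>\<^bsub>D\<^esub> x = s \<otimes>\<^bsub>D\<^esub> y" "w \<otimes>\<^bsub>D\<^esub> y = t \<otimes>\<^bsub>D\<^esub> z"
      by (auto simp: fraction_rel_iff)
    \<comment> \<open>The middle denominator \<open>t\<close> is carried as an extra factor that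
      central elements pass freely, and it is cancelled at the end by regularity.\<close>
    have "t \<otimes>\<^bsub>D\<^esub> (w \<otimes>\<^bsub>D\<^esub> x) = w \<otimes>\<^bsub>D\<^esub> (t \<otimes>\<^bsub>D\<^esub> x)" using c by (simp add: S_carrier S_lcomm[of w t])
    also have "\<dots> = w \<otimes>\<^bsub>D\<^esub> (s \<otimes>\<^bsub>D\<^esub> y)" by (simp only: e(1))
    also have "\<dots> = s \<otimes>\<^bsub>D\<^esub> (w \<otimes>\<^bsub>D\<^esub> y)" using c by (intro S_lcomm) (simp_all add: S_carrier)
    also have "\<dots> = s \<otimes>\<^bsub>D\<^esub> (t \<otimes>\<^bsub>D\<^esub> z)" by (simp only: e(2))
    also have "\<dots> = t \<otimes>\<^bsub>D\<^esub> (s \<otimes>\<^bsub>D\<^esub> z)" using c by (intro S_lcomm) (simp_all add: S_carrier)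
    finally have "w \<otimes>\<^bsub>D\<^esub> x = s \<otimes>\<^bsub>D\<^esub> z" by (rule S_cancel[rotated 3]) (use c S_carrier in auto)
    with c show "((s, x), (w, z)) \<in> fraction_rel D S" by (simp add: fraction_rel_iff)
  qed
qed

lemma fr_eq_iff:
  assumes "s \<in> S" "x \<in> carrier D" "t \<in> S" "y \<in> carrier D"
  shows "fr s x = fr t y \<longleftrightarrow> t \<otimes>\<^bsub>D\<^esub> x = s \<otimes>\<^bsub>D\<^esub> y"
proof -
  have "fr s x = fr t y \<longleftrightarrow> ((s, x), (t, y)) \<in> fraction_rel D S"
    unfolding fr_def using assms by (subst eq_equiv_class_iff[OF equiv_fraction_rel]) auto
  then show ?thesis using assms by (simp add: fraction_rel_iff)
qed

lemma mem_fr_iff: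
  "s \<in> S \<Longrightarrow> x \<in> carrier D \<Longrightarrow> (t, y) \<in> fr s x \<longleftrightarrow> t \<in> S \<and> y \<in> carrier D \<and> t \<otimes>\<^bsub>D\<^esub> x = s \<otimes>\<^bsub>D\<^esub> y"
  unfolding fr_def by (auto simp: fraction_rel_iff)

lemma fr_closed: "s \<in> S \<Longrightarrow> x \<in> carrier D \<Longrightarrow> fr s x \<in> carrier L"
  by (auto simp: L_def localization_def fr_def intro: quotientI)

lemma L_cases:
  assumes "p \<in> carrier L" obtains s x where "s \<in> S" "x \<in> carrier D" "p = fr s x"
  using assms unfolding L_def localization_def by (auto simp: fr_def elim: quotientE)

lemma fr_expand:
  assumes "t \<in> S" "s \<in> S" "x \<in> carrier D" shows "fr (t \<otimes>\<^bsub>D\<^esub> s) (t \<otimes>\<^bsub>D\<^esub> x) = fr s x"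
  using assms by (subst fr_eq_iff) (simp_all add: S_mult S_carrier A.m_assoc S_lcomm[of t s])

text \<open>Over one denominator, addition is addition of numerators, so additive laws reduce
  immediately to those of \<open>D\<close>.\<close>

lemma common_denominator:
  assumes "p \<in> carrier L" "q \<in> carrier L"
  obtains s x y where "s \<in> S" "x \<in> carrier D" "y \<in> carrier D" "p = fr s x" "q = fr s y"
proof -
  obtain s x t y where c: "s \<in> S" "x \<in> carrier D" "p = fr s x" "t \<in> S" "y \<in> carrier D" "q = fr t y"
    using assms L_cases by metis
  have "p = fr (t \<otimes>\<^bsub>D\<^esub> s) (t \<otimes>\<^bsub>D\<^esub> x)" "q = fr (t \<otimes>\<^bsub>D\<^esub> s) (s \<otimes>\<^bsub>D\<^esub> y)"
    using c fr_expand[of s t y] fr_expand[of t s x] S_comm[of s t] by (simp_all add: S_carrier)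
  with c that show ?thesis by (metis A.m_closed S_carrier S_mult)
qed

lemma common_denominator3:
  assumes "p \<in> carrier L" "q \<in> carrier L" "r \<in> carrier L"
  obtains s x y z where "s \<in> S" "x \<in> carrier D" "y \<in> carrier D" "z \<in> carrier D"
    "p = fr s x" "q = fr s y" "r = fr s z"
proof -
  obtain s x y where c: "s \<in> S" "x \<in> carrier D" "y \<in> carrier D" "p = fr s x" "q = fr s y"
    using assms(1,2) common_denominator by metis
  obtain t z where d: "t \<in> S" "z \<in> carrier D" "r = fr t z"
    using assms(3) L_cases by metis
  have "p = fr (t \<otimes>\<^bsub>D\<^esub> s) (t \<otimes>\<^bsub>D\<^esub> x)" "q = fr (t \<otimes>\<^bsub>D\<^esub> s) (t \<otimes>\<^bsub>D\<^esub> y)" "r = fr (t \<otimes>\<^bsub>D\<^esub> s) (s \<otimes>\<^bsub>D\<^esub> z)"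
    using c d fr_expand[of s t z] fr_expand[of t s x] fr_expand[of t s y] S_comm[of s t]
    by (simp_all add: S_carrier)
  with c d that show ?thesis by (metis A.m_closed S_carrier S_mult)
qed

lemma fr_mult:
  assumes c: "s \<in> S" "x \<in> carrier D" "t \<in> S" "y \<in> carrier D"
  shows "fr s x \<otimes>\<^bsub>L\<^esub> fr t y = fr (s \<otimes>\<^bsub>D\<^esub> t) (x \<otimes>\<^bsub>D\<^esub> y)"
proof -
  let ?U = "{fr (w \<otimes>\<^bsub>D\<^esub> s') (u \<otimes>\<^bsub>D\<^esub> y') | s' x' t' y' w u.
      (s', x') \<in> fr s x \<and> (t', y') \<in> fr t y \<and> w \<in> S \<and> u \<in> carrier D \<and> w \<otimes>\<^bsub>D\<^esub> x' = u \<otimes>\<^bsub>D\<^esub> t'}"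
  have const: "fr (w \<otimes>\<^bsub>D\<^esub> s') (u \<otimes>\<^bsub>D\<^esub> y') = fr (s \<otimes>\<^bsub>D\<^esub> t) (x \<otimes>\<^bsub>D\<^esub> y)"
    if p: "(s', x') \<in> fr s x" "(t', y') \<in> fr t y" and w: "w \<in> S" "u \<in> carrier D" "w \<otimes>\<^bsub>D\<^esub> x' = u \<otimes>\<^bsub>D\<^esub> t'"
    for s' x' t' y' w u
  proof -
    have d: "s' \<in> S" "x' \<in> carrier D" "t' \<in> S" "y' \<in> carrier D"
      and e: "s' \<otimes>\<^bsub>D\<^esub> x = s \<otimes>\<^bsub>D\<^esub> x'" "t' \<otimes>\<^bsub>D\<^esub> y = t \<otimes>\<^bsub>D\<^esub> y'"
      using p c by (auto simp: mem_fr_iff)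
    have "w \<otimes>\<^bsub>D\<^esub> s' \<otimes>\<^bsub>D\<^esub> (x \<otimes>\<^bsub>D\<^esub> y) = w \<otimes>\<^bsub>D\<^esub> (s' \<otimes>\<^bsub>D\<^esub> x) \<otimes>\<^bsub>D\<^esub> y"
      using c d w(1,2) by (simp add: A.m_assoc S_carrier)
    also have "\<dots> = s \<otimes>\<^bsub>D\<^esub> (w \<otimes>\<^bsub>D\<^esub> x') \<otimes>\<^bsub>D\<^esub> y"
      using c d w(1,2) by (simp add: e A.m_assoc S_carrier S_lcomm[of s w])
    also have "\<dots> = s \<otimes>\<^bsub>D\<^esub> (u \<otimes>\<^bsub>D\<^esub> (t' \<otimes>\<^bsub>D\<^esub> y))"
      using c d w by (simp add: A.m_assoc S_carrier)
    also have "\<dots> = s \<otimes>\<^bsub>D\<^esub> t \<otimes>\<^bsub>D\<^esub> (u \<otimes>\<^bsub>D\<^esub> y')"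
      using c d w(1,2) by (simp add: e A.m_assoc S_carrier S_lcomm[of t u])
    finally have "s \<otimes>\<^bsub>D\<^esub> t \<otimes>\<^bsub>D\<^esub> (u \<otimes>\<^bsub>D\<^esub> y') = w \<otimes>\<^bsub>D\<^esub> s' \<otimes>\<^bsub>D\<^esub> (x \<otimes>\<^bsub>D\<^esub> y)" by simp
    then show ?thesis using c d w by (subst fr_eq_iff) (simp_all add: S_mult S_carrier)
  qed
  \<comment> \<open>A member of the union: the auxiliary elements are \<open>t\<close> and
    \<open>x\<close> themselves, because \<open>t\<close> commutes with \<open>x\<close>.\<close>
  have "(s, x) \<in> fr s x" "(t, y) \<in> fr t y" "t \<otimes>\<^bsub>D\<^esub> x = x \<otimes>\<^bsub>D\<^esub> t"
    using c by (simp_all add: mem_fr_iff S_comm)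
  then have "fr (t \<otimes>\<^bsub>D\<^esub> s) (x \<otimes>\<^bsub>D\<^esub> y) \<in> ?U" using c by blast
  then have "\<Union>?U = fr (s \<otimes>\<^bsub>D\<^esub> t) (x \<otimes>\<^bsub>D\<^esub> y)"
    by (rule Union_const) (use const in blast)
  then show ?thesis by (simp add: L_def localization_def fr_def)
qed

lemma fr_add_general:
  assumes c: "s \<in> S" "x \<in> carrier D" "t \<in> S" "y \<in> carrier D"
  shows "fr s x \<oplus>\<^bsub>L\<^esub> fr t y = fr (t \<otimes>\<^bsub>D\<^esub> s) (t \<otimes>\<^bsub>D\<^esub> x \<oplus>\<^bsub>D\<^esub> s \<otimes>\<^bsub>D\<^esub> y)"
proof -
  let ?U = "{fr (u \<otimes>\<^bsub>D\<^esub> s') (u \<otimes>\<^bsub>D\<^esub> x' \<oplus>\<^bsub>D\<^esub> v \<otimes>\<^bsub>D\<^esub> y') | s' x' t' y' u v.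
      (s', x') \<in> fr s x \<and> (t', y') \<in> fr t y \<and> u \<in> carrier D \<and> v \<in> carrier D
      \<and> u \<otimes>\<^bsub>D\<^esub> s' = v \<otimes>\<^bsub>D\<^esub> t' \<and> u \<otimes>\<^bsub>D\<^esub> s' \<in> S}"
  have const: "fr (u \<otimes>\<^bsub>D\<^esub> s') (u \<otimes>\<^bsub>D\<^esub> x' \<oplus>\<^bsub>D\<^esub> v \<otimes>\<^bsub>D\<^esub> y') = fr (t \<otimes>\<^bsub>D\<^esub> s) (t \<otimes>\<^bsub>D\<^esub> x \<oplus>\<^bsub>D\<^esub> s \<otimes>\<^bsub>D\<^esub> y)"
    if p: "(s', x') \<in> fr s x" "(t', y') \<in> fr t y" and u: "u \<in> carrier D" "v \<in> carrier D"
      "u \<otimes>\<^bsub>D\<^esub> s' = v \<otimes>\<^bsub>D\<^esub> t'" "u \<otimes>\<^bsub>D\<^esub> s' \<in> S"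
    for s' x' t' y' u v
  proof -
    have d: "s' \<in> S" "x' \<in> carrier D" "t' \<in> S" "y' \<in> carrier D"
      and e: "s' \<otimes>\<^bsub>D\<^esub> x = s \<otimes>\<^bsub>D\<^esub> x'" "t' \<otimes>\<^bsub>D\<^esub> y = t \<otimes>\<^bsub>D\<^esub> y'"
      using p c by (auto simp: mem_fr_iff)
    have 1: "u \<otimes>\<^bsub>D\<^esub> s' \<otimes>\<^bsub>D\<^esub> (t \<otimes>\<^bsub>D\<^esub> x) = t \<otimes>\<^bsub>D\<^esub> s \<otimes>\<^bsub>D\<^esub> (u \<otimes>\<^bsub>D\<^esub> x')"
    proof -
      have "u \<otimes>\<^bsub>D\<^esub> s' \<otimes>\<^bsub>D\<^esub> (t \<otimes>\<^bsub>D\<^esub> x) = t \<otimes>\<^bsub>D\<^esub> (u \<otimes>\<^bsub>D\<^esub> (s' \<otimes>\<^bsub>D\<^esub> x))"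
        using c d u(1,2) by (simp add: A.m_assoc S_carrier S_lcomm[of t s'] S_lcomm[of t u])
      also have "\<dots> = t \<otimes>\<^bsub>D\<^esub> s \<otimes>\<^bsub>D\<^esub> (u \<otimes>\<^bsub>D\<^esub> x')"
        using c d u(1,2) by (simp add: e A.m_assoc S_carrier S_lcomm[of s u])
      finally show ?thesis .
    qed
    have "v \<otimes>\<^bsub>D\<^esub> t' \<otimes>\<^bsub>D\<^esub> (s \<otimes>\<^bsub>D\<^esub> y) = s \<otimes>\<^bsub>D\<^esub> (v \<otimes>\<^bsub>D\<^esub> (t' \<otimes>\<^bsub>D\<^esub> y))"
      using c d u(1,2) by (simp add: A.m_assoc S_carrier S_lcomm[of s t'] S_lcomm[of s v])
    also have "\<dots> = t \<otimes>\<^bsub>D\<^esub> s \<otimes>\<^bsub>D\<^esub> (v \<otimes>\<^bsub>D\<^esub> y')"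
      using c d u(1,2) by (simp add: e A.m_assoc S_carrier S_lcomm[of t v] S_lcomm[of t s])
    finally have 2: "u \<otimes>\<^bsub>D\<^esub> s' \<otimes>\<^bsub>D\<^esub> (s \<otimes>\<^bsub>D\<^esub> y) = t \<otimes>\<^bsub>D\<^esub> s \<otimes>\<^bsub>D\<^esub> (v \<otimes>\<^bsub>D\<^esub> y')" using u by simp
    have "t \<otimes>\<^bsub>D\<^esub> s \<otimes>\<^bsub>D\<^esub> (u \<otimes>\<^bsub>D\<^esub> x' \<oplus>\<^bsub>D\<^esub> v \<otimes>\<^bsub>D\<^esub> y')
        = t \<otimes>\<^bsub>D\<^esub> s \<otimes>\<^bsub>D\<^esub> (u \<otimes>\<^bsub>D\<^esub> x') \<oplus>\<^bsub>D\<^esub> t \<otimes>\<^bsub>D\<^esub> s \<otimes>\<^bsub>D\<^esub> (v \<otimes>\<^bsub>D\<^esub> y')"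
      using c d u(1,2) by (intro A.r_distr) (simp_all add: S_carrier)
    also have "\<dots> = u \<otimes>\<^bsub>D\<^esub> s' \<otimes>\<^bsub>D\<^esub> (t \<otimes>\<^bsub>D\<^esub> x \<oplus>\<^bsub>D\<^esub> s \<otimes>\<^bsub>D\<^esub> y)"
      unfolding 1[symmetric] 2[symmetric]
      using c d u(1,2) by (intro A.r_distr[symmetric]) (simp_all add: S_carrier)
    finally show ?thesis using c d u(1,2,4) by (subst fr_eq_iff) (simp_all add: S_mult S_carrier)
  qed
  \<comment> \<open>A member of the union: the multipliers are the two denominators,
    exchanged.\<close>
  have "(s, x) \<in> fr s x" "(t, y) \<in> fr t y" "t \<otimes>\<^bsub>D\<^esub> s = s \<otimes>\<^bsub>D\<^esub> t" "t \<otimes>\<^bsub>D\<^esub> s \<in> S"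
    using c by (simp_all add: mem_fr_iff S_comm S_carrier S_mult)
  then have "fr (t \<otimes>\<^bsub>D\<^esub> s) (t \<otimes>\<^bsub>D\<^esub> x \<oplus>\<^bsub>D\<^esub> s \<otimes>\<^bsub>D\<^esub> y) \<in> ?U" using c S_carrier by blast
  then have "\<Union>?U = fr (t \<otimes>\<^bsub>D\<^esub> s) (t \<otimes>\<^bsub>D\<^esub> x \<oplus>\<^bsub>D\<^esub> s \<otimes>\<^bsub>D\<^esub> y)"
    by (rule Union_const) (use const in blast)
  then show ?thesis by (simp add: L_def localization_def fr_def)
qed

lemma fr_add:
  assumes "s \<in> S" "x \<in> carrier D" "y \<in> carrier D"
  shows "fr s x \<oplus>\<^bsub>L\<^esub> fr s y = fr s (x \<oplus>\<^bsub>D\<^esub> y)"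
  using assms fr_expand[of s s "x \<oplus>\<^bsub>D\<^esub> y"] by (simp add: fr_add_general A.r_distr S_carrier)

lemma fr_smult:
  assumes "c \<in> carrier K" "s \<in> S" "x \<in> carrier D"
  shows "c \<odot>\<^bsub>L\<^esub> fr s x = fr s (c \<odot>\<^bsub>D\<^esub> x)"
proof -
  let ?U = "{fr t (c \<odot>\<^bsub>D\<^esub> y) | t y. (t, y) \<in> fr s x}"
  have const: "fr t (c \<odot>\<^bsub>D\<^esub> y) = fr s (c \<odot>\<^bsub>D\<^esub> x)" if "(t, y) \<in> fr s x" for t y
    using that assms
    by (subst fr_eq_iff) (simp_all add: mem_fr_iff smult_mult_right S_carrier)
  have "fr s (c \<odot>\<^bsub>D\<^esub> x) \<in> ?U" using assms by (auto simp: mem_fr_iff)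
  then have "\<Union>?U = fr s (c \<odot>\<^bsub>D\<^esub> x)"
    by (rule Union_const) (use const in blast)
  then show ?thesis by (simp add: L_def localization_def fr_def)
qed

lemma L_one: "\<one>\<^bsub>L\<^esub> = fr \<one>\<^bsub>D\<^esub> \<one>\<^bsub>D\<^esub>" and L_zero: "\<zero>\<^bsub>L\<^esub> = fr \<one>\<^bsub>D\<^esub> \<zero>\<^bsub>D\<^esub>"
  by (simp_all add: L_def localization_def fr_def)

lemma fr_zero: "s \<in> S \<Longrightarrow> fr s \<zero>\<^bsub>D\<^esub> = \<zero>\<^bsub>L\<^esub>"
  by (simp add: L_zero fr_eq_iff S_one S_carrier)

lemma fr_one: "s \<in> S \<Longrightarrow> fr s s = \<one>\<^bsub>L\<^esub>"
  by (simp add: L_one fr_eq_iff S_one S_carrier)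

lemma abelian_group_L: "abelian_group L"
proof (rule abelian_groupI)
  show "\<zero>\<^bsub>L\<^esub> \<in> carrier L" by (simp add: L_zero fr_closed S_one)
next
  fix p q assume "p \<in> carrier L" "q \<in> carrier L"
  then obtain s x y where "s \<in> S" "x \<in> carrier D" "y \<in> carrier D" "p = fr s x" "q = fr s y"
    by (rule common_denominator)
  then show "p \<oplus>\<^bsub>L\<^esub> q \<in> carrier L" "p \<oplus>\<^bsub>L\<^esub> q = q \<oplus>\<^bsub>L\<^esub> p"
    by (simp_all add: fr_add fr_closed A.a_comm)
next
  fix p q r assume "p \<in> carrier L" "q \<in> carrier L" "r \<in> carrier L"
  then obtain s x y z where "s \<in> S" "x \<in> carrier D" "y \<in> carrier D" "z \<in> carrier D"
    "p = fr s x" "q = fr s y" "r = fr s z"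
    by (rule common_denominator3)
  then show "p \<oplus>\<^bsub>L\<^esub> q \<oplus>\<^bsub>L\<^esub> r = p \<oplus>\<^bsub>L\<^esub> (q \<oplus>\<^bsub>L\<^esub> r)"
    by (simp add: fr_add A.a_assoc)
next
  fix p assume "p \<in> carrier L"
  then obtain s x where p: "s \<in> S" "x \<in> carrier D" "p = fr s x" by (rule L_cases)
  then show "\<zero>\<^bsub>L\<^esub> \<oplus>\<^bsub>L\<^esub> p = p" by (simp add: fr_add flip: fr_zero[of s])
  have "fr s (\<ominus>\<^bsub>D\<^esub> x) \<oplus>\<^bsub>L\<^esub> p = \<zero>\<^bsub>L\<^esub>" using p by (simp add: fr_add A.l_neg fr_zero)
  moreover have "fr s (\<ominus>\<^bsub>D\<^esub> x) \<in> carrier L" using p by (simp add: fr_closed)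
  ultimately show "\<exists>q\<in>carrier L. q \<oplus>\<^bsub>L\<^esub> p = \<zero>\<^bsub>L\<^esub>" by blast
qed

lemma monoid_L: "monoid L"
proof (rule monoidI)
  show "\<one>\<^bsub>L\<^esub> \<in> carrier L" by (simp add: L_one fr_closed S_one)
next
  fix p q assume "p \<in> carrier L" "q \<in> carrier L"
  then show "p \<otimes>\<^bsub>L\<^esub> q \<in> carrier L"
    by (auto elim!: L_cases simp: fr_mult fr_closed S_mult)
next
  fix p q r assume "p \<in> carrier L" "q \<in> carrier L" "r \<in> carrier L"
  then show "p \<otimes>\<^bsub>L\<^esub> q \<otimes>\<^bsub>L\<^esub> r = p \<otimes>\<^bsub>L\<^esub> (q \<otimes>\<^bsub>L\<^esub> r)"
    by (auto elim!: L_cases simp: fr_mult fr_closed S_mult S_carrier A.m_assoc)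
next
  fix p assume "p \<in> carrier L"
  then show "\<one>\<^bsub>L\<^esub> \<otimes>\<^bsub>L\<^esub> p = p" "p \<otimes>\<^bsub>L\<^esub> \<one>\<^bsub>L\<^esub> = p"
    by (auto elim!: L_cases simp: L_one fr_mult S_one S_carrier)
qed

lemma assoc_algebra_L: "assoc_algebra K L"
proof (rule assoc_algebraI)
  show "field K" by (rule K.field_axioms)
  show "ring L"
  proof (rule ringI)
    fix p q r assume "p \<in> carrier L" "q \<in> carrier L" "r \<in> carrier L"
    then obtain s x y t z where c: "s \<in> S" "x \<in> carrier D" "y \<in> carrier D" "t \<in> S" "z \<in> carrier D"
      "p = fr s x" "q = fr s y" "r = fr t z"
      by (metis L_cases common_denominator)
    then show "(p \<oplus>\<^bsub>L\<^esub> q) \<otimes>\<^bsub>L\<^esub> r = p \<otimes>\<^bsub>L\<^esub> r \<oplus>\<^bsub>L\<^esub> q \<otimes>\<^bsub>L\<^esub> r"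
      by (simp add: fr_add fr_mult S_mult A.l_distr)
    show "r \<otimes>\<^bsub>L\<^esub> (p \<oplus>\<^bsub>L\<^esub> q) = r \<otimes>\<^bsub>L\<^esub> p \<oplus>\<^bsub>L\<^esub> r \<otimes>\<^bsub>L\<^esub> q"
      using c by (simp add: fr_add fr_mult S_mult A.r_distr)
  qed (simp_all add: abelian_group_L monoid_L)
  show "module K L"
  proof (rule moduleI)
    fix c p q assume c: "c \<in> carrier K" and pq: "p \<in> carrier L" "q \<in> carrier L"
    from pq obtain s x y where "s \<in> S" "x \<in> carrier D" "y \<in> carrier D" "p = fr s x" "q = fr s y"
      by (rule common_denominator)
    with c show "c \<odot>\<^bsub>L\<^esub> (p \<oplus>\<^bsub>L\<^esub> q) = c \<odot>\<^bsub>L\<^esub> p \<oplus>\<^bsub>L\<^esub> c \<odot>\<^bsub>L\<^esub> q"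
      by (simp add: fr_add fr_smult smult_r_distr)
  next
    fix p assume "p \<in> carrier L"
    then obtain s x where p: "s \<in> S" "x \<in> carrier D" "p = fr s x" by (rule L_cases)
    then show "\<one>\<^bsub>K\<^esub> \<odot>\<^bsub>L\<^esub> p = p" by (simp add: fr_smult)
    fix c assume c: "c \<in> carrier K"
    with p show "c \<odot>\<^bsub>L\<^esub> p \<in> carrier L" by (simp add: fr_smult fr_closed)
    fix d assume "d \<in> carrier K"
    with c p show "(c \<oplus>\<^bsub>K\<^esub> d) \<odot>\<^bsub>L\<^esub> p = c \<odot>\<^bsub>L\<^esub> p \<oplus>\<^bsub>L\<^esub> d \<odot>\<^bsub>L\<^esub> p"
      "(c \<otimes>\<^bsub>K\<^esub> d) \<odot>\<^bsub>L\<^esub> p = c \<odot>\<^bsub>L\<^esub> (d \<odot>\<^bsub>L\<^esub> p)"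
      by (simp_all add: fr_smult fr_add smult_l_distr smult_assoc1)
  qed (simp_all add: K.is_cring abelian_group_L)
next
  fix c p q assume c: "c \<in> carrier K" and pq: "p \<in> carrier L" "q \<in> carrier L"
  from pq(1) obtain s x where p: "s \<in> S" "x \<in> carrier D" "p = fr s x" by (rule L_cases)
  from pq(2) obtain t y where q: "t \<in> S" "y \<in> carrier D" "q = fr t y" by (rule L_cases)
  show "(c \<odot>\<^bsub>L\<^esub> p) \<otimes>\<^bsub>L\<^esub> q = c \<odot>\<^bsub>L\<^esub> (p \<otimes>\<^bsub>L\<^esub> q)" "p \<otimes>\<^bsub>L\<^esub> (c \<odot>\<^bsub>L\<^esub> q) = c \<odot>\<^bsub>L\<^esub> (p \<otimes>\<^bsub>L\<^esub> q)"
    using c p q by (simp_all add: fr_smult fr_mult S_mult smult_mult_left smult_mult_right)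
qed

text \<open>A ring endomorphism preserving \<open>S\<close> carries a cross multiplied equation to
  another one, so the image class does not depend on the representative.\<close>

lemma localization_map_fr:
  assumes \<tau>: "\<tau> \<in> ring_hom D D" "\<tau> ` S \<subseteq> S" and c: "s \<in> S" "x \<in> carrier D"
  shows "localization_map D S \<tau> (fr s x) = fr (\<tau> s) (\<tau> x)"
proof -
  let ?U = "{fr (\<tau> t) (\<tau> y) | t y. (t, y) \<in> fr s x}"
  have const: "fr (\<tau> t) (\<tau> y) = fr (\<tau> s) (\<tau> x)" if "(t, y) \<in> fr s x" for t y
  proof -
    have d: "t \<in> S" "y \<in> carrier D" "t \<otimes>\<^bsub>D\<^esub> x = s \<otimes>\<^bsub>D\<^esub> y" using that c by (simp_all add: mem_fr_iff)
    have "\<tau> t \<otimes>\<^bsub>D\<^esub> \<tau> x = \<tau> s \<otimes>\<^bsub>D\<^esub> \<tau> y"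
      using c d by (simp add: S_carrier flip: ring_hom_mult[OF \<tau>(1)])
    then show ?thesis using c d \<tau>(2) ring_hom_closed[OF \<tau>(1)] by (subst fr_eq_iff) auto
  qed
  have "fr (\<tau> s) (\<tau> x) \<in> ?U" using c by (auto simp: mem_fr_iff)
  then have "\<Union>?U = fr (\<tau> s) (\<tau> x)"
    by (rule Union_const) (use const in blast)
  then show ?thesis by (simp add: localization_map_def fr_def)
qed

lemma localization_map_hom:
  assumes \<tau>: "\<tau> \<in> ring_hom D D" "\<tau> ` S \<subseteq> S"
  shows "localization_map D S \<tau> \<in> ring_hom L L"
proof -
  note [simp] = localization_map_fr[OF \<tau>] ring_hom_closed[OF \<tau>(1)] ring_hom_mult[OF \<tau>(1)]
    ring_hom_add[OF \<tau>(1)] ring_hom_one[OF \<tau>(1)] fr_mult fr_add fr_closed S_mult S_carrier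
  have tS: "\<tau> s \<in> S" if "s \<in> S" for s using \<tau>(2) that by blast
  show ?thesis
  proof (rule ring_hom_memI)
    fix p q assume "p \<in> carrier L" "q \<in> carrier L"
    then show "localization_map D S \<tau> (p \<otimes>\<^bsub>L\<^esub> q) = localization_map D S \<tau> p \<otimes>\<^bsub>L\<^esub> localization_map D S \<tau> q"
      by (auto elim!: L_cases simp: tS)
    obtain s x y where "s \<in> S" "x \<in> carrier D" "y \<in> carrier D" "p = fr s x" "q = fr s y"
      using \<open>p \<in> carrier L\<close> \<open>q \<in> carrier L\<close> by (rule common_denominator)
    then show "localization_map D S \<tau> (p \<oplus>\<^bsub>L\<^esub> q) = localization_map D S \<tau> p \<oplus>\<^bsub>L\<^esub> localization_map D S \<tau> q"
      by (simp add: tS)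
  qed (auto elim!: L_cases simp: tS L_one S_one)
qed

text \<open>The canonical map from \<open>D\<close> to its localization is injective. This is how
  equations between coefficients in the skew group ring return to \<open>D\<close>.\<close>

lemma fr_one_eq_iff: "x \<in> carrier D \<Longrightarrow> y \<in> carrier D \<Longrightarrow> fr \<one>\<^bsub>D\<^esub> x = fr \<one>\<^bsub>D\<^esub> y \<longleftrightarrow> x = y"
  by (simp add: fr_eq_iff S_one)

end

section \<open>Automorphisms and the set of denominators\<close>

lemma regular_element_closed: "regular_element R z \<Longrightarrow> z \<in> carrier R"
  unfolding regular_element_def by blast

context assoc_algebra
begin

lemma alg_Aut_iff:
  "\<tau> \<in> carrier (alg_Aut K A) \<longleftrightarrow> \<tau> \<in> Bij (carrier A) \<and> \<tau> \<in> ring_hom A A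
    \<and> (\<forall>c\<in>carrier K. \<forall>x\<in>carrier A. \<tau> (c \<odot>\<^bsub>A\<^esub> x) = c \<odot>\<^bsub>A\<^esub> \<tau> x)"
  by (auto simp: alg_Aut_def alg_iso_def ring_iso_def Bij_def)

lemma alg_Aut_hom: "\<tau> \<in> carrier (alg_Aut K A) \<Longrightarrow> \<tau> \<in> ring_hom A A"
  by (simp add: alg_Aut_iff)

lemma alg_Aut_smult:
  "\<lbrakk>\<tau> \<in> carrier (alg_Aut K A); c \<in> carrier K; x \<in> carrier A\<rbrakk> \<Longrightarrow> \<tau> (c \<odot>\<^bsub>A\<^esub> x) = c \<odot>\<^bsub>A\<^esub> \<tau> x"
  by (simp add: alg_Aut_iff)

lemma alg_Aut_closed: "\<lbrakk>\<tau> \<in> carrier (alg_Aut K A); x \<in> carrier A\<rbrakk> \<Longrightarrow> \<tau> x \<in> carrier A"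
  using alg_Aut_hom ring_hom_closed by fast

lemma alg_Aut_mult:
  "\<lbrakk>\<tau> \<in> carrier (alg_Aut K A); \<rho> \<in> carrier (alg_Aut K A); x \<in> carrier A\<rbrakk>
    \<Longrightarrow> (\<tau> \<otimes>\<^bsub>alg_Aut K A\<^esub> \<rho>) x = \<tau> (\<rho> x)"
  by (simp add: alg_Aut_iff) (simp add: alg_Aut_def BijGroup_def compose_def)

lemma alg_Aut_one: "x \<in> carrier A \<Longrightarrow> \<one>\<^bsub>alg_Aut K A\<^esub> x = x"
  by (simp add: alg_Aut_def BijGroup_def)

lemma group_alg_Aut: "group (alg_Aut K A)"
proof -
  let ?B = "BijGroup (carrier A)" and ?C = "extensional (carrier A) \<inter> alg_iso K A A"
  interpret B: group ?B by (rule group_BijGroup)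
  have C: "\<tau> \<in> ?C \<longleftrightarrow> \<tau> \<in> Bij (carrier A) \<and> \<tau> \<in> ring_hom A A
    \<and> (\<forall>c\<in>carrier K. \<forall>x\<in>carrier A. \<tau> (c \<odot>\<^bsub>A\<^esub> x) = c \<odot>\<^bsub>A\<^esub> \<tau> x)" for \<tau>
    using alg_Aut_iff[of \<tau>] by (simp add: alg_Aut_def)
  have "subgroup ?C ?B"
  proof (rule B.subgroupI)
    show "?C \<subseteq> carrier ?B" unfolding subset_iff C by (simp add: BijGroup_def)
    have "(\<lambda>x\<in>carrier A. x) \<in> ?C"
      unfolding C by (auto simp: id_Bij intro!: ring_hom_memI)
    then show "?C \<noteq> {}" by blast
  next
    fix \<tau> assume "\<tau> \<in> ?C"
    then have \<tau>: "\<tau> \<in> Bij (carrier A)" "\<tau> \<in> ring_hom A A"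
      and sm: "\<And>c x. \<lbrakk>c \<in> carrier K; x \<in> carrier A\<rbrakk> \<Longrightarrow> \<tau> (c \<odot>\<^bsub>A\<^esub> x) = c \<odot>\<^bsub>A\<^esub> \<tau> x"
      unfolding C by auto
    let ?g = "\<lambda>x\<in>carrier A. inv_into (carrier A) \<tau> x"
    have im: "\<tau> ` carrier A = carrier A" and inj: "inj_on \<tau> (carrier A)"
      using \<tau>(1) by (auto simp: Bij_def bij_betw_def)
    have gt: "?g (\<tau> x) = x" if "x \<in> carrier A" for x
      using that inj ring_hom_closed[OF \<tau>(2)] by simp
    \<comment> \<open>Arguments of the inverse map are written as values of \<open>\<tau>\<close>,
      so that each law for the inverse reduces through \<open>gt\<close> to the same law for
      \<open>\<tau>\<close>.\<close>
    have ex: "\<exists>x\<in>carrier A. y = \<tau> x" if "y \<in> carrier A" for y using im that by blast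
    have "?g \<in> ring_hom A A"
    proof (rule ring_hom_memI)
      fix y assume "y \<in> carrier A"
      then obtain x where x: "x \<in> carrier A" "y = \<tau> x" using ex by blast
      then show "?g y \<in> carrier A" by (simp only: gt)
      fix z assume "z \<in> carrier A"
      then obtain w where "w \<in> carrier A" "z = \<tau> w" using ex by blast
      with x have xw: "x \<in> carrier A" "w \<in> carrier A" "y = \<tau> x" "z = \<tau> w" by simp_all
      show "?g (y \<otimes>\<^bsub>A\<^esub> z) = ?g y \<otimes>\<^bsub>A\<^esub> ?g z"
        using xw gt[of x] gt[of w] gt[of "x \<otimes>\<^bsub>A\<^esub> w"] by (simp only: A.m_closed flip: ring_hom_mult[OF \<tau>(2)])
      show "?g (y \<oplus>\<^bsub>A\<^esub> z) = ?g y \<oplus>\<^bsub>A\<^esub> ?g z"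
        using xw gt[of x] gt[of w] gt[of "x \<oplus>\<^bsub>A\<^esub> w"] by (simp only: A.a_closed flip: ring_hom_add[OF \<tau>(2)])
    next
      show "?g \<one>\<^bsub>A\<^esub> = \<one>\<^bsub>A\<^esub>" using gt[of "\<one>\<^bsub>A\<^esub>"] ring_hom_one[OF \<tau>(2)] by (simp only: A.one_closed)
    qed
    moreover have "?g (c \<odot>\<^bsub>A\<^esub> y) = c \<odot>\<^bsub>A\<^esub> ?g y" if c: "c \<in> carrier K" and y: "y \<in> carrier A" for c y
    proof -
      obtain x where "x \<in> carrier A" "y = \<tau> x" using ex[OF y] by blast
      then show ?thesis using gt[of x] gt[of "c \<odot>\<^bsub>A\<^esub> x"] c sm[of c x] by (simp only: smult_closed)
    qed
    ultimately show "inv\<^bsub>?B\<^esub> \<tau> \<in> ?C"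
      unfolding C using \<tau>(1) by (simp add: inv_BijGroup restrict_inv_into_Bij)
  next
    fix \<tau> \<rho> assume \<tau>: "\<tau> \<in> ?C" and \<rho>: "\<rho> \<in> ?C"
    have \<tau>h: "\<tau> \<in> ring_hom A A" and \<rho>h: "\<rho> \<in> ring_hom A A" using \<tau> \<rho> unfolding C by auto
    note closed = ring_hom_closed[OF \<tau>h] ring_hom_closed[OF \<rho>h]
    have "\<tau> \<otimes>\<^bsub>?B\<^esub> \<rho> = compose (carrier A) \<tau> \<rho>"
      using \<tau> \<rho> unfolding C by (simp add: BijGroup_def)
    moreover have "compose (carrier A) \<tau> \<rho> \<in> ?C"
      using \<tau> \<rho> unfolding C
      by (auto simp: compose_Bij compose_eq closed ring_hom_mult[OF \<tau>h] ring_hom_mult[OF \<rho>h]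
          ring_hom_add[OF \<tau>h] ring_hom_add[OF \<rho>h] ring_hom_one[OF \<tau>h] ring_hom_one[OF \<rho>h]
          intro!: ring_hom_memI)
    ultimately show "\<tau> \<otimes>\<^bsub>?B\<^esub> \<rho> \<in> ?C" by simp
  qed
  then show ?thesis unfolding alg_Aut_def by (rule B.subgroup_imp_group)
qed

sublocale Aut: group "alg_Aut K A" by (rule group_alg_Aut)

lemma alg_Aut_inv:
  assumes "\<tau> \<in> carrier (alg_Aut K A)" "x \<in> carrier A"
  shows "(inv\<^bsub>alg_Aut K A\<^esub> \<tau>) (\<tau> x) = x" "\<tau> ((inv\<^bsub>alg_Aut K A\<^esub> \<tau>) x) = x"
  using assms Aut.inv_closed[OF assms(1)]
  by (simp_all add: alg_Aut_one flip: alg_Aut_mult)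

lemma alg_Aut_zero: "\<tau> \<in> carrier (alg_Aut K A) \<Longrightarrow> \<tau> \<zero>\<^bsub>A\<^esub> = \<zero>\<^bsub>A\<^esub>"
  using alg_Aut_hom A.ring_axioms by (meson ring_hom_zero)

text \<open>Testing \<open>\<tau> z\<close> against \<open>x\<close> amounts to testing
  \<open>z\<close> against the preimage of \<open>x\<close>.\<close>

lemma alg_Aut_center:
  assumes \<tau>: "\<tau> \<in> carrier (alg_Aut K A)" and z: "z \<in> ring_center A"
  shows "\<tau> z \<in> ring_center A"
proof -
  let ?i = "inv\<^bsub>alg_Aut K A\<^esub> \<tau>"
  have c: "z \<in> carrier A" "\<And>x. x \<in> carrier A \<Longrightarrow> z \<otimes>\<^bsub>A\<^esub> x = x \<otimes>\<^bsub>A\<^esub> z"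
    using z by (auto simp: ring_center_def)
  have "\<tau> z \<otimes>\<^bsub>A\<^esub> x = x \<otimes>\<^bsub>A\<^esub> \<tau> z" if x: "x \<in> carrier A" for x
  proof -
    have i: "?i x \<in> carrier A" by (rule alg_Aut_closed) (use \<tau> x in simp_all)
    have "\<tau> z \<otimes>\<^bsub>A\<^esub> x = \<tau> (z \<otimes>\<^bsub>A\<^esub> ?i x)" "x \<otimes>\<^bsub>A\<^esub> \<tau> z = \<tau> (?i x \<otimes>\<^bsub>A\<^esub> z)"
      using \<tau> x c(1) i by (simp_all add: ring_hom_mult[OF alg_Aut_hom[OF \<tau>]] alg_Aut_inv)
    with c(2)[OF i] show ?thesis by simp
  qed
  then show ?thesis using \<tau> c by (auto simp: ring_center_def alg_Aut_closed)
qed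

text \<open>The inverse automorphism turns an annihilator of \<open>\<tau> z\<close> into an
  annihilator of \<open>z\<close>.\<close>

lemma alg_Aut_regular:
  assumes \<tau>: "\<tau> \<in> carrier (alg_Aut K A)" and z: "regular_element A z"
  shows "regular_element A (\<tau> z)"
proof -
  let ?i = "inv\<^bsub>alg_Aut K A\<^esub> \<tau>"
  have c: "z \<in> carrier A" using z by (rule regular_element_closed)
  have i: "?i \<in> carrier (alg_Aut K A)" using \<tau> by simp
  have "x = \<zero>\<^bsub>A\<^esub>" if x: "x \<in> carrier A" and 0: "\<tau> z \<otimes>\<^bsub>A\<^esub> x = \<zero>\<^bsub>A\<^esub> \<or> x \<otimes>\<^bsub>A\<^esub> \<tau> z = \<zero>\<^bsub>A\<^esub>" for x
  proof -
    have "?i (\<tau> z \<otimes>\<^bsub>A\<^esub> x) = z \<otimes>\<^bsub>A\<^esub> ?i x" "?i (x \<otimes>\<^bsub>A\<^esub> \<tau> z) = ?i x \<otimes>\<^bsub>A\<^esub> z"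
      using \<tau> c x by (simp_all add: ring_hom_mult[OF alg_Aut_hom[OF i]] alg_Aut_closed alg_Aut_inv)
    then have "z \<otimes>\<^bsub>A\<^esub> ?i x = \<zero>\<^bsub>A\<^esub> \<or> ?i x \<otimes>\<^bsub>A\<^esub> z = \<zero>\<^bsub>A\<^esub>" using 0 i alg_Aut_zero by metis
    then have "?i x = \<zero>\<^bsub>A\<^esub>" using z alg_Aut_closed[OF i x] unfolding regular_element_def by blast
    then show ?thesis using alg_Aut_inv(2)[OF \<tau> x] alg_Aut_zero[OF \<tau>] by simp
  qed
  then show ?thesis using alg_Aut_closed[OF \<tau> c] unfolding regular_element_def by blast
qed

text \<open>Together with the corresponding fact for regular elements, this lets a property of the
  generators of \<open>S\<close> spread to all of \<open>S\<close> by minimality.\<close>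

lemma ring_center_submonoid: "submonoid (ring_center A) A"
proof
  fix x y assume "x \<in> ring_center A" "y \<in> ring_center A"
  then have c: "x \<in> carrier A" "y \<in> carrier A"
    and x: "\<And>z. z \<in> carrier A \<Longrightarrow> x \<otimes>\<^bsub>A\<^esub> z = z \<otimes>\<^bsub>A\<^esub> x"
    and y: "\<And>z. z \<in> carrier A \<Longrightarrow> y \<otimes>\<^bsub>A\<^esub> z = z \<otimes>\<^bsub>A\<^esub> y"
    by (auto simp: ring_center_def)
  have "x \<otimes>\<^bsub>A\<^esub> y \<otimes>\<^bsub>A\<^esub> z = z \<otimes>\<^bsub>A\<^esub> (x \<otimes>\<^bsub>A\<^esub> y)" if z: "z \<in> carrier A" for z
  proof -
    have "x \<otimes>\<^bsub>A\<^esub> y \<otimes>\<^bsub>A\<^esub> z = x \<otimes>\<^bsub>A\<^esub> (z \<otimes>\<^bsub>A\<^esub> y)" using c z by (simp add: A.m_assoc y[OF z])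
    also have "\<dots> = z \<otimes>\<^bsub>A\<^esub> (x \<otimes>\<^bsub>A\<^esub> y)" using c z by (simp add: x[OF z] flip: A.m_assoc)
    finally show ?thesis .
  qed
  then show "x \<otimes>\<^bsub>A\<^esub> y \<in> ring_center A" using c by (simp add: ring_center_def)
qed (auto simp: ring_center_def)

lemma regular_submonoid: "submonoid {x. regular_element A x} A"
proof
  fix x y assume "x \<in> {x. regular_element A x}" "y \<in> {x. regular_element A x}"
  then have x: "regular_element A x" and y: "regular_element A y" by auto
  then have c: "x \<in> carrier A" "y \<in> carrier A" by (simp_all add: regular_element_closed)
  have "z = \<zero>\<^bsub>A\<^esub>" if z: "z \<in> carrier A" "x \<otimes>\<^bsub>A\<^esub> y \<otimes>\<^bsub>A\<^esub> z = \<zero>\<^bsub>A\<^esub> \<or> z \<otimes>\<^bsub>A\<^esub> (x \<otimes>\<^bsub>A\<^esub> y) = \<zero>\<^bsub>A\<^esub>" for z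
  proof -
    from z c have "x \<otimes>\<^bsub>A\<^esub> (y \<otimes>\<^bsub>A\<^esub> z) = \<zero>\<^bsub>A\<^esub> \<or> z \<otimes>\<^bsub>A\<^esub> x \<otimes>\<^bsub>A\<^esub> y = \<zero>\<^bsub>A\<^esub>"
      by (simp add: A.m_assoc)
    moreover have "y \<otimes>\<^bsub>A\<^esub> z \<in> carrier A" "z \<otimes>\<^bsub>A\<^esub> x \<in> carrier A" using z c by auto
    ultimately show ?thesis using x y z(1) unfolding regular_element_def by blast
  qed
  then show "x \<otimes>\<^bsub>A\<^esub> y \<in> {x. regular_element A x}"
    using A.m_closed[OF c] unfolding regular_element_def by blast
next
  show "\<one>\<^bsub>A\<^esub> \<in> {x. regular_element A x}" by (simp add: regular_element_def)
qed (auto dest: regular_element_closed)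

end

text \<open>The centralizer of \<open>x\<close> is a subgroup, so it contains the negative powers of
  \<open>y\<close> too.\<close>

lemma (in group) commute_int_pow:
  assumes "x \<in> carrier G" "y \<in> carrier G" "x \<otimes> y = y \<otimes> x"
  shows "x \<otimes> y [^] (n::int) = y [^] n \<otimes> x"
proof -
  have "subgroup {z \<in> carrier G. x \<otimes> z = z \<otimes> x} G"
  proof (rule subgroupI)
    fix z assume "z \<in> {z \<in> carrier G. x \<otimes> z = z \<otimes> x}"
    then have z: "z \<in> carrier G" "x \<otimes> z = z \<otimes> x" by auto
    have "x \<otimes> inv z = inv z \<otimes> (z \<otimes> x) \<otimes> inv z"
      using z(1) assms by (simp add: m_assoc[symmetric])
    also have "\<dots> = inv z \<otimes> x" using z assms by (simp add: m_assoc flip: z(2))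
    finally show "inv z \<in> {z \<in> carrier G. x \<otimes> z = z \<otimes> x}" using z by simp
  next
    fix z w assume "z \<in> {z \<in> carrier G. x \<otimes> z = z \<otimes> x}" "w \<in> {z \<in> carrier G. x \<otimes> z = z \<otimes> x}"
    then show "z \<otimes> w \<in> {z \<in> carrier G. x \<otimes> z = z \<otimes> x}"
      using assms(1) by auto (metis m_assoc)
  qed (use assms in auto)
  from subgroup_int_pow_closed[OF this, of y n] assms show ?thesis by simp
qed

lemma submonoid_Inter:
  assumes "\<T> \<noteq> {}" and sub: "\<And>T. T \<in> \<T> \<Longrightarrow> submonoid T G"
  shows "submonoid (\<Inter>\<T>) G"
proof
  show "\<Inter>\<T> \<subseteq> carrier G" using assms submonoid.subset by blast
  show "x \<otimes>\<^bsub>G\<^esub> y \<in> \<Inter>\<T>" if "x \<in> \<Inter>\<T>" "y \<in> \<Inter>\<T>" for x y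
    using that submonoid.m_closed[OF sub] by blast
  show "\<one>\<^bsub>G\<^esub> \<in> \<Inter>\<T>" using submonoid.one_closed[OF sub] by blast
qed

text \<open>The third fact serves as the induction principle for \<open>S\<close>: a property is
  established by exhibiting it as a submonoid that contains the generators.\<close>

lemma
  assumes "gwa_data K D r \<sigma> a"
  defines "S \<equiv> gwa_mult_set K D r \<sigma> a"
  shows gwa_mult_set_submonoid: "submonoid S D"
    and gwa_mult_set_generators: "\<And>i j n. \<lbrakk>i \<in> Field r; j \<in> Field r\<rbrakk> \<Longrightarrow> (\<sigma> j [^]\<^bsub>alg_Aut K D\<^esub> (n::int)) (a i) \<in> S"
    and gwa_mult_set_least: "\<And>T. \<lbrakk>submonoid T D; \<And>i j n. \<lbrakk>i \<in> Field r; j \<in> Field r\<rbrakk>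
        \<Longrightarrow> (\<sigma> j [^]\<^bsub>alg_Aut K D\<^esub> (n::int)) (a i) \<in> T\<rbrakk> \<Longrightarrow> S \<subseteq> T"
proof -
  interpret gwa_data K D r \<sigma> a by fact
  let ?g = "{(\<sigma> j [^]\<^bsub>alg_Aut K D\<^esub> n) (a i) | i j (n::int). i \<in> Field r \<and> j \<in> Field r}"
  have "?g \<subseteq> carrier D"
    using a_central sigma_aut by (auto simp: ring_center_def alg_Aut_closed)
  moreover have "submonoid (carrier D) D" by unfold_locales auto
  \<comment> \<open>The family being intersected is not empty; this is what keeps the intersection
    inside the carrier.\<close>
  ultimately have "carrier D \<in> {T. submonoid T D \<and> ?g \<subseteq> T}" by blast
  then show "submonoid S D"
    unfolding S_def gwa_mult_set_def
    by (intro submonoid_Inter) auto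
  show "(\<sigma> j [^]\<^bsub>alg_Aut K D\<^esub> n) (a i) \<in> S" if "i \<in> Field r" "j \<in> Field r" for i j and n :: int
    using that unfolding S_def gwa_mult_set_def by blast
  show "S \<subseteq> T" if "submonoid T D" "\<And>i j n. \<lbrakk>i \<in> Field r; j \<in> Field r\<rbrakk>
        \<Longrightarrow> (\<sigma> j [^]\<^bsub>alg_Aut K D\<^esub> (n::int)) (a i) \<in> T" for T
    using that unfolding S_def gwa_mult_set_def by blast
qed

locale regular_gwa = gwa_data K D r \<sigma> a
  for K :: "('k, 'm) ring_scheme" and D :: "('k, 'd, 'n) module_scheme"
    and r :: "'i rel" and \<sigma> and a +
  assumes regular_a: "gwa_regular D r a" and surjective_type: "gwa_surjective_type K D r \<sigma>"
begin

abbreviation "Aut \<equiv> alg_Aut K D"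
abbreviation "S \<equiv> gwa_mult_set K D r \<sigma> a"
abbreviation "G \<equiv> free_Abelian_group (Field r)"
abbreviation "\<xi> \<equiv> gwa_xi K D r \<sigma>"

lemma a_closed: "i \<in> Field r \<Longrightarrow> a i \<in> carrier D"
  using a_central by (auto simp: ring_center_def)

lemma sigma_pow_closed: "j \<in> Field r \<Longrightarrow> \<sigma> j [^]\<^bsub>Aut\<^esub> (n::int) \<in> carrier Aut"
  using sigma_aut by simp

lemma S_central: "S \<subseteq> ring_center D"
  using gwa_data_axioms ring_center_submonoid
  by (rule gwa_mult_set_least) (rule alg_Aut_center[OF sigma_pow_closed a_central])

lemma S_regular: "s \<in> S \<Longrightarrow> regular_element D s"
  using gwa_mult_set_least[OF gwa_data_axioms regular_submonoid] alg_Aut_regular[OF sigma_pow_closed] regular_a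
  unfolding gwa_regular_def by blast

sublocale central_localization K D S
proof (intro central_localization.intro central_localization_axioms.intro assoc_algebra_axioms)
  show "submonoid S D" using gwa_data_axioms by (rule gwa_mult_set_submonoid)
  show "S \<subseteq> ring_center D" by (rule S_central)
  show "regular_element D s" if "s \<in> S" for s using that by (rule S_regular)
qed

text \<open>This is the generator with exponent 0, taking \<open>i\<close> also as the index of the
  automorphism.\<close>

lemma a_in_S: "i \<in> Field r \<Longrightarrow> a i \<in> S"
  using gwa_mult_set_generators[OF gwa_data_axioms, of i i 0] by (simp add: alg_Aut_one a_closed)

text \<open>Equality, not mere inclusion, of the image makes the stabilizer closed under inverses.
  It is applied to singletons and to \<open>S\<close>.\<close>

lemma stabilizer_subgroup:
  assumes "T \<subseteq> carrier D" shows "subgroup {\<tau> \<in> carrier Aut. \<tau> ` T = T} Aut"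
proof (rule Aut.subgroupI)
  have "\<one>\<^bsub>Aut\<^esub> ` T = T" using assms by (force simp: alg_Aut_one)
  then show "{\<tau> \<in> carrier Aut. \<tau> ` T = T} \<noteq> {}" by blast
next
  fix \<tau> assume "\<tau> \<in> {\<tau> \<in> carrier Aut. \<tau> ` T = T}"
  then have \<tau>: "\<tau> \<in> carrier Aut" "\<tau> ` T = T" by auto
  have "(inv\<^bsub>Aut\<^esub> \<tau>) ` T = (inv\<^bsub>Aut\<^esub> \<tau>) ` \<tau> ` T" using \<tau> by simp
  also have "\<dots> = T" using \<tau>(1) assms by (force simp: alg_Aut_inv image_image)
  finally show "inv\<^bsub>Aut\<^esub> \<tau> \<in> {\<tau> \<in> carrier Aut. \<tau> ` T = T}" using \<tau>(1) by simp
next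
  fix \<tau> \<rho> assume "\<tau> \<in> {\<tau> \<in> carrier Aut. \<tau> ` T = T}" "\<rho> \<in> {\<tau> \<in> carrier Aut. \<tau> ` T = T}"
  then have \<tau>: "\<tau> \<in> carrier Aut" "\<tau> ` T = T" and \<rho>: "\<rho> \<in> carrier Aut" "\<rho> ` T = T" by auto
  have "(\<tau> \<otimes>\<^bsub>Aut\<^esub> \<rho>) ` T = \<tau> ` \<rho> ` T"
    unfolding image_image using \<tau> \<rho> assms by (intro image_cong) (auto simp: alg_Aut_mult)
  with \<tau> \<rho> show "\<tau> \<otimes>\<^bsub>Aut\<^esub> \<rho> \<in> {\<tau> \<in> carrier Aut. \<tau> ` T = T}" by simp
qed auto

text \<open>The stabilizer of the singleton of \<open>x\<close> is a subgroup, so negative powers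
  are covered as well.\<close>

lemma sigma_pow_fixes:
  assumes "\<beta> \<in> Field r" "x \<in> carrier D" "\<sigma> \<beta> x = x"
  shows "(\<sigma> \<beta> [^]\<^bsub>Aut\<^esub> (n::int)) x = x"
  using Aut.subgroup_int_pow_closed[OF stabilizer_subgroup, of "{x}" "\<sigma> \<beta>" n] assms sigma_aut by simp

text \<open>Only \<open>\<sigma> i\<close> can move \<open>a i\<close>. If both automorphisms are
  \<open>\<sigma> i\<close>, exponents add; if only the outer one is, the inner power acts
  trivially; otherwise the outer one commutes past the inner power and fixes
  \<open>a i\<close>.\<close>

lemma sigma_pow_generator:
  assumes "i \<in> Field r" "j \<in> Field r" "\<beta> \<in> Field r"
  shows "\<exists>k\<in>Field r. \<exists>l::int. (\<sigma> \<beta> [^]\<^bsub>Aut\<^esub> (m::int)) ((\<sigma> j [^]\<^bsub>Aut\<^esub> (n::int)) (a i)) = (\<sigma> k [^]\<^bsub>Aut\<^esub> l) (a i)"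
proof (cases "\<beta> = i")
  case True
  show ?thesis
  proof (cases "j = i")
    case True
    then have "(\<sigma> \<beta> [^]\<^bsub>Aut\<^esub> m) ((\<sigma> j [^]\<^bsub>Aut\<^esub> n) (a i)) = (\<sigma> \<beta> [^]\<^bsub>Aut\<^esub> (m + n)) (a i)"
      using assms \<open>\<beta> = i\<close> sigma_aut by (simp add: Aut.int_pow_mult alg_Aut_mult a_closed)
    with assms show ?thesis by blast
  next
    case False
    then have "(\<sigma> j [^]\<^bsub>Aut\<^esub> n) (a i) = a i"
      using assms by (intro sigma_pow_fixes) (auto simp: a_closed sigma_fixes_a)
    with assms show ?thesis by auto
  qed
next
  case False
  have j: "\<sigma> j [^]\<^bsub>Aut\<^esub> n \<in> carrier Aut" and b: "\<sigma> \<beta> \<in> carrier Aut" using assms sigma_aut by simp_all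
  have "\<sigma> \<beta> ((\<sigma> j [^]\<^bsub>Aut\<^esub> n) (a i)) = (\<sigma> \<beta> \<otimes>\<^bsub>Aut\<^esub> \<sigma> j [^]\<^bsub>Aut\<^esub> n) (a i)"
    using j b assms by (simp add: alg_Aut_mult a_closed)
  also have "\<dots> = (\<sigma> j [^]\<^bsub>Aut\<^esub> n \<otimes>\<^bsub>Aut\<^esub> \<sigma> \<beta>) (a i)"
    using assms sigma_aut sigma_commute by (subst Aut.commute_int_pow) auto
  also have "\<dots> = (\<sigma> j [^]\<^bsub>Aut\<^esub> n) (a i)"
    using j b assms False by (simp add: alg_Aut_mult a_closed sigma_fixes_a)
  finally have "(\<sigma> \<beta> [^]\<^bsub>Aut\<^esub> m) ((\<sigma> j [^]\<^bsub>Aut\<^esub> n) (a i)) = (\<sigma> j [^]\<^bsub>Aut\<^esub> n) (a i)"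
    using assms j by (intro sigma_pow_fixes) (auto simp: a_closed alg_Aut_closed)
  with assms show ?thesis by blast
qed

lemma sigma_stable_S: "sigma_stable K D r \<sigma> S"
  unfolding sigma_stable_def
proof (intro ballI allI)
  fix \<beta> and m :: int assume \<beta>: "\<beta> \<in> Field r"
  let ?\<tau> = "\<sigma> \<beta> [^]\<^bsub>Aut\<^esub> m"
  have \<tau>: "?\<tau> \<in> carrier Aut" using \<beta> by (rule sigma_pow_closed)
  note hom = alg_Aut_hom[OF \<tau>]
  \<comment> \<open>Minimality of \<open>S\<close> is applied to those of its elements that
    \<open>?\<tau>\<close> keeps in \<open>S\<close>. The generators are among them, since
    \<open>?\<tau>\<close> maps generators to generators.\<close>
  have "submonoid {x \<in> S. ?\<tau> x \<in> S} D"
    by unfold_locales (auto simp: S_carrier S_mult S_one ring_hom_mult[OF hom] ring_hom_one[OF hom])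
  moreover have "(\<sigma> j [^]\<^bsub>Aut\<^esub> n) (a i) \<in> {x \<in> S. ?\<tau> x \<in> S}" if "i \<in> Field r" "j \<in> Field r" for i j and n :: int
    using sigma_pow_generator[OF that \<beta>, of m n] that gwa_mult_set_generators[OF gwa_data_axioms] by auto
  ultimately have "S \<subseteq> {x \<in> S. ?\<tau> x \<in> S}" using gwa_data_axioms by (intro gwa_mult_set_least)
  then show "?\<tau> ` S \<subseteq> S" by blast
qed

text \<open>Stability for the exponents 1 and -1 gives the two inclusions. Equality is the form in
  which \<open>stabilizer_subgroup\<close> can spread it to the generated group.\<close>

lemma sigma_image_S: "\<beta> \<in> Field r \<Longrightarrow> \<sigma> \<beta> ` S = S"
proof
  assume \<beta>: "\<beta> \<in> Field r"
  have st: "(\<sigma> \<beta> [^]\<^bsub>Aut\<^esub> m) ` S \<subseteq> S" for m :: int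
    using sigma_stable_S \<beta> unfolding sigma_stable_def by blast
  show "\<sigma> \<beta> ` S \<subseteq> S" using st[of 1] \<beta> sigma_aut by (simp add: Aut.int_pow_1)
  have "(inv\<^bsub>Aut\<^esub> \<sigma> \<beta>) ` S \<subseteq> S"
    using st[of "- 1"] \<beta> sigma_aut by (simp add: Aut.int_pow_neg Aut.int_pow_1)
  then have "\<sigma> \<beta> ` (inv\<^bsub>Aut\<^esub> \<sigma> \<beta>) ` S \<subseteq> \<sigma> \<beta> ` S" by blast
  moreover have "\<sigma> \<beta> ` (inv\<^bsub>Aut\<^esub> \<sigma> \<beta>) ` S = S"
    using \<beta> sigma_aut by (force simp: image_image alg_Aut_inv S_carrier)
  ultimately show "S \<subseteq> \<sigma> \<beta> ` S" by simp
qed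

section \<open>The homomorphism \<open>\<xi>\<close> and its values on the basis\<close>

abbreviation "\<Sigma> \<equiv> gwa_Sigma K D r \<sigma>"

lemma sigma_subset: "\<sigma> ` Field r \<subseteq> carrier Aut"
  using sigma_aut by blast

lemma xi_hom: "\<xi> \<in> hom G \<Sigma>"
  using surjective_type unfolding gwa_surjective_type_def iso_def by blast

lemma xi_generate: "c \<in> carrier G \<Longrightarrow> \<xi> c \<in> generate Aut (\<sigma> ` Field r)"
  using xi_hom hom_in_carrier by (fastforce simp: gwa_Sigma_def)

lemma xi_closed: "c \<in> carrier G \<Longrightarrow> \<xi> c \<in> carrier Aut"
  using xi_generate Aut.generate_incl[OF sigma_subset] by blast

text \<open>The stabilizer of \<open>S\<close> is a subgroup containing every
  \<open>\<sigma> \<beta>\<close>, hence the whole group generated by them, in which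
  \<open>\<xi> c\<close> lies.\<close>

lemma xi_image_S: "c \<in> carrier G \<Longrightarrow> \<xi> c ` S = S"
proof -
  have "subgroup {\<tau> \<in> carrier Aut. \<tau> ` S = S} Aut"
    by (rule stabilizer_subgroup) (use S_carrier in blast)
  then have "generate Aut (\<sigma> ` Field r) \<subseteq> {\<tau> \<in> carrier Aut. \<tau> ` S = S}"
    by (intro Aut.generate_subgroup_incl) (use sigma_aut sigma_image_S in blast)
  then show "c \<in> carrier G \<Longrightarrow> \<xi> c ` S = S" using xi_generate by blast
qed

lemma xi_mult: "c \<in> carrier G \<Longrightarrow> d \<in> carrier G \<Longrightarrow> \<xi> (c + d) = \<xi> c \<otimes>\<^bsub>Aut\<^esub> \<xi> d"
  using hom_mult[OF xi_hom, of c d] by (simp add: gwa_Sigma_def)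

text \<open>Commutativity is transported along the isomorphism \<open>\<xi>\<close> from the free
  abelian group. It is required to evaluate the finite product in \<open>gwa_xi\<close>, as is done
  for zero and for basis vectors.\<close>

lemma comm_group_Sigma: "comm_group \<Sigma>"
proof -
  have "group \<Sigma>" unfolding gwa_Sigma_def
    by (intro Aut.subgroup_imp_group Aut.generate_is_subgroup sigma_subset)
  then show ?thesis
    using surjective_type unfolding gwa_surjective_type_def
    by (intro comm_group.iso_imp_comm_group[OF abelian_free_Abelian_group])
       (auto simp: is_iso_def group.is_monoid)
qed

lemma xi_zero: "\<xi> 0 = \<one>\<^bsub>Aut\<^esub>"
proof -
  interpret \<Sigma>: comm_group \<Sigma> by (rule comm_group_Sigma)
  show ?thesis by (simp add: gwa_xi_def) (simp add: gwa_Sigma_def)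
qed

lemma xi_frag_of: "\<beta> \<in> Field r \<Longrightarrow> \<xi> (frag_of \<beta>) = \<sigma> \<beta>"
proof -
  interpret \<Sigma>: comm_group \<Sigma> by (rule comm_group_Sigma)
  assume "\<beta> \<in> Field r"
  then have "\<sigma> \<beta> \<in> carrier \<Sigma>" by (auto simp: gwa_Sigma_def intro: generate.incl)
  then show ?thesis by (simp add: gwa_xi_def \<Sigma>.int_pow_1)
qed

lemma xi_minus_frag_of: "\<beta> \<in> Field r \<Longrightarrow> \<xi> (- frag_of \<beta>) = inv\<^bsub>Aut\<^esub> \<sigma> \<beta>"
proof -
  assume \<beta>: "\<beta> \<in> Field r"
  then have c: "frag_of \<beta> \<in> carrier G" "- frag_of \<beta> \<in> carrier G" by simp_all
  have "\<xi> (- frag_of \<beta>) \<otimes>\<^bsub>Aut\<^esub> \<sigma> \<beta> = \<one>\<^bsub>Aut\<^esub>"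
    using xi_mult[OF c(2,1)] \<beta> by (simp add: xi_zero xi_frag_of)
  then show ?thesis using xi_closed[OF c(2)] sigma_aut[OF \<beta>] by (metis Aut.inv_equality)
qed

end

section \<open>Normal forms in a generalized Weyl algebra\<close>

context regular_gwa
begin

lemmas [simp del] = carrier_free_Abelian_group_iff

lemma G_zero: "0 \<in> carrier G"
  by (simp add: carrier_free_Abelian_group_iff)

lemma G_add: "g \<in> carrier G \<Longrightarrow> h \<in> carrier G \<Longrightarrow> g + h \<in> carrier G"
  using keys_add[of g h] by (auto simp: carrier_free_Abelian_group_iff)

lemma G_single: "\<beta> \<in> Field r \<Longrightarrow> Poly_Mapping.single \<beta> k \<in> carrier G"
  by (auto simp: carrier_free_Abelian_group_iff)

lemma xi_inv: "\<beta> \<in> Field r \<Longrightarrow> \<xi> (Poly_Mapping.single \<beta> (- 1)) = inv\<^bsub>Aut\<^esub> \<sigma> \<beta>"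
  using xi_minus_frag_of by (simp add: single_uminus)

section \<open>The skew group ring over the localized base ring\<close>

abbreviation "act \<equiv> \<lambda>c. localization_map D S (\<xi> c)"
abbreviation "B \<equiv> skew_group_ring L G act"

lemma xi_ring_hom: "c \<in> carrier G \<Longrightarrow> \<xi> c \<in> ring_hom D D"
  using xi_closed alg_Aut_hom by blast

lemma xi_elem_closed: "\<lbrakk>c \<in> carrier G; x \<in> carrier D\<rbrakk> \<Longrightarrow> \<xi> c x \<in> carrier D"
  using xi_closed alg_Aut_closed by blast

lemma xi_elem_S: "\<lbrakk>c \<in> carrier G; s \<in> S\<rbrakk> \<Longrightarrow> \<xi> c s \<in> S"
  using xi_image_S by blast

lemma act_fr: "\<lbrakk>c \<in> carrier G; s \<in> S; x \<in> carrier D\<rbrakk> \<Longrightarrow> act c (fr s x) = fr (\<xi> c s) (\<xi> c x)"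
  using xi_image_S by (intro localization_map_fr xi_ring_hom) auto

sublocale twisted: twisted_algebra K L G "smult L" act B
proof (rule twisted_algebra_skew_group_ring)
  show "assoc_algebra K L" by (rule assoc_algebra_L)
  show "group G" by simp
  show "act g \<in> ring_hom L L" if "g \<in> carrier G" for g
    using that by (intro localization_map_hom xi_ring_hom) (simp_all add: xi_image_S)
  show "act (g \<otimes>\<^bsub>G\<^esub> h) x = act g (act h x)" if gh: "g \<in> carrier G" "h \<in> carrier G" and x: "x \<in> carrier L" for g h x
  proof -
    obtain s y where "s \<in> S" "y \<in> carrier D" "x = fr s y" using x by (rule L_cases)
    then show ?thesis using gh act_fr[OF G_add[OF gh], of s y]
      by (simp add: act_fr xi_mult[OF gh] xi_elem_S xi_elem_closed alg_Aut_mult xi_closed S_carrier)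
  qed
  show "act \<one>\<^bsub>G\<^esub> x = x" if x: "x \<in> carrier L" for x
  proof -
    obtain s y where "s \<in> S" "y \<in> carrier D" "x = fr s y" using x by (rule L_cases)
    then show ?thesis using act_fr[OF G_zero, of s y] by (simp add: xi_zero alg_Aut_one S_carrier)
  qed
  show "act g (c \<odot>\<^bsub>L\<^esub> x) = c \<odot>\<^bsub>L\<^esub> act g x" if g: "g \<in> carrier G" and c: "c \<in> carrier K" and x: "x \<in> carrier L" for g c x
  proof -
    obtain s y where "s \<in> S" "y \<in> carrier D" "x = fr s y" using x by (rule L_cases)
    then show ?thesis using g c
      by (simp add: act_fr fr_smult alg_Aut_smult xi_closed xi_elem_S xi_elem_closed)
  qed
qed

sublocale BA: assoc_algebra K B by (rule twisted.assoc_algebra_B)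

text \<open>The element d g^n with \<open>d\<close> in \<open>D\<close>. All generators are sent to
  elements of this shape and products preserve it, so the relations can be checked in
  \<open>D\<close> without true fractions.\<close>

abbreviation "pt n d \<equiv> point_fun L n (fr \<one>\<^bsub>D\<^esub> d)"

lemma pt_closed: "n \<in> carrier G \<Longrightarrow> d \<in> carrier D \<Longrightarrow> pt n d \<in> carrier B"
  by (intro twisted.point_closed fr_closed S_one)

lemma pt_mult:
  assumes "n \<in> carrier G" "k \<in> carrier G" "d \<in> carrier D" "e \<in> carrier D"
  shows "pt n d \<otimes>\<^bsub>B\<^esub> pt k e = pt (n + k) (d \<otimes>\<^bsub>D\<^esub> \<xi> n e)"
  using assms
  by (simp add: twisted.point_B fr_closed S_one act_fr fr_mult xi_elem_closed ring_hom_one[OF xi_ring_hom])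

lemma pt_add:
  assumes "n \<in> carrier G" "d \<in> carrier D" "e \<in> carrier D"
  shows "pt n d \<oplus>\<^bsub>B\<^esub> pt n e = pt n (d \<oplus>\<^bsub>D\<^esub> e)"
proof
  fix h show "(pt n d \<oplus>\<^bsub>B\<^esub> pt n e) h = pt n (d \<oplus>\<^bsub>D\<^esub> e) h"
    using assms by (cases "h = n") (simp_all add: twisted.add_B point_fun_def fr_add S_one)
qed

lemma pt_one: "pt 0 \<one>\<^bsub>D\<^esub> = \<one>\<^bsub>B\<^esub>"
  by (simp add: twisted.one_B L_one)

lemma pt_smult: "\<lbrakk>c \<in> carrier K; d \<in> carrier D\<rbrakk> \<Longrightarrow> c \<odot>\<^bsub>B\<^esub> pt n d = pt n (c \<odot>\<^bsub>D\<^esub> d)"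
  by (simp add: twisted.smult_point fr_smult S_one)

end

text \<open>An interface that hides the quotient of the free algebra: the normal form argument uses
  only the relations and generation by left multiplication. Scalars act through \<open>b\<close>, so
  the span over \<open>D\<close> needs no separate treatment of \<open>K\<close>.\<close>

locale gwa_presented = regular_gwa K D r \<sigma> a + W: ring W
  for K :: "('k, 'm) ring_scheme" and D :: "('k, 'd, 'n) module_scheme"
    and r :: "'i rel" and \<sigma> and a and W :: "('k, 'x, 'y) module_scheme" +
  fixes b :: "'d \<Rightarrow> 'x" and p m :: "'i \<Rightarrow> 'x"
  assumes b_hom: "b \<in> ring_hom D W"
    and p_closed: "\<beta> \<in> Field r \<Longrightarrow> p \<beta> \<in> carrier W"
    and m_closed: "\<beta> \<in> Field r \<Longrightarrow> m \<beta> \<in> carrier W"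
    and p_b: "\<lbrakk>\<beta> \<in> Field r; d \<in> carrier D\<rbrakk> \<Longrightarrow> p \<beta> \<otimes>\<^bsub>W\<^esub> b d = b (\<sigma> \<beta> d) \<otimes>\<^bsub>W\<^esub> p \<beta>"
    and m_b: "\<lbrakk>\<beta> \<in> Field r; d \<in> carrier D\<rbrakk> \<Longrightarrow> m \<beta> \<otimes>\<^bsub>W\<^esub> b d = b ((inv\<^bsub>alg_Aut K D\<^esub> \<sigma> \<beta>) d) \<otimes>\<^bsub>W\<^esub> m \<beta>"
    and p_p: "\<lbrakk>\<beta> \<in> Field r; \<gamma> \<in> Field r; \<beta> \<noteq> \<gamma>\<rbrakk> \<Longrightarrow> p \<beta> \<otimes>\<^bsub>W\<^esub> p \<gamma> = p \<gamma> \<otimes>\<^bsub>W\<^esub> p \<beta>"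
    and m_m: "\<lbrakk>\<beta> \<in> Field r; \<gamma> \<in> Field r; \<beta> \<noteq> \<gamma>\<rbrakk> \<Longrightarrow> m \<beta> \<otimes>\<^bsub>W\<^esub> m \<gamma> = m \<gamma> \<otimes>\<^bsub>W\<^esub> m \<beta>"
    and p_m: "\<lbrakk>\<beta> \<in> Field r; \<gamma> \<in> Field r; \<beta> \<noteq> \<gamma>\<rbrakk> \<Longrightarrow> p \<beta> \<otimes>\<^bsub>W\<^esub> m \<gamma> = m \<gamma> \<otimes>\<^bsub>W\<^esub> p \<beta>"
    and mp: "\<beta> \<in> Field r \<Longrightarrow> m \<beta> \<otimes>\<^bsub>W\<^esub> p \<beta> = b (a \<beta>)"
    and pm: "\<beta> \<in> Field r \<Longrightarrow> p \<beta> \<otimes>\<^bsub>W\<^esub> m \<beta> = b (\<sigma> \<beta> (a \<beta>))"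
    and W_smult: "\<lbrakk>c \<in> carrier K; x \<in> carrier W\<rbrakk> \<Longrightarrow> c \<odot>\<^bsub>W\<^esub> x = b (c \<odot>\<^bsub>D\<^esub> \<one>\<^bsub>D\<^esub>) \<otimes>\<^bsub>W\<^esub> x"
    and generated: "\<And>P x. \<lbrakk>x \<in> carrier W; P \<one>\<^bsub>W\<^esub>;
        \<And>x y. \<lbrakk>x \<in> carrier W; y \<in> carrier W; P x; P y\<rbrakk> \<Longrightarrow> P (x \<oplus>\<^bsub>W\<^esub> y);
        \<And>d x. \<lbrakk>d \<in> carrier D; x \<in> carrier W; P x\<rbrakk> \<Longrightarrow> P (b d \<otimes>\<^bsub>W\<^esub> x);
        \<And>\<beta> x. \<lbrakk>\<beta> \<in> Field r; x \<in> carrier W; P x\<rbrakk> \<Longrightarrow> P (p \<beta> \<otimes>\<^bsub>W\<^esub> x);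
        \<And>\<beta> x. \<lbrakk>\<beta> \<in> Field r; x \<in> carrier W; P x\<rbrakk> \<Longrightarrow> P (m \<beta> \<otimes>\<^bsub>W\<^esub> x)\<rbrakk> \<Longrightarrow> P x"
begin

lemmas [simp del] = pow_nat

lemma b_closed: "d \<in> carrier D \<Longrightarrow> b d \<in> carrier W"
  using b_hom by (rule ring_hom_closed)

lemmas b_mult = ring_hom_mult[OF b_hom]
lemmas b_add = ring_hom_add[OF b_hom]
lemmas b_one = ring_hom_one[OF b_hom]

text \<open>Powers of X+ for positive and of X- for negative exponents. This is not additive in
  \<open>k\<close>: products of factors with opposite signs acquire coefficients from
  \<open>D\<close>.\<close>

definition Xpow :: "'i \<Rightarrow> int \<Rightarrow> 'x" where
  "Xpow \<beta> k = (if 0 \<le> k then p \<beta> [^]\<^bsub>W\<^esub> nat k else m \<beta> [^]\<^bsub>W\<^esub> nat (- k))"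

lemma Xpow_closed: "\<beta> \<in> Field r \<Longrightarrow> Xpow \<beta> k \<in> carrier W"
  by (simp add: Xpow_def p_closed m_closed)

lemma Xpow_0: "Xpow \<beta> 0 = \<one>\<^bsub>W\<^esub>"
  by (simp add: Xpow_def)

lemma commute_pows:
  assumes "x \<in> carrier W" "y \<in> carrier W" "x \<otimes>\<^bsub>W\<^esub> y = y \<otimes>\<^bsub>W\<^esub> x"
  shows "x [^]\<^bsub>W\<^esub> (i::nat) \<otimes>\<^bsub>W\<^esub> y [^]\<^bsub>W\<^esub> (j::nat) = y [^]\<^bsub>W\<^esub> j \<otimes>\<^bsub>W\<^esub> x [^]\<^bsub>W\<^esub> i"
proof -
  have "x [^]\<^bsub>W\<^esub> i \<otimes>\<^bsub>W\<^esub> y = y \<otimes>\<^bsub>W\<^esub> x [^]\<^bsub>W\<^esub> i"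
    using assms W.group_commutes_pow by simp
  then have "y [^]\<^bsub>W\<^esub> j \<otimes>\<^bsub>W\<^esub> x [^]\<^bsub>W\<^esub> i = x [^]\<^bsub>W\<^esub> i \<otimes>\<^bsub>W\<^esub> y [^]\<^bsub>W\<^esub> j"
    using assms W.group_commutes_pow[of y "x [^]\<^bsub>W\<^esub> i" j] by simp
  then show ?thesis by simp
qed

lemma Xpow_commute:
  "\<lbrakk>\<beta> \<in> Field r; \<gamma> \<in> Field r; \<beta> \<noteq> \<gamma>\<rbrakk> \<Longrightarrow> Xpow \<beta> k \<otimes>\<^bsub>W\<^esub> Xpow \<gamma> l = Xpow \<gamma> l \<otimes>\<^bsub>W\<^esub> Xpow \<beta> k"
  using p_p[of \<beta> \<gamma>] m_m[of \<beta> \<gamma>] p_m[of \<beta> \<gamma>] p_m[of \<gamma> \<beta>]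
  by (auto simp: Xpow_def p_closed m_closed intro!: commute_pows)

text \<open>For nonnegative \<open>k\<close> the power just grows, with coefficient one. For
  negative \<open>k\<close> the new factor meets an X- and the pair collapses to
  \<open>\<sigma> \<beta> (a \<beta>)\<close>.\<close>

lemma p_Xpow:
  assumes "\<beta> \<in> Field r"
  shows "\<exists>d\<in>carrier D. p \<beta> \<otimes>\<^bsub>W\<^esub> Xpow \<beta> k = b d \<otimes>\<^bsub>W\<^esub> Xpow \<beta> (k + 1)"
proof (cases "0 \<le> k")
  case True
  then have "nat (k + 1) = Suc (nat k)" by simp
  then have "p \<beta> \<otimes>\<^bsub>W\<^esub> Xpow \<beta> k = b \<one>\<^bsub>D\<^esub> \<otimes>\<^bsub>W\<^esub> Xpow \<beta> (k + 1)"
    using True assms W.nat_pow_Suc2[OF p_closed[OF assms], of "nat k"] by (simp add: Xpow_def b_one p_closed)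
  then show ?thesis by blast
next
  case False
  then have "nat (- k) = Suc (nat (- (k + 1)))" by simp
  then have "Xpow \<beta> k = m \<beta> \<otimes>\<^bsub>W\<^esub> m \<beta> [^]\<^bsub>W\<^esub> nat (- (k + 1))"
    using False assms W.nat_pow_Suc2[OF m_closed[OF assms], of "nat (- (k + 1))"] by (simp add: Xpow_def)
  \<comment> \<open>For \<open>k = -1\<close> the right side falls into the other branch of
    \<open>Xpow\<close>, but both sides are then the unit.\<close>
  moreover have "m \<beta> [^]\<^bsub>W\<^esub> nat (- (k + 1)) = Xpow \<beta> (k + 1)" using False by (auto simp: Xpow_def)
  ultimately have "p \<beta> \<otimes>\<^bsub>W\<^esub> Xpow \<beta> k = b (\<sigma> \<beta> (a \<beta>)) \<otimes>\<^bsub>W\<^esub> Xpow \<beta> (k + 1)"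
    using assms by (simp add: p_closed m_closed Xpow_closed flip: pm W.m_assoc)
  moreover have "\<sigma> \<beta> (a \<beta>) \<in> carrier D" using assms sigma_aut by (simp add: alg_Aut_closed a_closed)
  ultimately show ?thesis by blast
qed

text \<open>The mirror image: a coefficient other than one arises for positive \<open>k\<close>,
  where the collapsing pair gives \<open>a \<beta>\<close>.\<close>

lemma m_Xpow:
  assumes "\<beta> \<in> Field r"
  shows "\<exists>d\<in>carrier D. m \<beta> \<otimes>\<^bsub>W\<^esub> Xpow \<beta> k = b d \<otimes>\<^bsub>W\<^esub> Xpow \<beta> (k - 1)"
proof (cases "0 < k")
  case False
  then have "nat (- (k - 1)) = Suc (nat (- k))" by simp
  moreover have "Xpow \<beta> k = m \<beta> [^]\<^bsub>W\<^esub> nat (- k)" using False by (auto simp: Xpow_def)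
  ultimately have "m \<beta> \<otimes>\<^bsub>W\<^esub> Xpow \<beta> k = b \<one>\<^bsub>D\<^esub> \<otimes>\<^bsub>W\<^esub> Xpow \<beta> (k - 1)"
    using False assms W.nat_pow_Suc2[OF m_closed[OF assms], of "nat (- k)"] by (simp add: Xpow_def b_one m_closed)
  then show ?thesis by blast
next
  case True
  then have "nat k = Suc (nat (k - 1))" by simp
  then have "Xpow \<beta> k = p \<beta> \<otimes>\<^bsub>W\<^esub> Xpow \<beta> (k - 1)"
    using True assms W.nat_pow_Suc2[OF p_closed[OF assms], of "nat (k - 1)"] by (simp add: Xpow_def)
  then have "m \<beta> \<otimes>\<^bsub>W\<^esub> Xpow \<beta> k = b (a \<beta>) \<otimes>\<^bsub>W\<^esub> Xpow \<beta> (k - 1)"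
    using assms by (simp add: p_closed m_closed Xpow_closed flip: mp W.m_assoc)
  then show ?thesis using a_closed[OF assms] by blast
qed

text \<open>Written as a fold because \<open>W\<close> is not commutative. The order of the factors
  is nevertheless immaterial, since powers belonging to distinct indices commute.\<close>

definition Xprod :: "('i \<Rightarrow> int) \<Rightarrow> 'i set \<Rightarrow> 'x" where
  "Xprod k N = foldD (carrier W) (\<lambda>\<beta> x. Xpow \<beta> (k \<beta>) \<otimes>\<^bsub>W\<^esub> x) \<one>\<^bsub>W\<^esub> N"

definition Xmon :: "('i \<Rightarrow>\<^sub>0 int) \<Rightarrow> 'x" where
  "Xmon n = Xprod (Poly_Mapping.lookup n) (Poly_Mapping.keys n)"

lemma LCD_Xpow: "LCD (Field r) (carrier W) (\<lambda>\<beta> x. Xpow \<beta> (k \<beta>) \<otimes>\<^bsub>W\<^esub> x)"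
proof
  fix \<beta> \<gamma> z assume "\<beta> \<in> Field r" "\<gamma> \<in> Field r" "z \<in> carrier W"
  then show "Xpow \<beta> (k \<beta>) \<otimes>\<^bsub>W\<^esub> (Xpow \<gamma> (k \<gamma>) \<otimes>\<^bsub>W\<^esub> z) = Xpow \<gamma> (k \<gamma>) \<otimes>\<^bsub>W\<^esub> (Xpow \<beta> (k \<beta>) \<otimes>\<^bsub>W\<^esub> z)"
    using Xpow_commute[of \<beta> \<gamma> "k \<beta>" "k \<gamma>"] Xpow_closed
    by (cases "\<beta> = \<gamma>") (simp_all flip: W.m_assoc)
qed (simp add: Xpow_closed)

lemma Xprod_empty: "Xprod k {} = \<one>\<^bsub>W\<^esub>"
  by (simp add: Xprod_def)

lemma Xprod_closed: "finite N \<Longrightarrow> N \<subseteq> Field r \<Longrightarrow> Xprod k N \<in> carrier W"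
  unfolding Xprod_def by (intro LCD.foldD_closed[OF LCD_Xpow]) simp_all

lemma Xprod_insert:
  "\<lbrakk>finite N; N \<subseteq> Field r; \<beta> \<in> Field r; \<beta> \<notin> N\<rbrakk>
    \<Longrightarrow> Xprod k (insert \<beta> N) = Xpow \<beta> (k \<beta>) \<otimes>\<^bsub>W\<^esub> Xprod k N"
  unfolding Xprod_def by (subst LCD.foldD_insert[OF LCD_Xpow]) simp_all

lemma Xprod_cong:
  "\<lbrakk>finite N; N \<subseteq> Field r; \<And>\<beta>. \<beta> \<in> N \<Longrightarrow> k \<beta> = l \<beta>\<rbrakk> \<Longrightarrow> Xprod k N = Xprod l N"
  by (induction N rule: finite_induct) (simp_all add: Xprod_empty Xprod_insert)

lemma Xmon_closed: "n \<in> carrier G \<Longrightarrow> Xmon n \<in> carrier W"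
  unfolding Xmon_def by (intro Xprod_closed) (simp_all add: carrier_free_Abelian_group_iff)

lemma Xmon_0: "Xmon 0 = \<one>\<^bsub>W\<^esub>"
  by (simp add: Xmon_def Xprod_empty)

text \<open>Any chosen index can be moved to the front. If it does not occur in \<open>n\<close>,
  its factor has exponent 0 and is the unit.\<close>

lemma Xmon_split:
  assumes "n \<in> carrier G" "\<beta> \<in> Field r"
  shows "Xmon n = Xpow \<beta> (Poly_Mapping.lookup n \<beta>) \<otimes>\<^bsub>W\<^esub> Xprod (Poly_Mapping.lookup n) (Poly_Mapping.keys n - {\<beta>})"
proof -
  have N: "finite (Poly_Mapping.keys n - {\<beta>})" "Poly_Mapping.keys n - {\<beta>} \<subseteq> Field r"
    using assms by (auto simp: carrier_free_Abelian_group_iff)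
  show ?thesis
  proof (cases "\<beta> \<in> Poly_Mapping.keys n")
    case True
    then have "insert \<beta> (Poly_Mapping.keys n - {\<beta>}) = Poly_Mapping.keys n" by blast
    then show ?thesis using Xprod_insert[OF N assms(2), of "Poly_Mapping.lookup n"] by (simp add: Xmon_def)
  next
    case False
    then show ?thesis using N Xprod_closed[OF N]
      by (simp add: Xmon_def in_keys_iff Xpow_0)
  qed
qed

text \<open>Once the factor of index \<open>\<beta>\<close> stands in front, \<open>y\<close> acts
  on that factor alone and the rest is untouched. It is meant for X+ with \<open>j = 1\<close> and
  X- with \<open>j = -1\<close>.\<close>

lemma Xmon_shift:
  assumes n: "n \<in> carrier G" and \<beta>: "\<beta> \<in> Field r" and y: "y \<in> carrier W"
    and ex: "\<And>k. \<exists>d\<in>carrier D. y \<otimes>\<^bsub>W\<^esub> Xpow \<beta> k = b d \<otimes>\<^bsub>W\<^esub> Xpow \<beta> (k + j)"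
  shows "\<exists>d\<in>carrier D. y \<otimes>\<^bsub>W\<^esub> Xmon n = b d \<otimes>\<^bsub>W\<^esub> Xmon (n + Poly_Mapping.single \<beta> j)"
proof -
  let ?n = "n + Poly_Mapping.single \<beta> j"
  let ?N = "Poly_Mapping.keys n - {\<beta>}"
  let ?x = "Xprod (Poly_Mapping.lookup n) ?N"
  have N: "finite ?N" "?N \<subseteq> Field r" using n by (auto simp: carrier_free_Abelian_group_iff)
  have x: "?x \<in> carrier W" using N by (rule Xprod_closed)
  have look: "Poly_Mapping.lookup ?n \<gamma> = Poly_Mapping.lookup n \<gamma> + (if \<gamma> = \<beta> then j else 0)" for \<gamma>
    by (simp add: lookup_add lookup_single when_def)
  \<comment> \<open>The index \<open>\<beta>\<close> is removed on both sides because the shift may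
    create or cancel its exponent.\<close>
  have "Poly_Mapping.keys ?n - {\<beta>} = ?N" by (auto simp: in_keys_iff look)
  moreover have "Xprod (Poly_Mapping.lookup ?n) ?N = ?x" using N by (intro Xprod_cong) (auto simp: look)
  ultimately have X': "Xmon ?n = Xpow \<beta> (Poly_Mapping.lookup n \<beta> + j) \<otimes>\<^bsub>W\<^esub> ?x"
    using Xmon_split[OF G_add[OF n G_single[OF \<beta>]] \<beta>, of j] by (simp add: look)
  obtain d where d: "d \<in> carrier D"
    "y \<otimes>\<^bsub>W\<^esub> Xpow \<beta> (Poly_Mapping.lookup n \<beta>) = b d \<otimes>\<^bsub>W\<^esub> Xpow \<beta> (Poly_Mapping.lookup n \<beta> + j)"
    using ex by blast
  have "y \<otimes>\<^bsub>W\<^esub> Xmon n = y \<otimes>\<^bsub>W\<^esub> Xpow \<beta> (Poly_Mapping.lookup n \<beta>) \<otimes>\<^bsub>W\<^esub> ?x"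
    using y x \<beta> Xmon_split[OF n \<beta>] by (simp add: W.m_assoc Xpow_closed)
  also have "\<dots> = b d \<otimes>\<^bsub>W\<^esub> Xmon ?n"
    using d x \<beta> by (simp add: X' W.m_assoc Xpow_closed b_closed)
  finally show ?thesis using d(1) by blast
qed

abbreviation "term_of \<equiv> \<lambda>n d. b d \<otimes>\<^bsub>W\<^esub> Xmon n"
abbreviation "expand \<equiv> lin_ext D W term_of"
abbreviation "coeffs \<equiv> fin_supp_funs D (carrier G)"

sublocale T: additive_family D W "carrier G" term_of
  by unfold_locales (simp_all add: b_closed Xmon_closed b_add W.l_distr)

text \<open>The image of \<open>expand\<close> is the left \<open>D\<close>-span of the monomials.
  By additivity it is enough to know that \<open>y\<close> maps single terms into this span.\<close>

lemma expand_mult_left: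
  assumes y: "y \<in> carrier W"
    and step: "\<And>n d. \<lbrakk>n \<in> carrier G; d \<in> carrier D\<rbrakk> \<Longrightarrow> y \<otimes>\<^bsub>W\<^esub> term_of n d \<in> expand ` coeffs"
    and f: "f \<in> coeffs"
  shows "y \<otimes>\<^bsub>W\<^esub> expand f \<in> expand ` coeffs"
  using f
proof (induction rule: A.fin_supp_funs_induct)
  case zero
  have "expand (\<lambda>_. \<zero>\<^bsub>D\<^esub>) \<in> expand ` coeffs" using A.fin_supp_funs_zero by (rule imageI)
  then show ?case using y by (simp add: T.lin_ext_zero)
next
  case (add f d n)
  then obtain g where g: "g \<in> coeffs" "y \<otimes>\<^bsub>W\<^esub> expand f = expand g" by blast
  from step add obtain h where h: "h \<in> coeffs" "y \<otimes>\<^bsub>W\<^esub> term_of n d = expand h" by blast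
  have pt: "point_fun D n d \<in> coeffs" using add by (intro A.point_fun_closed)
  have "y \<otimes>\<^bsub>W\<^esub> expand (\<lambda>x. f x \<oplus>\<^bsub>D\<^esub> point_fun D n d x) = expand g \<oplus>\<^bsub>W\<^esub> expand h"
    using add y T.lin_ext_closed[OF add(1)] unfolding g(2)[symmetric] h(2)[symmetric]
    by (simp add: T.lin_ext_add[OF add(1) pt] T.lin_ext_point W.r_distr b_closed Xmon_closed)
  also have "\<dots> = expand (\<lambda>x. g x \<oplus>\<^bsub>D\<^esub> h x)" using g h by (simp add: T.lin_ext_add)
  finally show ?case using A.fin_supp_funs_add[OF g(1) h(1)] by blast
qed

lemma term_in_image: "\<lbrakk>n \<in> carrier G; d \<in> carrier D\<rbrakk> \<Longrightarrow> term_of n d \<in> expand ` coeffs"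
  using T.lin_ext_point[of n d] A.point_fun_closed[of d n "carrier G"] by (metis imageI)

text \<open>The span contains the unit and is closed under addition and under left multiplication by
  each kind of generator, which is all that \<open>generated\<close> requires.\<close>

lemma spanning:
  assumes "x \<in> carrier W" shows "x \<in> expand ` coeffs"
  using assms
proof (rule generated[where P = "\<lambda>x. x \<in> expand ` coeffs"], goal_cases)
  case 1
  then show ?case using term_in_image[OF G_zero, of "\<one>\<^bsub>D\<^esub>"] by (simp add: b_one Xmon_0)
next
  case (2 x y)
  then obtain f g where fg: "f \<in> coeffs" "g \<in> coeffs" and xy: "x = expand f" "y = expand g" by blast
  have "x \<oplus>\<^bsub>W\<^esub> y = expand (\<lambda>n. f n \<oplus>\<^bsub>D\<^esub> g n)" unfolding xy by (rule T.lin_ext_add[OF fg, symmetric])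
  then show ?case using A.fin_supp_funs_add[OF fg] by blast
next
  case (3 d x)
  have "b d \<otimes>\<^bsub>W\<^esub> term_of n e \<in> expand ` coeffs" if "n \<in> carrier G" "e \<in> carrier D" for n e
    using term_in_image[of n "d \<otimes>\<^bsub>D\<^esub> e"] that 3(1)
    by (simp add: b_mult b_closed Xmon_closed W.m_assoc)
  with 3 show ?case using expand_mult_left[OF b_closed[OF 3(1)]] by auto
next
  case (4 \<beta> x)
  \<comment> \<open>The coefficient is first moved to the left of the generator, twisted by
    \<open>\<sigma> \<beta>\<close>; the generator then shifts the monomial.\<close>
  have "p \<beta> \<otimes>\<^bsub>W\<^esub> term_of n e \<in> expand ` coeffs" if n: "n \<in> carrier G" and e: "e \<in> carrier D" for n e
  proof -
    obtain d where d: "d \<in> carrier D" "p \<beta> \<otimes>\<^bsub>W\<^esub> Xmon n = b d \<otimes>\<^bsub>W\<^esub> Xmon (n + Poly_Mapping.single \<beta> 1)"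
      using Xmon_shift[OF n 4(1) p_closed[OF 4(1)] p_Xpow[OF 4(1)]] by blast
    have s: "\<sigma> \<beta> e \<in> carrier D" using 4(1) e sigma_aut by (simp add: alg_Aut_closed)
    have "p \<beta> \<otimes>\<^bsub>W\<^esub> term_of n e = b (\<sigma> \<beta> e) \<otimes>\<^bsub>W\<^esub> (p \<beta> \<otimes>\<^bsub>W\<^esub> Xmon n)"
      using 4(1) n e s by (simp add: p_b p_closed b_closed Xmon_closed flip: W.m_assoc)
    also have "\<dots> = term_of (n + Poly_Mapping.single \<beta> 1) (\<sigma> \<beta> e \<otimes>\<^bsub>D\<^esub> d)"
      using 4(1) n d s by (simp add: b_mult b_closed Xmon_closed G_add G_single W.m_assoc)
    finally show ?thesis using term_in_image[of "n + Poly_Mapping.single \<beta> 1" "\<sigma> \<beta> e \<otimes>\<^bsub>D\<^esub> d"] s d n 4(1)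
      by (simp add: G_add G_single)
  qed
  with 4 show ?case using expand_mult_left[OF p_closed[OF 4(1)]] by auto
next
  case (5 \<beta> x)
  have "m \<beta> \<otimes>\<^bsub>W\<^esub> term_of n e \<in> expand ` coeffs" if n: "n \<in> carrier G" and e: "e \<in> carrier D" for n e
  proof -
    have mX: "\<exists>d\<in>carrier D. m \<beta> \<otimes>\<^bsub>W\<^esub> Xpow \<beta> k = b d \<otimes>\<^bsub>W\<^esub> Xpow \<beta> (k + (- 1))" for k
      using m_Xpow[OF 5(1), of k] by simp
    obtain d where d: "d \<in> carrier D" "m \<beta> \<otimes>\<^bsub>W\<^esub> Xmon n = b d \<otimes>\<^bsub>W\<^esub> Xmon (n + Poly_Mapping.single \<beta> (- 1))"
      using Xmon_shift[OF n 5(1) m_closed[OF 5(1)] mX] by blast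
    let ?e = "(inv\<^bsub>Aut\<^esub> \<sigma> \<beta>) e"
    have s: "?e \<in> carrier D" using alg_Aut_closed[OF Aut.inv_closed[OF sigma_aut[OF 5(1)]] e] .
    have "m \<beta> \<otimes>\<^bsub>W\<^esub> term_of n e = b ?e \<otimes>\<^bsub>W\<^esub> (m \<beta> \<otimes>\<^bsub>W\<^esub> Xmon n)"
      using 5(1) n e s by (simp add: m_b m_closed b_closed Xmon_closed flip: W.m_assoc)
    also have "\<dots> = term_of (n + Poly_Mapping.single \<beta> (- 1)) (?e \<otimes>\<^bsub>D\<^esub> d)"
      using 5(1) n d s by (simp add: b_mult b_closed Xmon_closed G_add G_single W.m_assoc)
    finally show ?thesis using term_in_image[of "n + Poly_Mapping.single \<beta> (- 1)" "?e \<otimes>\<^bsub>D\<^esub> d"] s d n 5(1)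
      by (simp add: G_add G_single)
  qed
  with 5 show ?case using expand_mult_left[OF m_closed[OF 5(1)]] by auto
qed

end

section \<open>The embedding into the skew group ring\<close>

locale gwa_embedding = gwa_presented K D r \<sigma> a W b p m
  for K :: "('k, 'm) ring_scheme" and D :: "('k, 'd, 'n) module_scheme"
    and r :: "'i rel" and \<sigma> and a and W :: "('k, 'x, 'y) module_scheme"
    and b and p and m +
  fixes \<phi>
  assumes phi_hom: "\<phi> \<in> ring_hom W B"
    and phi_b: "d \<in> carrier D \<Longrightarrow> \<phi> (b d) = pt 0 d"
    and phi_p: "\<beta> \<in> Field r \<Longrightarrow> \<phi> (p \<beta>) = pt (Poly_Mapping.single \<beta> 1) \<one>\<^bsub>D\<^esub>"
    and phi_m: "\<beta> \<in> Field r \<Longrightarrow> \<phi> (m \<beta>) = pt (Poly_Mapping.single \<beta> (- 1)) (a \<beta>)"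
begin

lemma act_zero: "x \<in> carrier L \<Longrightarrow> act 0 x = x"
  using twisted.act_one by simp

lemmas phi_mult = ring_hom_mult[OF phi_hom]
lemmas phi_add = ring_hom_add[OF phi_hom]
lemmas phi_one = ring_hom_one[OF phi_hom]
lemmas phi_closed = ring_hom_closed[OF phi_hom]

lemma phi_zero: "\<phi> \<zero>\<^bsub>W\<^esub> = \<zero>\<^bsub>B\<^esub>"
  using phi_hom W.ring_axioms BA.A.ring_axioms by (rule ring_hom_zero)

text \<open>Elements whose image is homogeneous of degree \<open>n\<close> with coefficient in
  \<open>S\<close>. The coefficient is left existential so that the property passes through products
  without tracking its value.\<close>

definition monomial :: "('i \<Rightarrow>\<^sub>0 int) \<Rightarrow> 'x \<Rightarrow> bool" where
  "monomial n x \<longleftrightarrow> n \<in> carrier G \<and> x \<in> carrier W \<and> (\<exists>u\<in>S. \<phi> x = pt n u)"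

lemma monomial_one: "monomial 0 \<one>\<^bsub>W\<^esub>"
  unfolding monomial_def using S_one G_zero by (auto simp: phi_one pt_one[symmetric])

text \<open>The product has coefficient \<open>u\<close> times \<open>\<xi> n v\<close>, which stays
  in \<open>S\<close> because \<open>S\<close> is stable under the action.\<close>

lemma monomial_mult:
  assumes "monomial n x" "monomial k y" shows "monomial (n + k) (x \<otimes>\<^bsub>W\<^esub> y)"
proof -
  from assms obtain u v where c: "n \<in> carrier G" "k \<in> carrier G" "x \<in> carrier W" "y \<in> carrier W" "u \<in> S" "v \<in> S"
    and e: "\<phi> x = pt n u" "\<phi> y = pt k v" unfolding monomial_def by blast
  have "\<phi> (x \<otimes>\<^bsub>W\<^esub> y) = pt (n + k) (u \<otimes>\<^bsub>D\<^esub> \<xi> n v)"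
    using c by (simp add: phi_mult e pt_mult S_carrier)
  moreover have "u \<otimes>\<^bsub>D\<^esub> \<xi> n v \<in> S" using c by (intro S_mult xi_elem_S)
  ultimately show ?thesis using c G_add unfolding monomial_def by blast
qed

lemma monomial_p: "\<beta> \<in> Field r \<Longrightarrow> monomial (Poly_Mapping.single \<beta> 1) (p \<beta>)"
  unfolding monomial_def using phi_p p_closed G_single S_one by blast

lemma monomial_m: "\<beta> \<in> Field r \<Longrightarrow> monomial (Poly_Mapping.single \<beta> (- 1)) (m \<beta>)"
  unfolding monomial_def using phi_m m_closed G_single a_in_S by blast

lemma monomial_p_pow: "\<beta> \<in> Field r \<Longrightarrow> monomial (Poly_Mapping.single \<beta> (int i)) (p \<beta> [^]\<^bsub>W\<^esub> i)"
proof (induction i)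
  case (Suc i)
  show ?case using monomial_mult[OF Suc.IH monomial_p, OF Suc.prems Suc.prems, folded single_add]
    by (simp add: add.commute)
qed (simp add: monomial_one)

lemma monomial_m_pow: "\<beta> \<in> Field r \<Longrightarrow> monomial (Poly_Mapping.single \<beta> (- int i)) (m \<beta> [^]\<^bsub>W\<^esub> i)"
proof (induction i)
  case (Suc i)
  show ?case using monomial_mult[OF Suc.IH monomial_m, OF Suc.prems Suc.prems, folded single_add]
    by (simp add: algebra_simps)
qed (simp add: monomial_one)

lemma monomial_Xpow: "\<beta> \<in> Field r \<Longrightarrow> monomial (Poly_Mapping.single \<beta> k) (Xpow \<beta> k)"
  using monomial_p_pow[of \<beta> "nat k"] monomial_m_pow[of \<beta> "nat (- k)"]
  by (cases "0 \<le> k") (simp_all add: Xpow_def)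

lemma monomial_Xprod:
  "finite N \<Longrightarrow> N \<subseteq> Field r \<Longrightarrow> monomial (\<Sum>\<beta>\<in>N. Poly_Mapping.single \<beta> (k \<beta>)) (Xprod k N)"
proof (induction N rule: finite_induct)
  case (insert \<beta> N)
  then show ?case using monomial_mult[OF monomial_Xpow[of \<beta> "k \<beta>"], of _ "Xprod k N"]
    by (simp add: Xprod_insert)
qed (simp add: Xprod_empty monomial_one)

lemma monomial_Xmon:
  assumes "n \<in> carrier G" shows "monomial n (Xmon n)"
proof -
  have "(\<Sum>\<beta>\<in>Poly_Mapping.keys n. Poly_Mapping.single \<beta> (Poly_Mapping.lookup n \<beta>)) = n"
    by (rule poly_mapping_eqI) (auto simp: lookup_sum lookup_single when_def in_keys_iff)
  then show ?thesis
    using monomial_Xprod[of "Poly_Mapping.keys n" "Poly_Mapping.lookup n"] assms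
    by (simp add: Xmon_def carrier_free_Abelian_group_iff)
qed

text \<open>An explicit formula would be the product, over the indices with negative exponent -k, of
  a \<sigma>^-1(a) ... \<sigma>^-(k-1)(a). A choice suffices, because only membership in
  \<open>S\<close> matters.\<close>

definition unit_of :: "('i \<Rightarrow>\<^sub>0 int) \<Rightarrow> 'd" where
  "unit_of n = (SOME u. u \<in> S \<and> \<phi> (Xmon n) = pt n u)"

lemma unit_of: "n \<in> carrier G \<Longrightarrow> unit_of n \<in> S \<and> \<phi> (Xmon n) = pt n (unit_of n)"
proof -
  assume "n \<in> carrier G"
  then have "\<exists>u. u \<in> S \<and> \<phi> (Xmon n) = pt n u" using monomial_Xmon[of n] unfolding monomial_def by blast
  then show ?thesis unfolding unit_of_def by (rule someI_ex)
qed

lemma phi_term: "n \<in> carrier G \<Longrightarrow> d \<in> carrier D \<Longrightarrow> \<phi> (term_of n d) = pt n (d \<otimes>\<^bsub>D\<^esub> unit_of n)"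
  using unit_of[of n]
  by (simp add: phi_mult b_closed Xmon_closed phi_b pt_mult G_zero S_carrier xi_zero alg_Aut_one)

text \<open>Monomials of different exponents land in different degrees of the skew group ring, so
  the coefficients of an expansion do not mix.\<close>

lemma phi_expand:
  assumes f: "f \<in> coeffs" and n: "n \<in> carrier G"
  shows "\<phi> (expand f) n = fr \<one>\<^bsub>D\<^esub> (f n \<otimes>\<^bsub>D\<^esub> unit_of n)"
  using f
proof (induction rule: A.fin_supp_funs_induct)
  case zero
  show ?case using unit_of[OF n]
    by (simp add: T.lin_ext_zero phi_zero S_carrier fr_zero S_one) (simp add: twisted.zero_B)
next
  case (add f d k)
  have pt: "point_fun D k d \<in> coeffs" using add by (intro A.point_fun_closed)
  have u: "unit_of n \<in> carrier D" using unit_of[OF n] S_carrier by blast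
  have fn: "f n \<in> carrier D" "point_fun D k d n \<in> carrier D"
    using add pt by (simp_all add: A.fin_supp_funs_closed)
  have "\<phi> (expand (\<lambda>x. f x \<oplus>\<^bsub>D\<^esub> point_fun D k d x)) n
      = \<phi> (expand f) n \<oplus>\<^bsub>L\<^esub> pt k (d \<otimes>\<^bsub>D\<^esub> unit_of k) n"
    using add by (simp add: T.lin_ext_add[OF add(1) pt] T.lin_ext_point phi_add T.lin_ext_closed b_closed
        Xmon_closed phi_term) (simp add: twisted.add_B)
  also have "pt k (d \<otimes>\<^bsub>D\<^esub> unit_of k) n = fr \<one>\<^bsub>D\<^esub> (point_fun D k d n \<otimes>\<^bsub>D\<^esub> unit_of n)"
    using u by (auto simp: point_fun_def fr_zero S_one)
  finally show ?case using add u fn by (simp add: fr_add S_one A.l_distr)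
qed

text \<open>Comparing coefficients in degree \<open>n\<close> gives an equation in \<open>D\<close>
  between \<open>f n\<close> and \<open>g n\<close>, each multiplied by \<open>unit_of n\<close>,
  and this factor can be cancelled. Since expansions are all of \<open>W\<close>, the argument also
  shows that the monomials are independent over \<open>D\<close>.\<close>

lemma phi_inj: "inj_on \<phi> (carrier W)"
proof (rule inj_onI)
  fix x y assume xy: "x \<in> carrier W" "y \<in> carrier W" "\<phi> x = \<phi> y"
  obtain f g where fg: "f \<in> coeffs" "g \<in> coeffs" "x = expand f" "y = expand g"
    using spanning[OF xy(1)] spanning[OF xy(2)] by blast
  have "f n = g n" for n
  proof (cases "n \<in> carrier G")
    case True
    have c: "f n \<in> carrier D" "g n \<in> carrier D" using fg by (simp_all add: A.fin_supp_funs_closed)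
    have u: "unit_of n \<in> S" "unit_of n \<in> carrier D" using unit_of[OF True] S_carrier by blast+
    have "f n \<otimes>\<^bsub>D\<^esub> unit_of n = g n \<otimes>\<^bsub>D\<^esub> unit_of n"
      using phi_expand[OF fg(1) True] phi_expand[OF fg(2) True] xy(3) fg(3,4) c u by (simp add: fr_one_eq_iff)
    then show ?thesis by (metis S_cancel[OF u(1) c] S_comm[OF u(1) c(1)] S_comm[OF u(1) c(2)])
  next
    case False
    then have "f n = \<zero>\<^bsub>D\<^esub>" "g n = \<zero>\<^bsub>D\<^esub>" using fg unfolding fin_supp_funs_def by blast+
    then show ?thesis by simp
  qed
  then show "x = y" using fg by (metis ext)
qed

text \<open>Each homogeneous summand has its own denominator. Finitely many of them are multiplied
  together, which is possible because \<open>S\<close> is commutative.\<close>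

lemma phi_fractions:
  assumes "y \<in> carrier B"
  shows "\<exists>s\<in>S. \<exists>x\<in>carrier W. \<phi> (b s) \<otimes>\<^bsub>B\<^esub> y = \<phi> x"
  using assms
proof (induction rule: twisted.B_induct)
  case zero
  show ?case
    using S_one W.zero_closed by (intro bexI[of _ "\<one>\<^bsub>D\<^esub>"] bexI[of _ "\<zero>\<^bsub>W\<^esub>"]) (auto simp: b_one phi_one phi_zero)
next
  case (add y q n)
  obtain s x where s: "s \<in> S" "x \<in> carrier W" "\<phi> (b s) \<otimes>\<^bsub>B\<^esub> y = \<phi> x" using add by blast
  obtain t d where q: "t \<in> S" "d \<in> carrier D" "q = fr t d" using add L_cases by metis
  let ?u = "unit_of n"
  have u: "?u \<in> S" "?u \<in> carrier D" using unit_of[OF \<open>n \<in> carrier G\<close>] S_carrier by blast+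
  \<comment> \<open>The factor \<open>t\<close> clears the denominator of \<open>q\<close>, and
    \<open>unit_of n\<close> supplies the coefficient with which the monomial of exponent
    \<open>n\<close> is mapped.\<close>
  let ?t = "?u \<otimes>\<^bsub>D\<^esub> t" and ?z = "term_of n d"
  have t: "?t \<in> S" "?t \<in> carrier D" using u q S_mult S_carrier by blast+
  have z: "?z \<in> carrier W" using q add by (simp add: b_closed Xmon_closed)
  have "fr \<one>\<^bsub>D\<^esub> ?t \<otimes>\<^bsub>L\<^esub> fr t d = fr (t \<otimes>\<^bsub>D\<^esub> \<one>\<^bsub>D\<^esub>) (t \<otimes>\<^bsub>D\<^esub> (d \<otimes>\<^bsub>D\<^esub> ?u))"
    using q u by (simp add: fr_mult S_one S_mult S_carrier A.m_assoc S_comm[of ?u "t \<otimes>\<^bsub>D\<^esub> d"] flip: A.m_assoc)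
  also have "\<dots> = fr \<one>\<^bsub>D\<^esub> (d \<otimes>\<^bsub>D\<^esub> ?u)" using q u by (intro fr_expand S_one) simp_all
  finally have e: "fr \<one>\<^bsub>D\<^esub> ?t \<otimes>\<^bsub>L\<^esub> fr t d = fr \<one>\<^bsub>D\<^esub> (d \<otimes>\<^bsub>D\<^esub> ?u)" .
  have tz: "\<phi> (b ?t) \<otimes>\<^bsub>B\<^esub> point_fun L n q = \<phi> ?z"
    using q add t e by (simp add: phi_b phi_term twisted.point_B G_zero fr_closed S_one act_zero)
  have cl: "\<phi> (b s) \<in> carrier B" "\<phi> (b ?t) \<in> carrier B" "point_fun L n q \<in> carrier B"
    using s t add by (simp_all add: phi_closed b_closed S_carrier twisted.point_closed)
  \<comment> \<open>Commutation lets the product of the two denominators clear the old part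
    \<open>y\<close> as well as the new summand.\<close>
  have comm: "\<phi> (b s) \<otimes>\<^bsub>B\<^esub> \<phi> (b ?t) = \<phi> (b ?t) \<otimes>\<^bsub>B\<^esub> \<phi> (b s)"
    using s t S_comm[of s ?t] by (simp add: b_closed S_carrier flip: phi_mult b_mult)
  have st: "\<phi> (b (s \<otimes>\<^bsub>D\<^esub> ?t)) = \<phi> (b s) \<otimes>\<^bsub>B\<^esub> \<phi> (b ?t)"
    using s t by (simp add: b_mult phi_mult b_closed S_carrier)
  have "\<phi> (b (s \<otimes>\<^bsub>D\<^esub> ?t)) \<otimes>\<^bsub>B\<^esub> (y \<oplus>\<^bsub>B\<^esub> point_fun L n q)
      = \<phi> (b s) \<otimes>\<^bsub>B\<^esub> \<phi> (b ?t) \<otimes>\<^bsub>B\<^esub> y \<oplus>\<^bsub>B\<^esub> \<phi> (b s) \<otimes>\<^bsub>B\<^esub> \<phi> (b ?t) \<otimes>\<^bsub>B\<^esub> point_fun L n q"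
    unfolding st using cl add by (intro BA.A.r_distr) simp_all
  also have "\<dots> = \<phi> (b ?t) \<otimes>\<^bsub>B\<^esub> (\<phi> (b s) \<otimes>\<^bsub>B\<^esub> y) \<oplus>\<^bsub>B\<^esub> \<phi> (b s) \<otimes>\<^bsub>B\<^esub> (\<phi> (b ?t) \<otimes>\<^bsub>B\<^esub> point_fun L n q)"
    using cl add comm by (simp add: BA.A.m_assoc[symmetric])
  also have "\<dots> = \<phi> (b ?t) \<otimes>\<^bsub>B\<^esub> \<phi> x \<oplus>\<^bsub>B\<^esub> \<phi> (b s) \<otimes>\<^bsub>B\<^esub> \<phi> ?z"
    by (simp only: s(3) tz)
  also have "\<dots> = \<phi> (b ?t \<otimes>\<^bsub>W\<^esub> x \<oplus>\<^bsub>W\<^esub> b s \<otimes>\<^bsub>W\<^esub> ?z)"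
    using s t z by (simp add: phi_add phi_mult b_closed S_carrier)
  finally show ?case
    using s t z S_mult[OF s(1) t(1)] by (meson W.a_closed W.m_closed b_closed S_carrier)
qed

lemma phi_units: "s \<in> S \<Longrightarrow> \<phi> (b s) \<in> Units B"
proof -
  assume s: "s \<in> S"
  \<comment> \<open>The inverse of \<open>s\<close>, placed in degree 0, where the action is
    trivial.\<close>
  let ?i = "point_fun L 0 (fr s \<one>\<^bsub>D\<^esub>)"
  have "\<phi> (b s) \<otimes>\<^bsub>B\<^esub> ?i = \<one>\<^bsub>B\<^esub>" "?i \<otimes>\<^bsub>B\<^esub> \<phi> (b s) = \<one>\<^bsub>B\<^esub>"
    using s by (simp_all add: phi_b S_carrier twisted.point_B G_zero fr_closed S_one act_zero
        fr_mult fr_one twisted.one_B)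
  moreover have "?i \<in> carrier B" "\<phi> (b s) \<in> carrier B"
    using s by (simp_all add: twisted.point_closed G_zero fr_closed phi_closed b_closed S_carrier)
  ultimately show ?thesis unfolding Units_def by blast
qed

sublocale loc: localizing_hom K W B \<phi> "b ` S"
proof (intro localizing_hom.intro localizing_hom_axioms.intro)
  show "ring W" by (rule W.ring_axioms)
  show "assoc_algebra K B" by (rule BA.assoc_algebra_axioms)
  show "\<phi> \<in> ring_hom W B" by (rule phi_hom)
  show "inj_on \<phi> (carrier W)" by (rule phi_inj)
  show "submonoid (b ` S) W"
  proof
    show "b ` S \<subseteq> carrier W" using b_closed S_carrier by blast
    show "\<one>\<^bsub>W\<^esub> \<in> b ` S" using b_one S_one by (metis imageI)
    fix x y assume "x \<in> b ` S" "y \<in> b ` S"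
    then obtain s t where "s \<in> S" "t \<in> S" "x = b s" "y = b t" by blast
    then have "x \<otimes>\<^bsub>W\<^esub> y = b (s \<otimes>\<^bsub>D\<^esub> t)" "s \<otimes>\<^bsub>D\<^esub> t \<in> S" by (simp_all add: b_mult S_carrier S_mult)
    then show "x \<otimes>\<^bsub>W\<^esub> y \<in> b ` S" by blast
  qed
  show "\<phi> x \<in> Units B" if "x \<in> b ` S" for x using that phi_units by blast
  show "\<exists>s\<in>b ` S. \<exists>x\<in>carrier W. \<phi> s \<otimes>\<^bsub>B\<^esub> y = \<phi> x" if "y \<in> carrier B" for y
    using phi_fractions[OF that] by blast
  fix c x assume cx: "c \<in> carrier K" "x \<in> carrier W"
  then show "c \<odot>\<^bsub>W\<^esub> x \<in> carrier W" by (simp add: W_smult b_closed)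
  have "\<phi> (c \<odot>\<^bsub>W\<^esub> x) = (c \<odot>\<^bsub>B\<^esub> \<one>\<^bsub>B\<^esub>) \<otimes>\<^bsub>B\<^esub> \<phi> x"
    using cx by (simp add: W_smult phi_mult b_closed phi_b pt_smult[symmetric] pt_one)
  also have "\<dots> = c \<odot>\<^bsub>B\<^esub> \<phi> x" using cx by (simp add: BA.smult_mult_left phi_closed)
  finally show "\<phi> (c \<odot>\<^bsub>W\<^esub> x) = c \<odot>\<^bsub>B\<^esub> \<phi> x" .
qed

end

section \<open>The presentation by generators and relations\<close>

context regular_gwa
begin

abbreviation "gens \<equiv> gwa_gens D r"
abbreviation "F \<equiv> free_algebra K gens"
abbreviation "I \<equiv> gwa_ideal K D r \<sigma> a"
abbreviation "W \<equiv> gwa K D r \<sigma> a"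
abbreviation "v \<equiv> free_var K"

sublocale free: twisted_algebra K K "word_monoid gens" "(\<otimes>\<^bsub>K\<^esub>)" "\<lambda>_ x. x" F
  by (rule twisted_algebra_free_algebra) (rule K.field_axioms)

sublocale FA: assoc_algebra K F by (rule free.assoc_algebra_B)

lemma gens_iff:
  "Base d \<in> gens \<longleftrightarrow> d \<in> carrier D" "X_plus \<beta> \<in> gens \<longleftrightarrow> \<beta> \<in> Field r" "X_minus \<beta> \<in> gens \<longleftrightarrow> \<beta> \<in> Field r"
  by (auto simp: gwa_gens_def)

lemma var_closed: "y \<in> gens \<Longrightarrow> v y \<in> carrier F"
  unfolding free_var_point by (rule free.point_closed) (simp_all add: word_monoid_def)

lemma sigma_closed: "\<beta> \<in> Field r \<Longrightarrow> d \<in> carrier D \<Longrightarrow> \<sigma> \<beta> d \<in> carrier D"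
  using sigma_aut alg_Aut_closed by blast

lemma sigma_inv_closed: "\<beta> \<in> Field r \<Longrightarrow> d \<in> carrier D \<Longrightarrow> (inv\<^bsub>Aut\<^esub> \<sigma> \<beta>) d \<in> carrier D"
  using alg_Aut_closed[OF Aut.inv_closed[OF sigma_aut]] .

lemma sigma_inv_fixes_a:
  assumes "\<beta> \<in> Field r" "\<gamma> \<in> Field r" "\<gamma> \<noteq> \<beta>" shows "(inv\<^bsub>Aut\<^esub> \<sigma> \<beta>) (a \<gamma>) = a \<gamma>"
  using alg_Aut_inv(1)[OF sigma_aut[OF assms(1)] a_closed[OF assms(2)]] sigma_fixes_a[OF assms] by simp

lemma relations_subset: "gwa_relations K D r \<sigma> a \<subseteq> carrier F"
  unfolding gwa_relations_def Let_def
  by (intro Un_least subsetI; elim CollectE exE conjE singletonE; hypsubst)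
     (intro free.B.minus_closed free.B.a_closed FA.A.m_closed FA.A.one_closed FA.smult_closed var_closed;
      simp add: gens_iff a_closed sigma_closed sigma_inv_closed)+

lemma ideal_I: "ideal I F"
  unfolding gwa_ideal_def using relations_subset by (rule FA.A.genideal_ideal)

sublocale I: ideal I F by (rule ideal_I)

definition proj :: "(('d, 'i) gwa_gen list \<Rightarrow> 'k) \<Rightarrow> (('d, 'i) gwa_gen list \<Rightarrow> 'k) set" where
  "proj f = I +>\<^bsub>F\<^esub> f"

text \<open>The ring operations of \<open>W\<close> are those of the quotient ring, but the record
  also carries scalars, so facts about the quotient are transferred field by field.\<close>

lemma W_simps:
  "carrier W = carrier (F Quot I)" "monoid.mult W = monoid.mult (F Quot I)" "add W = add (F Quot I)"
  "\<one>\<^bsub>W\<^esub> = \<one>\<^bsub>F Quot I\<^esub>" "\<zero>\<^bsub>W\<^esub> = \<zero>\<^bsub>F Quot I\<^esub>"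
  "smult W = (\<lambda>c C. \<Union>x\<in>C. I +>\<^bsub>F\<^esub> (c \<odot>\<^bsub>F\<^esub> x))"
  by (simp_all add: gwa_def quot_algebra_def ring.defs)

lemma ring_W: "ring W"
proof -
  interpret Q: ring "F Quot I" by (rule I.quotient_is_ring)
  show ?thesis
  proof (rule ringI)
    show "abelian_group W"
    proof (rule abelian_groupI)
      show "\<exists>y\<in>carrier W. y \<oplus>\<^bsub>W\<^esub> x = \<zero>\<^bsub>W\<^esub>" if "x \<in> carrier W" for x
        using that Q.l_neg[of x] Q.a_inv_closed[of x] unfolding W_simps by blast
    qed (simp_all add: W_simps Q.a_ac)
    show "monoid W" by (rule monoidI) (simp_all add: W_simps Q.m_assoc)
  qed (simp_all add: W_simps Q.l_distr Q.r_distr)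
qed

lemma proj_hom: "proj \<in> ring_hom F W"
  using I.rcos_ring_hom unfolding ring_hom_def W_simps proj_def by simp

lemma proj_surj: "x \<in> carrier W \<Longrightarrow> \<exists>f\<in>carrier F. x = proj f"
  unfolding W_simps proj_def FactRing_def A_RCOSETS_def' by auto

lemma proj_zero: "i \<in> I \<Longrightarrow> proj i = \<zero>\<^bsub>W\<^esub>"
  using I.a_rcos_const[of i] by (simp add: proj_def W_simps FactRing_def)

lemma mem_proj: "f \<in> proj g \<longleftrightarrow> (\<exists>i\<in>I. f = i \<oplus>\<^bsub>F\<^esub> g)"
  unfolding proj_def a_r_coset_def' by auto

sublocale W: ring W by (rule ring_W)

lemmas proj_closed = ring_hom_closed[OF proj_hom]
lemmas proj_mult = ring_hom_mult[OF proj_hom]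
lemmas proj_add = ring_hom_add[OF proj_hom]
lemmas proj_one = ring_hom_one[OF proj_hom]

text \<open>An ideal absorbs scalars because scaling by \<open>c\<close> is multiplication by
  \<open>c\<close> times the unit. Hence all representatives in the union give the same
  coset.\<close>

lemma proj_smult:
  assumes "c \<in> carrier K" "f \<in> carrier F" shows "c \<odot>\<^bsub>W\<^esub> proj f = proj (c \<odot>\<^bsub>F\<^esub> f)"
proof -
  have "I +>\<^bsub>F\<^esub> (c \<odot>\<^bsub>F\<^esub> g) = proj (c \<odot>\<^bsub>F\<^esub> f)" if g: "g \<in> proj f" for g
  proof -
    obtain i where i: "i \<in> I" "i \<in> carrier F" "g = i \<oplus>\<^bsub>F\<^esub> f" using g I.Icarr unfolding mem_proj by blast
    have "c \<odot>\<^bsub>F\<^esub> i = (c \<odot>\<^bsub>F\<^esub> \<one>\<^bsub>F\<^esub>) \<otimes>\<^bsub>F\<^esub> i" using assms i by (simp add: FA.smult_mult_left)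
    then have "c \<odot>\<^bsub>F\<^esub> i \<in> I" using I.I_l_closed[OF i(1), of "c \<odot>\<^bsub>F\<^esub> \<one>\<^bsub>F\<^esub>"] assms by simp
    then show ?thesis
      using assms i proj_zero[of "c \<odot>\<^bsub>F\<^esub> i"]
      by (simp add: FA.smult_r_distr proj_add proj_closed flip: proj_def)
  qed
  moreover have "f \<in> proj f"
    unfolding mem_proj using I.zero_closed assms by (intro bexI[of _ "\<zero>\<^bsub>F\<^esub>"]) simp_all
  ultimately show ?thesis unfolding W_simps by blast
qed

text \<open>Relations are stored as differences; this turns each of them into an equation in the
  quotient.\<close>

lemma proj_relation:
  assumes "x \<ominus>\<^bsub>F\<^esub> y \<in> gwa_relations K D r \<sigma> a" "x \<in> carrier F" "y \<in> carrier F"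
  shows "proj x = proj y"
proof -
  have "x \<ominus>\<^bsub>F\<^esub> y \<in> I" using assms(1) FA.A.genideal_self[OF relations_subset] unfolding gwa_ideal_def by blast
  moreover have "x = (x \<ominus>\<^bsub>F\<^esub> y) \<oplus>\<^bsub>F\<^esub> y" using assms by (simp add: free.B.minus_eq free.B.a_assoc free.B.l_neg)
  ultimately have "proj x = \<zero>\<^bsub>W\<^esub> \<oplus>\<^bsub>W\<^esub> proj y"
    using assms by (metis proj_zero proj_add free.B.minus_closed)
  then show ?thesis using assms by (simp add: proj_closed)
qed

abbreviation "gb \<equiv> gwa_base K D r \<sigma> a"

lemma gb_proj: "gb d = proj (v (Base d))"
  by (simp add: gwa_base_def proj_def)

lemma relation_intros:
  "\<lbrakk>d \<in> carrier D; e \<in> carrier D\<rbrakk> \<Longrightarrow> v (Base (d \<oplus>\<^bsub>D\<^esub> e)) \<ominus>\<^bsub>F\<^esub> (v (Base d) \<oplus>\<^bsub>F\<^esub> v (Base e)) \<in> gwa_relations K D r \<sigma> a"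
  "\<lbrakk>d \<in> carrier D; e \<in> carrier D\<rbrakk> \<Longrightarrow> v (Base (d \<otimes>\<^bsub>D\<^esub> e)) \<ominus>\<^bsub>F\<^esub> (v (Base d) \<otimes>\<^bsub>F\<^esub> v (Base e)) \<in> gwa_relations K D r \<sigma> a"
  "\<lbrakk>c \<in> carrier K; d \<in> carrier D\<rbrakk> \<Longrightarrow> v (Base (c \<odot>\<^bsub>D\<^esub> d)) \<ominus>\<^bsub>F\<^esub> (c \<odot>\<^bsub>F\<^esub> v (Base d)) \<in> gwa_relations K D r \<sigma> a"
  "v (Base \<one>\<^bsub>D\<^esub>) \<ominus>\<^bsub>F\<^esub> \<one>\<^bsub>F\<^esub> \<in> gwa_relations K D r \<sigma> a"
  "\<lbrakk>\<beta> \<in> Field r; d \<in> carrier D\<rbrakk> \<Longrightarrow> v (X_plus \<beta>) \<otimes>\<^bsub>F\<^esub> v (Base d) \<ominus>\<^bsub>F\<^esub> v (Base (\<sigma> \<beta> d)) \<otimes>\<^bsub>F\<^esub> v (X_plus \<beta>) \<in> gwa_relations K D r \<sigma> a"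
  "\<lbrakk>\<beta> \<in> Field r; d \<in> carrier D\<rbrakk> \<Longrightarrow> v (X_minus \<beta>) \<otimes>\<^bsub>F\<^esub> v (Base d) \<ominus>\<^bsub>F\<^esub> v (Base ((inv\<^bsub>Aut\<^esub> \<sigma> \<beta>) d)) \<otimes>\<^bsub>F\<^esub> v (X_minus \<beta>) \<in> gwa_relations K D r \<sigma> a"
  "\<lbrakk>\<beta> \<in> Field r; \<gamma> \<in> Field r; \<beta> \<noteq> \<gamma>\<rbrakk> \<Longrightarrow> v (X_plus \<beta>) \<otimes>\<^bsub>F\<^esub> v (X_plus \<gamma>) \<ominus>\<^bsub>F\<^esub> v (X_plus \<gamma>) \<otimes>\<^bsub>F\<^esub> v (X_plus \<beta>) \<in> gwa_relations K D r \<sigma> a"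
  "\<lbrakk>\<beta> \<in> Field r; \<gamma> \<in> Field r; \<beta> \<noteq> \<gamma>\<rbrakk> \<Longrightarrow> v (X_minus \<beta>) \<otimes>\<^bsub>F\<^esub> v (X_minus \<gamma>) \<ominus>\<^bsub>F\<^esub> v (X_minus \<gamma>) \<otimes>\<^bsub>F\<^esub> v (X_minus \<beta>) \<in> gwa_relations K D r \<sigma> a"
  "\<lbrakk>\<beta> \<in> Field r; \<gamma> \<in> Field r; \<beta> \<noteq> \<gamma>\<rbrakk> \<Longrightarrow> v (X_plus \<beta>) \<otimes>\<^bsub>F\<^esub> v (X_minus \<gamma>) \<ominus>\<^bsub>F\<^esub> v (X_minus \<gamma>) \<otimes>\<^bsub>F\<^esub> v (X_plus \<beta>) \<in> gwa_relations K D r \<sigma> a"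
  "\<beta> \<in> Field r \<Longrightarrow> v (X_minus \<beta>) \<otimes>\<^bsub>F\<^esub> v (X_plus \<beta>) \<ominus>\<^bsub>F\<^esub> v (Base (a \<beta>)) \<in> gwa_relations K D r \<sigma> a"
  "\<beta> \<in> Field r \<Longrightarrow> v (X_plus \<beta>) \<otimes>\<^bsub>F\<^esub> v (X_minus \<beta>) \<ominus>\<^bsub>F\<^esub> v (Base (\<sigma> \<beta> (a \<beta>))) \<in> gwa_relations K D r \<sigma> a"
  unfolding gwa_relations_def Let_def by blast+

text \<open>The scalars of the free algebra and those of \<open>D\<close> are identified in the
  quotient by the relations for the unit and for scalar multiples.\<close>

lemma gb_smult_one:
  assumes "c \<in> carrier K" shows "proj (c \<odot>\<^bsub>F\<^esub> \<one>\<^bsub>F\<^esub>) = gb (c \<odot>\<^bsub>D\<^esub> \<one>\<^bsub>D\<^esub>)"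
proof -
  have "proj (v (Base \<one>\<^bsub>D\<^esub>)) = proj \<one>\<^bsub>F\<^esub>"
    by (rule proj_relation[OF relation_intros(4)]) (simp_all add: var_closed gens_iff)
  then have "proj (c \<odot>\<^bsub>F\<^esub> \<one>\<^bsub>F\<^esub>) = proj (c \<odot>\<^bsub>F\<^esub> v (Base \<one>\<^bsub>D\<^esub>))"
    using assms by (simp add: var_closed gens_iff flip: proj_smult)
  also have "\<dots> = proj (v (Base (c \<odot>\<^bsub>D\<^esub> \<one>\<^bsub>D\<^esub>)))"
    by (rule proj_relation[OF relation_intros(3), symmetric]) (use assms in \<open>simp_all add: var_closed gens_iff\<close>)
  finally show ?thesis by (simp add: gb_proj)
qed

sublocale presented: gwa_presented K D r \<sigma> a W gb "\<lambda>\<beta>. proj (v (X_plus \<beta>))" "\<lambda>\<beta>. proj (v (X_minus \<beta>))"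
proof (intro gwa_presented.intro gwa_presented_axioms.intro)
  note [simp] = var_closed gens_iff a_closed sigma_closed sigma_inv_closed
  show "regular_gwa K D r \<sigma> a" by (rule regular_gwa_axioms)
  show "ring W" by (rule ring_W)
  show "gb \<in> ring_hom D W"
  proof (rule ring_hom_memI)
    show "gb \<one>\<^bsub>D\<^esub> = \<one>\<^bsub>W\<^esub>" unfolding gb_proj proj_one[symmetric]
      by (rule proj_relation[OF relation_intros(4)]) simp_all
    fix d e assume d: "d \<in> carrier D" and e: "e \<in> carrier D"
    show "gb (d \<otimes>\<^bsub>D\<^esub> e) = gb d \<otimes>\<^bsub>W\<^esub> gb e"
      using proj_relation[OF relation_intros(2)[OF d e]] d e by (simp add: gb_proj proj_mult)
    show "gb (d \<oplus>\<^bsub>D\<^esub> e) = gb d \<oplus>\<^bsub>W\<^esub> gb e"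
      using proj_relation[OF relation_intros(1)[OF d e]] d e by (simp add: gb_proj proj_add)
  qed (simp add: gb_proj proj_closed)
  fix \<beta> assume \<beta>: "\<beta> \<in> Field r"
  show "proj (v (X_plus \<beta>)) \<in> carrier W" "proj (v (X_minus \<beta>)) \<in> carrier W"
    using \<beta> by (simp_all add: proj_closed)
  show "proj (v (X_minus \<beta>)) \<otimes>\<^bsub>W\<^esub> proj (v (X_plus \<beta>)) = gb (a \<beta>)"
    using proj_relation[OF relation_intros(10)[OF \<beta>]] \<beta> by (simp add: gb_proj proj_mult)
  show "proj (v (X_plus \<beta>)) \<otimes>\<^bsub>W\<^esub> proj (v (X_minus \<beta>)) = gb (\<sigma> \<beta> (a \<beta>))"
    using proj_relation[OF relation_intros(11)[OF \<beta>]] \<beta> by (simp add: gb_proj proj_mult)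
  show "proj (v (X_plus \<beta>)) \<otimes>\<^bsub>W\<^esub> gb d = gb (\<sigma> \<beta> d) \<otimes>\<^bsub>W\<^esub> proj (v (X_plus \<beta>))" if d: "d \<in> carrier D" for d
    using proj_relation[OF relation_intros(5)[OF \<beta> d]] \<beta> d by (simp add: gb_proj proj_mult)
  show "proj (v (X_minus \<beta>)) \<otimes>\<^bsub>W\<^esub> gb d = gb ((inv\<^bsub>Aut\<^esub> \<sigma> \<beta>) d) \<otimes>\<^bsub>W\<^esub> proj (v (X_minus \<beta>))" if d: "d \<in> carrier D" for d
    using proj_relation[OF relation_intros(6)[OF \<beta> d]] \<beta> d by (simp add: gb_proj proj_mult)
  fix \<gamma> assume \<gamma>: "\<gamma> \<in> Field r" "\<beta> \<noteq> \<gamma>"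
  show "proj (v (X_plus \<beta>)) \<otimes>\<^bsub>W\<^esub> proj (v (X_plus \<gamma>)) = proj (v (X_plus \<gamma>)) \<otimes>\<^bsub>W\<^esub> proj (v (X_plus \<beta>))"
    using proj_relation[OF relation_intros(7)[OF \<beta> \<gamma>]] \<beta> \<gamma> by (simp add: proj_mult)
  show "proj (v (X_minus \<beta>)) \<otimes>\<^bsub>W\<^esub> proj (v (X_minus \<gamma>)) = proj (v (X_minus \<gamma>)) \<otimes>\<^bsub>W\<^esub> proj (v (X_minus \<beta>))"
    using proj_relation[OF relation_intros(8)[OF \<beta> \<gamma>]] \<beta> \<gamma> by (simp add: proj_mult)
  show "proj (v (X_plus \<beta>)) \<otimes>\<^bsub>W\<^esub> proj (v (X_minus \<gamma>)) = proj (v (X_minus \<gamma>)) \<otimes>\<^bsub>W\<^esub> proj (v (X_plus \<beta>))"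
    using proj_relation[OF relation_intros(9)[OF \<beta> \<gamma>]] \<beta> \<gamma> by (simp add: proj_mult)
next
  fix c x assume c: "c \<in> carrier K" and "x \<in> carrier W"
  then obtain f where f: "f \<in> carrier F" "x = proj f" using proj_surj by blast
  have "c \<odot>\<^bsub>W\<^esub> x = proj ((c \<odot>\<^bsub>F\<^esub> \<one>\<^bsub>F\<^esub>) \<otimes>\<^bsub>F\<^esub> f)"
    using c f by (simp add: proj_smult FA.smult_mult_left)
  also have "\<dots> = gb (c \<odot>\<^bsub>D\<^esub> \<one>\<^bsub>D\<^esub>) \<otimes>\<^bsub>W\<^esub> x"
    using c f by (simp add: proj_mult gb_smult_one)
  finally show "c \<odot>\<^bsub>W\<^esub> x = gb (c \<odot>\<^bsub>D\<^esub> \<one>\<^bsub>D\<^esub>) \<otimes>\<^bsub>W\<^esub> x" .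
next
  fix P x
  assume x: "x \<in> carrier W" and one: "P \<one>\<^bsub>W\<^esub>"
    and add: "\<And>x y. \<lbrakk>x \<in> carrier W; y \<in> carrier W; P x; P y\<rbrakk> \<Longrightarrow> P (x \<oplus>\<^bsub>W\<^esub> y)"
    and base: "\<And>d x. \<lbrakk>d \<in> carrier D; x \<in> carrier W; P x\<rbrakk> \<Longrightarrow> P (gb d \<otimes>\<^bsub>W\<^esub> x)"
    and plus: "\<And>\<beta> x. \<lbrakk>\<beta> \<in> Field r; x \<in> carrier W; P x\<rbrakk> \<Longrightarrow> P (proj (v (X_plus \<beta>)) \<otimes>\<^bsub>W\<^esub> x)"
    and minus: "\<And>\<beta> x. \<lbrakk>\<beta> \<in> Field r; x \<in> carrier W; P x\<rbrakk> \<Longrightarrow> P (proj (v (X_minus \<beta>)) \<otimes>\<^bsub>W\<^esub> x)"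
  have pclosed: "point_fun K w c \<in> carrier F" if "w \<in> lists gens" "c \<in> carrier K" for w c
    using that by (intro free.point_closed) (simp_all add: word_monoid_def)
  \<comment> \<open>A word is peeled from the left, matching generation by left multiplication. The
    empty word with coefficient \<open>c\<close> is the base element \<open>c\<close> times the unit
    of \<open>D\<close>.\<close>
  have word: "P (proj (point_fun K w c))" if "w \<in> lists gens" and c: "c \<in> carrier K" for w c
    using that(1)
  proof (induction w)
    case Nil
    have "point_fun K [] c = c \<odot>\<^bsub>F\<^esub> \<one>\<^bsub>F\<^esub>"
      using free.smult_point[OF c, of "[]" "\<one>\<^bsub>K\<^esub>"] c by (simp add: free.one_B word_monoid_def)
    then have "proj (point_fun K [] c) = gb (c \<odot>\<^bsub>D\<^esub> \<one>\<^bsub>D\<^esub>) \<otimes>\<^bsub>W\<^esub> \<one>\<^bsub>W\<^esub>"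
      using c gb_smult_one by (simp add: gb_proj proj_closed var_closed gens_iff)
    then show ?case using base[OF _ W.one_closed one, of "c \<odot>\<^bsub>D\<^esub> \<one>\<^bsub>D\<^esub>"] c by simp
  next
    case (Cons y w)
    have "v y \<otimes>\<^bsub>F\<^esub> point_fun K w c = point_fun K (y # w) c"
      using free.point_B[of "[y]" w "\<one>\<^bsub>K\<^esub>" c] Cons c by (simp add: free_var_point word_monoid_def)
    then have "proj (point_fun K (y # w) c) = proj (v y) \<otimes>\<^bsub>W\<^esub> proj (point_fun K w c)"
      using proj_mult[OF var_closed pclosed, of y w c] Cons c by simp
    moreover have "proj (point_fun K w c) \<in> carrier W" "P (proj (point_fun K w c))"
      using Cons c by (simp_all add: proj_closed pclosed)
    moreover have "y \<in> gens" using Cons by simp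
    ultimately show ?case
      using base plus minus by (cases y) (simp_all add: gb_proj gens_iff)
  qed
  obtain f where f: "f \<in> carrier F" "x = proj f" using x proj_surj by blast
  have "P (proj f)" using f(1)
  proof (induction rule: free.B_induct)
    case zero
    have "\<zero>\<^bsub>F\<^esub> = point_fun K [] \<zero>\<^bsub>K\<^esub>" using free.zero_point[of "[]"] by (simp add: word_monoid_def)
    then show ?case using word[of "[]" "\<zero>\<^bsub>K\<^esub>"] by simp
  next
    case (add f c w)
    then have "w \<in> lists gens" by (simp add: word_monoid_def)
    with add show ?case
      using word[of w c] \<open>\<And>x y. \<lbrakk>x \<in> carrier W; y \<in> carrier W; P x; P y\<rbrakk> \<Longrightarrow> P (x \<oplus>\<^bsub>W\<^esub> y)\<close>
      by (simp add: proj_add pclosed proj_closed)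
  qed
  with f show "P x" by simp
qed

section \<open>The homomorphism on the quotient induced by evaluation\<close>

definition gen_image :: "('d, 'i) gwa_gen \<Rightarrow> ('i \<Rightarrow>\<^sub>0 int) \<Rightarrow> ('d \<times> 'd) set" where
  "gen_image y = (case y of Base d \<Rightarrow> pt 0 d
     | X_plus \<beta> \<Rightarrow> pt (Poly_Mapping.single \<beta> 1) \<one>\<^bsub>D\<^esub>
     | X_minus \<beta> \<Rightarrow> pt (Poly_Mapping.single \<beta> (- 1)) (a \<beta>))"

abbreviation "ev \<equiv> free_eval K B gen_image"

lemma gen_image_closed: "gen_image \<in> gens \<rightarrow> carrier B"
proof
  fix y assume "y \<in> gens"
  then show "gen_image y \<in> carrier B"
    by (cases y) (auto simp: gen_image_def gens_iff intro!: pt_closed G_zero G_single a_closed)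
qed

lemma ev_hom: "ev \<in> ring_hom F B"
  using BA.assoc_algebra_axioms gen_image_closed by (rule free_eval_ring_hom)

lemma ev_var:
  "d \<in> carrier D \<Longrightarrow> ev (v (Base d)) = pt 0 d"
  "\<beta> \<in> Field r \<Longrightarrow> ev (v (X_plus \<beta>)) = pt (Poly_Mapping.single \<beta> 1) \<one>\<^bsub>D\<^esub>"
  "\<beta> \<in> Field r \<Longrightarrow> ev (v (X_minus \<beta>)) = pt (Poly_Mapping.single \<beta> (- 1)) (a \<beta>)"
  using free_eval_var[OF BA.assoc_algebra_axioms gen_image_closed] by (simp_all add: gens_iff gen_image_def)

lemma ev_minus:
  assumes "x \<in> carrier F" "y \<in> carrier F" "ev x = ev y" shows "ev (x \<ominus>\<^bsub>F\<^esub> y) = \<zero>\<^bsub>B\<^esub>"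
proof -
  interpret ev: ring_hom_ring F B ev
    using FA.A.ring_axioms BA.A.ring_axioms ev_hom by (rule ring_hom_ringI2)
  show ?thesis using assms by (simp add: free.B.minus_eq twisted.B.r_neg)
qed

lemma single_cancel: "Poly_Mapping.single \<beta> (- 1 :: int) + Poly_Mapping.single \<beta> 1 = 0"
  "Poly_Mapping.single \<beta> (1 :: int) + Poly_Mapping.single \<beta> (- 1) = 0"
  by (simp_all flip: single_add)

text \<open>All products of generator images have the form d g^n, so comparing two sides reduces to
  equality of exponents and an identity in \<open>D\<close>.\<close>

lemma ev_relation_eqs:
  "\<lbrakk>d \<in> carrier D; e \<in> carrier D\<rbrakk> \<Longrightarrow> ev (v (Base (d \<oplus>\<^bsub>D\<^esub> e))) = ev (v (Base d) \<oplus>\<^bsub>F\<^esub> v (Base e))"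
  "\<lbrakk>d \<in> carrier D; e \<in> carrier D\<rbrakk> \<Longrightarrow> ev (v (Base (d \<otimes>\<^bsub>D\<^esub> e))) = ev (v (Base d) \<otimes>\<^bsub>F\<^esub> v (Base e))"
  "\<lbrakk>c \<in> carrier K; d \<in> carrier D\<rbrakk> \<Longrightarrow> ev (v (Base (c \<odot>\<^bsub>D\<^esub> d))) = ev (c \<odot>\<^bsub>F\<^esub> v (Base d))"
  "ev (v (Base \<one>\<^bsub>D\<^esub>)) = ev \<one>\<^bsub>F\<^esub>"
  "\<lbrakk>\<beta> \<in> Field r; d \<in> carrier D\<rbrakk> \<Longrightarrow> ev (v (X_plus \<beta>) \<otimes>\<^bsub>F\<^esub> v (Base d)) = ev (v (Base (\<sigma> \<beta> d)) \<otimes>\<^bsub>F\<^esub> v (X_plus \<beta>))"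
  "\<lbrakk>\<beta> \<in> Field r; d \<in> carrier D\<rbrakk> \<Longrightarrow> ev (v (X_minus \<beta>) \<otimes>\<^bsub>F\<^esub> v (Base d)) = ev (v (Base ((inv\<^bsub>Aut\<^esub> \<sigma> \<beta>) d)) \<otimes>\<^bsub>F\<^esub> v (X_minus \<beta>))"
  "\<lbrakk>\<beta> \<in> Field r; \<gamma> \<in> Field r; \<beta> \<noteq> \<gamma>\<rbrakk> \<Longrightarrow> ev (v (X_plus \<beta>) \<otimes>\<^bsub>F\<^esub> v (X_plus \<gamma>)) = ev (v (X_plus \<gamma>) \<otimes>\<^bsub>F\<^esub> v (X_plus \<beta>))"
  "\<lbrakk>\<beta> \<in> Field r; \<gamma> \<in> Field r; \<beta> \<noteq> \<gamma>\<rbrakk> \<Longrightarrow> ev (v (X_minus \<beta>) \<otimes>\<^bsub>F\<^esub> v (X_minus \<gamma>)) = ev (v (X_minus \<gamma>) \<otimes>\<^bsub>F\<^esub> v (X_minus \<beta>))"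
  "\<lbrakk>\<beta> \<in> Field r; \<gamma> \<in> Field r; \<beta> \<noteq> \<gamma>\<rbrakk> \<Longrightarrow> ev (v (X_plus \<beta>) \<otimes>\<^bsub>F\<^esub> v (X_minus \<gamma>)) = ev (v (X_minus \<gamma>) \<otimes>\<^bsub>F\<^esub> v (X_plus \<beta>))"
  "\<beta> \<in> Field r \<Longrightarrow> ev (v (X_minus \<beta>) \<otimes>\<^bsub>F\<^esub> v (X_plus \<beta>)) = ev (v (Base (a \<beta>)))"
  "\<beta> \<in> Field r \<Longrightarrow> ev (v (X_plus \<beta>) \<otimes>\<^bsub>F\<^esub> v (X_minus \<beta>)) = ev (v (Base (\<sigma> \<beta> (a \<beta>))))"
proof -
  note [simp] = var_closed gens_iff a_closed sigma_closed sigma_inv_closed ev_var pt_mult G_zero G_single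
    xi_zero alg_Aut_one xi_frag_of xi_inv ring_hom_one[OF xi_ring_hom] ring_hom_mult[OF ev_hom]
    ring_hom_add[OF ev_hom] ring_hom_one[OF ev_hom] pt_add pt_one pt_smult single_cancel
    ring_hom_one[OF alg_Aut_hom[OF Aut.inv_closed[OF sigma_aut]]] ring_hom_one[OF alg_Aut_hom[OF sigma_aut]]
    free_eval_smult[OF BA.assoc_algebra_axioms gen_image_closed]
  show "ev (v (Base (d \<oplus>\<^bsub>D\<^esub> e))) = ev (v (Base d) \<oplus>\<^bsub>F\<^esub> v (Base e))"
    "ev (v (Base (d \<otimes>\<^bsub>D\<^esub> e))) = ev (v (Base d) \<otimes>\<^bsub>F\<^esub> v (Base e))"
    if "d \<in> carrier D" "e \<in> carrier D" for d e using that by simp_all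
  show "ev (v (Base (c \<odot>\<^bsub>D\<^esub> d))) = ev (c \<odot>\<^bsub>F\<^esub> v (Base d))" if "c \<in> carrier K" "d \<in> carrier D" for c d
    using that by simp
  show "ev (v (Base \<one>\<^bsub>D\<^esub>)) = ev \<one>\<^bsub>F\<^esub>" by simp
  show "ev (v (X_plus \<beta>) \<otimes>\<^bsub>F\<^esub> v (Base d)) = ev (v (Base (\<sigma> \<beta> d)) \<otimes>\<^bsub>F\<^esub> v (X_plus \<beta>))"
    if "\<beta> \<in> Field r" "d \<in> carrier D" for \<beta> d using that by simp
  \<comment> \<open>The coefficient \<open>a \<beta>\<close> must change places with the twisted
    \<open>d\<close>, which is centrality of \<open>a \<beta>\<close>.\<close>
  show "ev (v (X_minus \<beta>) \<otimes>\<^bsub>F\<^esub> v (Base d)) = ev (v (Base ((inv\<^bsub>Aut\<^esub> \<sigma> \<beta>) d)) \<otimes>\<^bsub>F\<^esub> v (X_minus \<beta>))"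
    if "\<beta> \<in> Field r" "d \<in> carrier D" for \<beta> d
    using that S_comm[OF a_in_S[OF that(1)] sigma_inv_closed[OF that]] by simp
  show "\<beta> \<in> Field r \<Longrightarrow> ev (v (X_minus \<beta>) \<otimes>\<^bsub>F\<^esub> v (X_plus \<beta>)) = ev (v (Base (a \<beta>)))"
    "\<beta> \<in> Field r \<Longrightarrow> ev (v (X_plus \<beta>) \<otimes>\<^bsub>F\<^esub> v (X_minus \<beta>)) = ev (v (Base (\<sigma> \<beta> (a \<beta>))))" for \<beta>
    by simp_all
  fix \<beta> \<gamma> assume \<beta>: "\<beta> \<in> Field r" "\<gamma> \<in> Field r" "\<beta> \<noteq> \<gamma>"
  show "ev (v (X_plus \<beta>) \<otimes>\<^bsub>F\<^esub> v (X_plus \<gamma>)) = ev (v (X_plus \<gamma>) \<otimes>\<^bsub>F\<^esub> v (X_plus \<beta>))"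
    using \<beta> by (simp add: add.commute)
  \<comment> \<open>Each inverse automorphism fixes the coefficient of the other index, and the two
    coefficients commute.\<close>
  show "ev (v (X_minus \<beta>) \<otimes>\<^bsub>F\<^esub> v (X_minus \<gamma>)) = ev (v (X_minus \<gamma>) \<otimes>\<^bsub>F\<^esub> v (X_minus \<beta>))"
    using \<beta> S_comm[OF a_in_S[OF \<beta>(1)] a_closed[OF \<beta>(2)]] by (simp add: sigma_inv_fixes_a add.commute)
  \<comment> \<open>Only the left side twists \<open>a \<gamma>\<close>, by
    \<open>\<sigma> \<beta>\<close>, which fixes it.\<close>
  show "ev (v (X_plus \<beta>) \<otimes>\<^bsub>F\<^esub> v (X_minus \<gamma>)) = ev (v (X_minus \<gamma>) \<otimes>\<^bsub>F\<^esub> v (X_plus \<beta>))"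
    using \<beta> by (simp add: sigma_fixes_a add.commute)
qed

lemma ev_relations: "gwa_relations K D r \<sigma> a \<subseteq> {f \<in> carrier F. ev f = \<zero>\<^bsub>B\<^esub>}"
proof -
  note [simp] = var_closed gens_iff a_closed sigma_closed sigma_inv_closed
  have "ev f = \<zero>\<^bsub>B\<^esub>" if "f \<in> gwa_relations K D r \<sigma> a" for f
    by (insert that, unfold gwa_relations_def Let_def)
       (elim UnE CollectE exE conjE singletonE; hypsubst; rule ev_minus; (rule ev_relation_eqs; assumption)?; simp)
  then show ?thesis using relations_subset by blast
qed

text \<open>The kernel of evaluation is an ideal containing the relations, so it contains the ideal
  generated by them.\<close>

lemma ev_ideal: "f \<in> I \<Longrightarrow> ev f = \<zero>\<^bsub>B\<^esub>"
proof -
  interpret ev: ring_hom_ring F B ev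
    using FA.A.ring_axioms BA.A.ring_axioms ev_hom by (rule ring_hom_ringI2)
  have "gwa_relations K D r \<sigma> a \<subseteq> a_kernel F B ev"
    unfolding a_kernel_def' by (rule ev_relations)
  with ev.kernel_is_ideal have "I \<subseteq> a_kernel F B ev"
    unfolding gwa_ideal_def by (rule FA.A.genideal_minimal)
  then show "f \<in> I \<Longrightarrow> ev f = \<zero>\<^bsub>B\<^esub>" unfolding a_kernel_def' by blast
qed

text \<open>Evaluation is constant on each coset of the ideal, so its image of a coset is a
  singleton.\<close>

definition emb :: "(('d, 'i) gwa_gen list \<Rightarrow> 'k) set \<Rightarrow> ('i \<Rightarrow>\<^sub>0 int) \<Rightarrow> ('d \<times> 'd) set" where
  "emb C = the_elem (ev ` C)"

lemma emb_proj:
  assumes f: "f \<in> carrier F" shows "emb (proj f) = ev f"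
proof -
  have "ev g = ev f" if "g \<in> proj f" for g
    using that f ring_hom_closed[OF ev_hom f] ev_ideal I.Icarr
    by (auto simp: mem_proj ring_hom_add[OF ev_hom])
  moreover have "f \<in> proj f"
    unfolding mem_proj using I.zero_closed f by (intro bexI[of _ "\<zero>\<^bsub>F\<^esub>"]) simp_all
  ultimately have "ev ` proj f = {ev f}" by blast
  then show ?thesis by (simp add: emb_def)
qed

sublocale embedding: gwa_embedding K D r \<sigma> a W gb "\<lambda>\<beta>. proj (v (X_plus \<beta>))" "\<lambda>\<beta>. proj (v (X_minus \<beta>))" emb
proof (intro gwa_embedding.intro gwa_embedding_axioms.intro presented.gwa_presented_axioms)
  show "emb \<in> ring_hom W B"
  proof (rule ring_hom_memI)
    show "emb \<one>\<^bsub>W\<^esub> = \<one>\<^bsub>B\<^esub>" by (simp add: emb_proj ring_hom_one[OF ev_hom] flip: proj_one)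
    fix x assume "x \<in> carrier W"
    then obtain f where f: "f \<in> carrier F" "x = proj f" using proj_surj by blast
    then show "emb x \<in> carrier B" by (simp add: emb_proj ring_hom_closed[OF ev_hom])
    fix y assume "y \<in> carrier W"
    then obtain g where g: "g \<in> carrier F" "y = proj g" using proj_surj by blast
    show "emb (x \<otimes>\<^bsub>W\<^esub> y) = emb x \<otimes>\<^bsub>B\<^esub> emb y"
      using f g by (simp add: emb_proj ring_hom_mult[OF ev_hom] flip: proj_mult)
    show "emb (x \<oplus>\<^bsub>W\<^esub> y) = emb x \<oplus>\<^bsub>B\<^esub> emb y"
      using f g by (simp add: emb_proj ring_hom_add[OF ev_hom] flip: proj_add)
  qed
qed (simp_all add: gb_proj emb_proj var_closed gens_iff ev_var)

end

theorem theorem6p13: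
  fixes K :: "('k, 'm) ring_scheme" and D :: "('k, 'd, 'n) module_scheme"
    and r :: "'i rel" and \<sigma> :: "'i \<Rightarrow> 'd \<Rightarrow> 'd" and a :: "'i \<Rightarrow> 'd"
  assumes "gwa_data K D r \<sigma> a"
    and "gwa_regular D r a"
    and "gwa_surjective_type K D r \<sigma>"
  shows "let A = gwa K D r \<sigma> a;
             S = gwa_mult_set K D r \<sigma> a;
             S\<^sub>A = gwa_base K D r \<sigma> a ` S
         in sigma_stable K D r \<sigma> S
          \<and> left_denominator_set D S
          \<and> left_denominator_set A S\<^sub>A
          \<and> alg_isomorphic K
              (localization A S\<^sub>A)
              (skew_group_ring (localization D S) (free_Abelian_group (Field r))
                 (\<lambda>c. localization_map D S (gwa_xi K D r \<sigma> c)))"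
proof -
  interpret regular_gwa K D r \<sigma> a
    using assms by (intro regular_gwa.intro regular_gwa_axioms.intro)
  show ?thesis
    using sigma_stable_S left_denominator_set embedding.loc.left_denominator_set
      embedding.loc.localization_isomorphic
    unfolding Let_def L_def by blast
qed

end
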